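(* Let $m,k\ge 1$ be integers and let $\varphi(z)=-z^{-1}A_{-1}+I-A_0-zA_1$ be an $m\times m$ matrix function such that: (i) the $m\times m$ matrices $A_{-1},A_0,A_1$ are (entrywise) nonnegative and $I-\varphi(z)$ has spectral radius smaller than $1$ for any $z\in\mathbb T$; (ii) the matrices $A_i$ are $k$-quasiseparable and $\|A_i\|_2\le L$ for $i=-1,0,1$; (iii) there exist $t>1$ and $\delta>0$ such that $\det\varphi(z)\neq 0$ and $\|\varphi(z)^{-1}\|_2\le\delta$ for every $z\in\mathbb A:=\mathbb A(t^{-1},t)$. Partition $$\varphi(z)=\begin{bmatrix} I-E(z) & -B(z)\\ -C(z) & I-D(z)\end{bmatrix},\qquad \psi(z):=\varphi(z)^{-1}=\begin{bmatrix}\tilde E(z)&\tilde B(z)\\ \tilde C(z)&\tilde D(z)\end{bmatrix},$$ where $E(z),D(z)$ are square blocks of any compatible size (the two partitionings being conformal). Then $\rho(I-\varphi(z))<1$ for any $z\in\mathbb A$, and both blocks $I-E(z)$ and $I-D(z)$ are invertible for any $z\in\mathbb A$. Moreover, for any $z\in\mathbb T$ and any integer $h\ge 0$, the singular values of $\tilde C^{(h)}:=I_N(\tilde C)$, with $N=2^h$, satisfy $$\sigma_s(\tilde C^{(h)}(z))\le 3M\,e^{-\frac{s-3k}{6k}\log t},\qquad M=\frac{4L\delta^2}{(1-e^{-N\log t})(1-t^{-1})}.$$ Moreover, if $A_{-1},A_0,A_1$ are tridiagonal, then for any $z\in\mathbb T$ and any integer $h\ge 0$, with $N=2^h$ and the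 same constant $M=\frac{4L\delta^2}{(1-e^{-N\log t})(1-t^{-1})}$, the bound $\sigma_s(\tilde C^{(h)}(z))\le 3M\,e^{-\frac{s-3k}{6k}\log t}$ can be replaced by $$\sigma_s(\tilde C^{(h)}(z))\le M\,e^{-\frac{s}{2}\log t}.$$
   Context: $\mathbb T=\{z\in\mathbb C:|z|=1\}$ and, for $0<r_1<1<r_2$, $\mathbb A(r_1,r_2)=\{z\in\mathbb C: r_1<|z|<r_2\}$. $\rho$ denotes the spectral radius, $\|\cdot\|_2$ the spectral norm (induced by the Euclidean norm), and $\sigma_s(X)$ the $s$-th singular value of $X$ in non-increasing order. A square matrix is $k$-quasiseparable if the maximum of the ranks of its submatrices strictly contained in its upper triangular part or strictly contained in its lower triangular part is $k$ (so all such submatrices have rank at most $k$). Operator $I_N$: if $A(z)=\sum_{i\in\mathbb Z}z^iA_i$ is a matrix Laurent series analytic on $\mathbb A(r_1,r_2)$ and $N\ge 1$ is an integer, then $I_N(A)$ is the matrix Laurent series $B(z)=\sum_{i\in\mathbb Z}z^iA_{Ni}$, which is analytic on $\mathbb A(r_1^N,r_2^N)$; equivalently $B(z^N)=\frac1N\sum_{j=0}^{N-1}A(\omega_N^jz)$ with $\omega_N=e^{2\pi \mathrm{i}/N}$.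
   Formalization: The tridiagonal bound is stated only for s ≥ 2; for s = 1 it is false, e.g. m=2, k=1, L=1, A_0=e_2e_1^T, A_{-1}=A_1=10^{-8}e_2e_1^T, t=10^4, δ=1.62, where σ_1≈1 but the bound is about 0.11. *)

theory Defs
  imports
    "HOL-Analysis.Infinite_Sum"
    "HOL-Library.Nonpos_Ints"
    "Jordan_Normal_Form.Spectral_Radius"
    "Jordan_Normal_Form.Schur_Decomposition"
    "Jordan_Normal_Form.DL_Rank"
    "Jordan_Normal_Form.DL_Submatrix"
begin

definition annulus :: "real \<Rightarrow> real \<Rightarrow> complex set" where
  "annulus r1 r2 = {z. r1 < cmod z \<and> cmod z < r2}"

definition euclid_norm :: "complex vec \<Rightarrow> real" where
  "euclid_norm v = sqrt (\<Sum>i<dim_vec v. (cmod (v $ i))\<^sup>2)"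

definition spectral_norm :: "complex mat \<Rightarrow> real" where
  "spectral_norm A =
     (SUP v\<in>{v \<in> carrier_vec (dim_col A). euclid_norm v \<le> 1}. euclid_norm (A *\<^sub>v v))"

(* Square roots of the eigenvalues of X^* X, counted with algebraic multiplicity,
   in non-increasing order. *)
definition singular_values :: "complex mat \<Rightarrow> real list" where
  "singular_values X = rev (sorted_list_of_multiset
     (image_mset (\<lambda>\<mu>. sqrt (Re \<mu>)) (proots (char_poly (mat_adjoint X * X)))))"

(* Indices start at 1.  Singular values with an index beyond the size of X are 0;
   the list above has dim_col X entries, which agrees with this convention. *)
definition singular_value :: "nat \<Rightarrow> complex mat \<Rightarrow> real" (\<open>\<sigma>\<close>) where
  "\<sigma> s X = (if 1 \<le> s \<and> s \<le> length (singular_values X) then singular_values X ! (s - 1) else 0)"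

definition mat_rank :: "complex mat \<Rightarrow> nat" where
  "mat_rank A = vec_space.rank (dim_row A) A"

(* The submatrices lying strictly above or strictly below the diagonal.  Empty
   submatrices (of rank 0) are allowed, so that the set is nonempty even for m = 1. *)
definition off_diagonal_submatrices :: "complex mat \<Rightarrow> complex mat set" where
  "off_diagonal_submatrices A =
     {submatrix A I J | I J. I \<subseteq> {..<dim_row A} \<and> J \<subseteq> {..<dim_col A} \<and>
        ((\<forall>i\<in>I. \<forall>j\<in>J. i < j) \<or> (\<forall>i\<in>I. \<forall>j\<in>J. j < i))}"

definition quasiseparable_rank :: "complex mat \<Rightarrow> nat" where
  "quasiseparable_rank A = Max (mat_rank ` off_diagonal_submatrices A)"

(* All off-diagonal submatrices have rank at most k; attaining the value k is not required,
   so that several matrices may share the same k. *)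
definition quasiseparable :: "nat \<Rightarrow> complex mat \<Rightarrow> bool" where
  "quasiseparable k A \<longleftrightarrow> square_mat A \<and> quasiseparable_rank A \<le> k"

definition tridiagonal :: "complex mat \<Rightarrow> bool" where
  "tridiagonal A \<longleftrightarrow>
     (\<forall>i<dim_row A. \<forall>j<dim_col A. i + 1 < j \<or> j + 1 < i \<longrightarrow> A $$ (i, j) = 0)"

definition qbd_symbol :: "nat \<Rightarrow> (int \<Rightarrow> complex mat) \<Rightarrow> complex \<Rightarrow> complex mat" where
  "qbd_symbol m A z = - (inverse z \<cdot>\<^sub>m A (-1)) + 1\<^sub>m m - A 0 - z \<cdot>\<^sub>m A 1"

(* A matrix Laurent series is represented by its coefficient family, indexed by the integers. *)
definition laurent_series_on ::
  "real \<Rightarrow> real \<Rightarrow> nat \<Rightarrow> nat \<Rightarrow> (int \<Rightarrow> complex mat) \<Rightarrow> (complex \<Rightarrow> complex mat) \<Rightarrow> bool" where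
  "laurent_series_on r1 r2 p q c F \<longleftrightarrow>
     (\<forall>n. c n \<in> carrier_mat p q) \<and>
     (\<forall>z\<in>annulus r1 r2. F z \<in> carrier_mat p q \<and>
        (\<forall>i<p. \<forall>j<q. ((\<lambda>n. z powi n * c n $$ (i, j)) has_sum F z $$ (i, j)) UNIV))"

(* All coefficients are meant to have the same dimensions; they are read off the one of index 0. *)
definition laurent_eval :: "(int \<Rightarrow> complex mat) \<Rightarrow> complex \<Rightarrow> complex mat" where
  "laurent_eval c z =
     mat (dim_row (c 0)) (dim_col (c 0)) (\<lambda>(i, j). \<Sum>\<^sub>\<infinity>n. z powi n * c n $$ (i, j))"

definition I_op :: "nat \<Rightarrow> (int \<Rightarrow> complex mat) \<Rightarrow> int \<Rightarrow> complex mat" where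
  "I_op N c = (\<lambda>i. c (int N * i))"

end

theory Submission
  imports Defs "HOL-Analysis.L2_Norm" "HOL-Analysis.Elementary_Metric_Spaces"
begin

text \<open>
  Write \<open>\<alpha>(z) = I - \<phi>(z)\<close>, which is a Laurent polynomial with nonnegative coefficients, and \<open>x = 1 / t\<close>.
  On the real interval \<open>(x, t)\<close> the vector \<open>w = \<psi>(r) 1\<close> solves \<open>w = 1 + \<alpha>(r) w\<close>, so \<open>w \<ge> 0\<close> forces \<open>w \<ge> 1\<close>;
  by connectedness \<open>w \<ge> 1\<close> propagates from \<open>r = 1\<close> to the whole interval.  Thus \<open>\<alpha>(r) w < w\<close> with
  \<open>w > 0\<close>, which bounds the spectral radius of every matrix dominated by \<open>\<alpha>(r)\<close> and makes the Neumann
  series of \<open>\<alpha>(z)\<close> and of its diagonal blocks converge geometrically on the annulus.  In particular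
  \<open>\<psi>\<close> and \<open>(I - D)\<^sup>-\<^sup>1\<close> have Laurent expansions with nonnegative coefficients, and \<open>(I - D)\<^sup>-\<^sup>1\<close> is
  dominated at real points by a block of \<open>\<psi>\<close>, hence is bounded by \<open>\<delta>\<close> as well.

  For \<open>z = \<zeta>\<^sup>N\<close>, the identity \<open>C' = (I - D)\<^sup>-\<^sup>1 C E'\<close> for the left blocks \<open>E'\<close>, \<open>C'\<close> of \<open>\<psi>\<close> turns
  \<open>I\<^sub>N(C')(z)\<close> into the sum of \<open>\<zeta>\<^sup>l X(p) C\<^sub>l Y(q)\<close> over residues with \<open>l + p + q \<equiv> 0\<close> modulo \<open>N\<close>, where
  \<open>X(p)\<close> and \<open>Y(q)\<close> collect the terms of the two outer factors with exponents in one residue class.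
  Keeping the residues \<open>q\<close> within distance \<open>j\<close> of \<open>0\<close> gives a matrix of small rank.  The rest is estimated
  as a bilinear form with the Cauchy-Schwarz inequality over \<open>q\<close>: by nonnegativity the squared norms of
  \<open>Y(q) v\<close> sum to at most \<open>\<delta>\<^sup>2 |v|\<^sup>2\<close>, and to at most \<open>(2 x\<^sup>j\<^sup>+\<^sup>1 \<delta> |v|)\<^sup>2\<close> over the residues left out.
  In the tridiagonal case both factors decay, which compensates for the three values of \<open>l\<close>.
\<close>

subsection \<open>Unitary triangularization\<close>

text \<open>Singular values are defined here through the characteristic polynomial of the Gram
  matrix, so rank arguments first need an orthonormal eigenbasis with the eigenvalues in decreasing
  order; the unitary triangularization supplies it. The factorization of C' through (I - D)^-1 and
  E' is chosen because the only available bound \<delta> concerns \<psi>: E' is a block of \<psi>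
  and (I - D)^-1 is dominated by one, so both outer factors inherit it. Norms are handled as
  bilinear forms, which behave well under entrywise domination, blocks and sums over residues.
  Cauchy-Schwarz over residues is the economical choice: adding up the norms of single terms would
  cost a geometric series, while nonnegativity bounds a square sum by the square of a value at a
  real point. In the tridiagonal case the factor 3 is no longer available, although three values of
  l contribute. A kept residue then costs rank one only, and the half power of x that is missing for
  odd s has to be won from the left factor.\<close>

lemma mat_adjoint_eq:
  "mat_adjoint (A :: complex mat) = mat (dim_col A) (dim_row A) (\<lambda>(i, j). cnj (A $$ (j, i)))"
  unfolding mat_adjoint_def by (rule eq_matI) (auto simp: mat_of_rows_index)

lemma mat_adjoint_carrier [simp]:
  "(A :: complex mat) \<in> carrier_mat n k \<Longrightarrow> mat_adjoint A \<in> carrier_mat k n"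
  by (auto simp: mat_adjoint_eq)

lemma mat_adjoint_mult:
  assumes "(A :: complex mat) \<in> carrier_mat n k" and "B \<in> carrier_mat k l"
  shows "mat_adjoint (A * B) = mat_adjoint B * mat_adjoint A"
  using assms by (intro eq_matI) (auto simp: mat_adjoint_eq scalar_prod_def mult.commute)

lemma mat_adjoint_adjoint [simp]: "mat_adjoint (mat_adjoint (A :: complex mat)) = A"
  by (auto simp: mat_adjoint_eq)

text \<open>Gram-Schmidt applied to a basis that starts with v, followed by division by the norms.
  The first vector stays a multiple of v, so an eigenvector placed first remains one.\<close>

lemma unitary_completion:
  fixes v :: "complex vec"
  assumes v: "v \<in> carrier_vec n" and v0: "v \<noteq> 0\<^sub>v n"
  obtains c ws where "c \<noteq> 0" "set ws \<subseteq> carrier_vec n" "corthogonal ws" "length ws = n"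
    "hd ws = c \<cdot>\<^sub>v v" "\<And>u. u \<in> set ws \<Longrightarrow> u \<bullet>c u = 1"
proof -
  interpret cof_vec_space n "TYPE(complex)" .
  define b where "b = basis_completion v"
  from basis_completion[OF v v0, folded b_def]
  have dist_b: "distinct b" and indep: "\<not> lin_dep (set b)" and b: "set b \<subseteq> carrier_vec n"
    and hdb: "hd b = v" and len_b: "length b = n" by auto
  have n: "n \<noteq> 0" using v v0 by auto
  from hdb len_b n obtain vs where bv: "b = v # vs" by (cases b) auto
  define us where "us = gram_schmidt n b"
  from gram_schmidt_result[OF b dist_b indep refl, folded us_def]
  have us: "set us \<subseteq> carrier_vec n" "corthogonal us" "length us = n"
    by (auto simp: len_b)
  from gram_schmidt_hd[OF v, of vs, folded bv] have hdus: "hd us = v" unfolding us_def .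
  define r where "r u = complex_of_real (1 / sqrt (Re (u \<bullet>c u)))" for u :: "complex vec"
  have self: "u \<bullet>c u = complex_of_real (Re (u \<bullet>c u))" "Re (u \<bullet>c u) > 0" if "u \<in> set us" for u
  proof -
    from that obtain i where i: "i < length us" "u = us ! i" by (auto simp: in_set_conv_nth)
    have "u \<bullet>c u \<noteq> 0" using corthogonalD[OF us(2) i(1) i(1)] i by auto
    moreover have "u \<bullet>c u \<ge> 0"
      using conjugate_square_ge_0_vec by blast
    ultimately show "u \<bullet>c u = complex_of_real (Re (u \<bullet>c u))" "Re (u \<bullet>c u) > 0"
      by (auto simp: less_eq_complex_def complex_eq_iff)
  qed
  have r0: "r u \<noteq> 0" if "u \<in> set us" for u
    using self(2)[OF that] by (auto simp: r_def)
  define ws where "ws = map (\<lambda>u. r u \<cdot>\<^sub>v u) us"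
  have sp: "(a \<cdot>\<^sub>v u) \<bullet>c (b \<cdot>\<^sub>v w) = a * cnj b * (u \<bullet>c w)"
    if "u \<in> carrier_vec n" "w \<in> carrier_vec n" for a b and u w :: "complex vec"
    using that by (auto simp: scalar_prod_def sum_distrib_left algebra_simps intro!: sum.cong)
  show ?thesis
  proof (rule that[of "r v" ws])
    have vin: "v \<in> set us" using hdus us(3) n by (cases us) auto
    show "r v \<noteq> 0" by (rule r0[OF vin])
    show "set ws \<subseteq> carrier_vec n" using us(1) by (auto simp: ws_def)
    show "length ws = n" using us by (simp add: ws_def)
    show "hd ws = r v \<cdot>\<^sub>v v" using hdus us(3) n by (cases us) (auto simp: ws_def)
    show "corthogonal ws"
    proof (rule corthogonalI)
      fix i j assume ij: "i < length ws" "j < length ws"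
      hence ij': "i < length us" "j < length us" by (auto simp: ws_def)
      hence m: "us ! i \<in> set us" "us ! j \<in> set us" by auto
      show "(ws ! i \<bullet>c ws ! j = 0) = (i \<noteq> j)"
        using corthogonalD[OF us(2) ij'] r0[OF m(1)] r0[OF m(2)] us(1) m ij'
        by (auto simp: ws_def sp subset_iff)
    qed
    fix u assume "u \<in> set ws"
    then obtain u' where u': "u' \<in> set us" "u = r u' \<cdot>\<^sub>v u'" by (auto simp: ws_def)
    have "u \<bullet>c u = r u' * cnj (r u') * complex_of_real (Re (u' \<bullet>c u'))"
      using sp[of u' u' "r u'" "r u'"] u' us(1) self(1)[OF u'(1)] by auto
    also have "\<dots> = complex_of_real (1 / sqrt (Re (u' \<bullet>c u')) * (1 / sqrt (Re (u' \<bullet>c u'))) * Re (u' \<bullet>c u'))"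
      by (simp only: r_def complex_cnj_complex_of_real of_real_mult)
    also have "\<dots> = 1"
      using self(2)[OF u'(1)] by (subst of_real_eq_1_iff) (simp add: field_simps)
    finally show "u \<bullet>c u = 1" .
  qed
qed

text \<open>The similarity produced by \<open>schur_decomposition\<close> is not unitary, since its columns are not normalized;
  this is the same induction with normalized columns.\<close>

theorem unitary_schur:
  fixes A :: "complex mat"
  assumes A: "A \<in> carrier_mat n n" and c: "char_poly A = (\<Prod>e\<leftarrow>es. [:- e, 1:])"
  shows "\<exists>B U. similar_mat_wit A B U (mat_adjoint U) \<and> upper_triangular B \<and> diag_mat B = es"
  using assms
proof (induct es arbitrary: n A)
  case Nil
  with degree_monic_char_poly[of A n] have n: "n = 0" by auto
  hence "mat_adjoint (1\<^sub>m n :: complex mat) = 1\<^sub>m n" by (auto simp: mat_adjoint_eq)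
  with Nil(1) n show ?case
    by (intro exI[of _ A] exI[of _ "1\<^sub>m n"]) (auto intro: similar_mat_wit_refl simp: diag_mat_def)
next
  case (Cons e es n A)
  let ?n1 = "n - 1"
  from Cons have A: "A \<in> carrier_mat n n" by auto
  from Cons(3) have cp: "char_poly A = [: -e, 1 :] * (\<Prod>e\<leftarrow>es. [:- e, 1:])" by auto
  have mon: "monic (\<Prod>e\<leftarrow>es. [:- e, 1:])" by (rule monic_prod_list) auto
  have "degree (char_poly A) = Suc (degree (\<Prod>e\<leftarrow>es. [:- e, 1:]))" unfolding cp
    by (subst degree_mult_eq, insert mon, auto)
  with degree_monic_char_poly[OF A] have n: "n \<noteq> 0" by auto
  have "eigenvalue A e" unfolding eigenvalue_root_char_poly[OF A] cp by simp
  from find_eigenvector[OF A this] obtain v where "eigenvector A v e" by blast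
  hence v: "v \<in> carrier_vec n" "v \<noteq> 0\<^sub>v n" "A *\<^sub>v v = e \<cdot>\<^sub>v v"
    using A unfolding eigenvector_def by auto
  obtain c ws where c0: "c \<noteq> 0" and ws: "set ws \<subseteq> carrier_vec n" "corthogonal ws" "length ws = n"
    and hdws: "hd ws = c \<cdot>\<^sub>v v" and unit: "\<And>u. u \<in> set ws \<Longrightarrow> u \<bullet>c u = 1"
    using unitary_completion[OF v(1,2)] by metis
  have eigen: "A *\<^sub>v (c \<cdot>\<^sub>v v) = e \<cdot>\<^sub>v (c \<cdot>\<^sub>v v)"
    using v A by (auto simp: mult_mat_vec smult_smult_assoc mult.commute)
  have cv: "c \<cdot>\<^sub>v v \<in> carrier_vec n" "c \<cdot>\<^sub>v v \<noteq> 0\<^sub>v n"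
    using v c0 by (auto simp: vec_eq_iff)
  define W where "W = mat_of_cols n ws"
  define W' where "W' = mat_adjoint W"
  have W: "W \<in> carrier_mat n n" using ws unfolding W_def by auto
  \<comment> \<open>\<open>corthogonal_inv\<close> divides each conjugated column by its squared
    norm; for unit columns nothing is divided, so this inverse is the adjoint.\<close>
  have W'alt: "W' = corthogonal_inv W"
  proof -
    have "vec_inv (col W i) = conjugate (col W i)" if "i < n" for i
      using that ws unit[of "ws ! i"]
      by (auto simp: vec_inv_def W_def col_mat_of_cols subset_iff)
    thus ?thesis using W
      unfolding W'_def mat_adjoint_def corthogonal_inv_def cols_def map_map
      by (intro arg_cong2[where f = mat_of_rows]) auto
  qed
  define A' where "A' = W' * A * W"
  have orth_W: "corthogonal_mat W" using orthogonal_mat_of_cols ws unfolding W_def .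
  have W': "W' \<in> carrier_mat n n" using W by (simp add: W'_def)
  from corthogonal_inv_result[OF orth_W] have W'W: "inverts_mat W' W" unfolding W'alt .
  hence WW': "inverts_mat W W'" using mat_mult_left_right_inverse[OF W' W] W' W
    unfolding inverts_mat_def by auto
  have A': "A' \<in> carrier_mat n n" using W W' A unfolding A'_def by auto
  have A'A_wit: "similar_mat_wit A' A W' W"
    by (rule similar_mat_witI[of _ _ n], insert W W' A A' W'W WW', auto simp: A'_def inverts_mat_def)
  hence A'A: "similar_mat A' A" unfolding similar_mat_def by blast
  from similar_mat_wit_sym[OF A'A_wit] have simAA': "similar_mat_wit A A' W W'" by auto
  let ?f = "\<lambda>i. if i = 0 then e else 0"
  have col0: "col A' 0 = vec n ?f"
    unfolding A'_def W'alt W_def using corthogonal_col_ev_0[OF A cv eigen n hdws ws] .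
  obtain A1 A2 A0 A3 where splitA': "split_block A' 1 1 = (A1,A2,A0,A3)"
    by (cases "split_block A' 1 1") auto
  from A' n have "dim_row A' = 1 + ?n1" "dim_col A' = 1 + ?n1" by auto
  from split_block[OF splitA' this] have A2: "A2 \<in> carrier_mat 1 ?n1"
    and A3: "A3 \<in> carrier_mat ?n1 ?n1"
    and A'block: "A' = four_block_mat A1 A2 A0 A3" by auto
  have A1id: "A1 = mat 1 1 (\<lambda>_. e)"
    using splitA'[unfolded split_block_def Let_def] arg_cong[OF col0, of "\<lambda>v. v $ 0"] A' n
    by (auto simp: col_def)
  have A1: "A1 \<in> carrier_mat 1 1" unfolding A1id by auto
  have "A' $$ (Suc i, 0) = 0" if "i < ?n1" for i
    using that arg_cong[OF col0, of "\<lambda>v. v $ Suc i"] A' by auto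
  hence A0id: "A0 = 0\<^sub>m ?n1 1"
    using splitA'[unfolded split_block_def Let_def] A' by auto
  have A0: "A0 \<in> carrier_mat ?n1 1" unfolding A0id by auto
  from cp char_poly_similar[OF A'A]
  have cp: "char_poly A' = [: -e,1 :] * (\<Prod>e\<leftarrow>es. [:- e, 1:])" by simp
  also have "char_poly A' = char_poly A1 * char_poly A3"
    unfolding A'block A0id by (rule char_poly_four_block_zeros_col[OF A1 A2 A3])
  also have "char_poly A1 = [: -e,1 :]"
    by (simp add: A1id char_poly_defs det_def sign_def)
  finally have cp: "char_poly A3 = (\<Prod>e\<leftarrow>es. [:- e, 1:])"
    by (metis mult_cancel_left pCons_eq_0_iff zero_neq_one)
  from Cons(1)[OF A3 cp] obtain B P' where simIH: "similar_mat_wit A3 B P' (mat_adjoint P')"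
    and ut: "upper_triangular B" and diag: "diag_mat B = es" by blast
  let ?P' = "four_block_mat (1\<^sub>m 1) (0\<^sub>m 1 ?n1) (0\<^sub>m ?n1 1) P'"
  let ?Q' = "four_block_mat (1\<^sub>m 1) (0\<^sub>m 1 ?n1) (0\<^sub>m ?n1 1) (mat_adjoint P')"
  from similar_mat_witD2[OF A3 simIH]
  have B: "B \<in> carrier_mat ?n1 ?n1" and P': "P' \<in> carrier_mat ?n1 ?n1"
    and Q': "mat_adjoint P' \<in> carrier_mat ?n1 ?n1"
    and PQ': "P' * mat_adjoint P' = 1\<^sub>m ?n1" by auto
  \<comment> \<open>Bordering by 1 commutes with the adjoint, so the inverse in the composed
    similarity is again an adjoint.\<close>
  have adj: "?Q' = mat_adjoint ?P'"
    using P' by (intro eq_matI) (auto simp: mat_adjoint_eq)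
  have A2_eq: "A2 * P' * mat_adjoint P' = A2"
    using PQ' A2 by (simp add: assoc_mult_mat[OF A2 P' Q'])
  define C where "C = four_block_mat A1 (A2 * P') A0 B"
  have A0_eq: "A0 = P' * A0 * 1\<^sub>m 1" unfolding A0id using P' by auto
  have simA'C: "similar_mat_wit A' C ?P' ?Q'" unfolding A'block C_def
    by (rule similar_mat_wit_four_block[OF similar_mat_wit_refl[OF A1] simIH _ A0_eq A1 A3 A0],
      insert PQ' A2 P' Q' A2_eq, auto)
  have ut1: "upper_triangular A1" unfolding A1id by auto
  have ut: "upper_triangular C" unfolding C_def A0id
    by (intro upper_triangular_four_block[OF _ B ut1 ut], auto simp: A1id)
  from A1id have diagA1: "diag_mat A1 = [e]" unfolding diag_mat_def by auto
  from diag_four_block_mat[OF A1 B] have diag: "diag_mat C = e # es"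
    unfolding diag diagA1 C_def by simp
  have P'c: "?P' \<in> carrier_mat n n" using P' n by (metis One_nat_def Suc_pred four_block_carrier_mat neq0_conv one_carrier_mat plus_1_eq_Suc)
  have "mat_adjoint (W * ?P') = ?Q' * W'"
    unfolding adj W'_def by (rule mat_adjoint_mult[OF W P'c])
  with similar_mat_wit_trans[OF simAA' simA'C]
  have "similar_mat_wit A C (W * ?P') (mat_adjoint (W * ?P'))" by simp
  with ut diag show ?case by blast
qed

subsection \<open>Singular values and low-rank approximation\<close>

definition vnorm :: "nat \<Rightarrow> (nat \<Rightarrow> complex) \<Rightarrow> real" where
  "vnorm n v = L2_set (\<lambda>i. cmod (v i)) {..<n}"

text \<open>For \<open>c \<ge> 0\<close> this says that the operator norm of K is at most c. The
  vector y carries no conjugate, since it ranges over all vectors anyway.\<close>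

definition form_bound :: "nat \<Rightarrow> nat \<Rightarrow> (nat \<Rightarrow> nat \<Rightarrow> complex) \<Rightarrow> real \<Rightarrow> bool" where
  "form_bound a b K c \<longleftrightarrow>
     (\<forall>y v. cmod (\<Sum>i<a. \<Sum>j<b. y i * K i j * v j) \<le> c * vnorm a y * vnorm b v)"

lemma vnorm_nonneg [simp]: "vnorm n v \<ge> 0"
  by (simp add: vnorm_def)

lemma vnorm_square: "(vnorm n v)\<^sup>2 = (\<Sum>i<n. (cmod (v i))\<^sup>2)"
  by (simp add: vnorm_def L2_set_def sum_nonneg)

text \<open>The eigenvalues are kept together with their order, because \<open>unitary_schur\<close>
  puts a prescribed list on the diagonal and the s-th singular value has to belong to the s-th
  column.\<close>

lemma singular_values_eq:
  assumes X: "X \<in> carrier_mat a b"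
  obtains es where "length es = b" "char_poly (mat_adjoint X * X) = (\<Prod>e\<leftarrow>es. [:- e, 1:])"
    "singular_values X = map (\<lambda>\<mu>. sqrt (Re \<mu>)) es" "sorted (rev (map (\<lambda>\<mu>. sqrt (Re \<mu>)) es))"
proof -
  define f where "f = (\<lambda>\<mu>. sqrt (Re \<mu>))"
  have H: "mat_adjoint X * X \<in> carrier_mat b b"
    by (rule mult_carrier_mat[OF mat_adjoint_carrier[OF X] X])
  obtain as where as: "char_poly (mat_adjoint X * X) = (\<Prod>a\<leftarrow>as. [:- a, 1:])" "length as = b"
    using char_poly_factorized[OF H] by blast
  define es where "es = rev (sort_key f as)"
  have pr: "proots (\<Prod>a\<leftarrow>as. [:- a, 1:]) = mset as" for as :: "complex list"
  proof (induction as)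
    case (Cons a as)
    have "(\<Prod>a\<leftarrow>as. [:- a, 1:]) \<noteq> 0" by (auto simp: prod_list_zero_iff)
    with Cons show ?case
      by (simp add: proots_mult del: mult_pCons_left mult_pCons_right)
  qed simp
  have "image_mset f (proots (char_poly (mat_adjoint X * X))) = mset (map f as)"
    unfolding as pr by simp
  hence "singular_values X = rev (sort (map f as))"
    by (simp add: singular_values_def f_def flip: mset_map)
  also have "sort (map f as) = map f (sort_key f as)"
    by (rule properties_for_sort) simp_all
  finally have 1: "singular_values X = map f es" by (simp add: es_def rev_map)
  have "(\<Prod>a\<leftarrow>as. [:- a, 1:]) = (\<Prod>a\<leftarrow>es. [:- a, 1:])"
    by (simp add: es_def flip: prod_mset_prod_list)
  with as 1 show ?thesis
    by (intro that[of es]) (auto simp: es_def f_def rev_map)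
qed

text \<open>The r equations in s > r unknowns are padded with zero rows to a square matrix. Its row
  r is zero, so the transpose kills a unit vector and the determinant vanishes.\<close>

lemma underdetermined_kernel:
  fixes G :: "nat \<Rightarrow> nat \<Rightarrow> complex"
  assumes "r < s"
  obtains w where "\<exists>i<s. w i \<noteq> 0" "\<And>e. e < r \<Longrightarrow> (\<Sum>i<s. G e i * w i) = 0"
proof -
  define M where "M = mat s s (\<lambda>(e, i). if e < r then G e i else 0)"
  have M: "M \<in> carrier_mat s s" by (simp add: M_def)
  have "M\<^sup>T *\<^sub>v unit_vec s r = 0\<^sub>v s"
    using assms by (intro eq_vecI) (auto simp: M_def)
  hence "Determinant.det M\<^sup>T = 0"
    using assms M by (subst det_0_iff_vec_prod_zero[of _ s]) (auto intro!: exI[of _ "unit_vec s r"])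
  hence "Determinant.det M = 0" by (simp add: det_transpose[OF M])
  then obtain v where v: "v \<in> carrier_vec s" "v \<noteq> 0\<^sub>v s" "M *\<^sub>v v = 0\<^sub>v s"
    using det_0_iff_vec_prod_zero[OF M] by blast
  show ?thesis
  proof (rule that[of "\<lambda>i. v $ i"])
    show "\<exists>i<s. v $ i \<noteq> 0" using v by (auto simp: vec_eq_iff)
    fix e assume e: "e < r"
    hence "(M *\<^sub>v v) $ e = 0" using v assms by auto
    thus "(\<Sum>i<s. G e i * v $ i) = 0"
      using e assms v by (simp add: M_def scalar_prod_def lessThan_atLeast0)
  qed
qed

lemma cscalar_adjoint:
  fixes M :: "complex mat"
  assumes "M \<in> carrier_mat a b" "v \<in> carrier_vec b" "u \<in> carrier_vec a"
  shows "(M *\<^sub>v v) \<bullet>c u = v \<bullet>c (mat_adjoint M *\<^sub>v u)"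
proof -
  have "(M *\<^sub>v v) \<bullet>c u = (\<Sum>i<a. (\<Sum>j<b. M $$ (i, j) * v $ j) * cnj (u $ i))"
    using assms by (simp add: scalar_prod_def lessThan_atLeast0)
  also have "\<dots> = (\<Sum>j<b. v $ j * cnj (\<Sum>i<a. cnj (M $$ (i, j)) * u $ i))"
    by (simp add: sum_distrib_left sum_distrib_right, subst sum.swap)
      (simp add: mult_ac)
  also have "\<dots> = v \<bullet>c (mat_adjoint M *\<^sub>v u)"
    using assms by (simp add: scalar_prod_def lessThan_atLeast0 mat_adjoint_eq)
  finally show ?thesis .
qed

lemma cscalar_self: "v \<in> carrier_vec n \<Longrightarrow> v \<bullet>c v = complex_of_real ((vnorm n (\<lambda>i. v $ i))\<^sup>2)"
  unfolding vnorm_square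
  by (simp add: scalar_prod_def lessThan_atLeast0 flip: complex_norm_square)

text \<open>The easy half of Eckart-Young: the s leading right singular vectors span a space on
  which X stretches by at least the s-th singular value, and the r < s conditions Q v = 0 leave a
  nonzero v in it. On this v the matrix X agrees with Y.\<close>

theorem singular_value_le:
  assumes X: "X \<in> carrier_mat a b" and s: "s \<ge> 1" and r: "r < s"
    and dec: "\<And>i j. i < a \<Longrightarrow> j < b \<Longrightarrow> X $$ (i, j) = (\<Sum>e<r. P i e * Q e j) + Y i j"
    and Y: "form_bound a b Y \<epsilon>" and \<epsilon>: "\<epsilon> \<ge> 0"
  shows "\<sigma> s X \<le> \<epsilon>"
proof -
  define H where "H = mat_adjoint X * X"
  define f where "f = (\<lambda>\<mu>. sqrt (Re \<mu>))"
  have H: "H \<in> carrier_mat b b"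
    unfolding H_def by (rule mult_carrier_mat[OF mat_adjoint_carrier[OF X] X])
  obtain es where es: "length es = b" "char_poly H = (\<Prod>e\<leftarrow>es. [:- e, 1:])"
    "singular_values X = map f es" and sorted: "sorted (rev (map f es))"
    using singular_values_eq[OF X] unfolding H_def f_def by metis
  show ?thesis
  \<comment> \<open>The negative case contains the indices beyond the list, where the singular value
    is 0 by convention, and the entries that are not positive.\<close>
  proof (cases "s \<le> b \<and> f (es ! (s - 1)) > 0")
    case False
    thus ?thesis using es s \<epsilon> by (auto simp: singular_value_def)
  next
    case True
    define \<mu> where "\<mu> = Re (es ! (s - 1))"
    have \<mu>: "\<mu> > 0" using True by (auto simp: \<mu>_def f_def)
    have \<sigma>: "\<sigma> s X = sqrt \<mu>" using True es s by (auto simp: singular_value_def f_def \<mu>_def)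
    have ge: "Re (es ! i) \<ge> \<mu>" if "i < s" for i
    proof -
      have "f (es ! (s - 1)) \<le> f (es ! i)"
        using sorted_rev_nth_mono[OF sorted, of i "s - 1"] that True es by auto
      thus ?thesis by (simp add: f_def \<mu>_def)
    qed
    obtain B U where sim: "similar_mat_wit H B U (mat_adjoint U)" and ut: "upper_triangular B"
      and diag: "diag_mat B = es"
      using unitary_schur[OF H es(2)] by blast
    from similar_mat_witD2[OF H sim]
    have U: "U \<in> carrier_mat b b" and B: "B \<in> carrier_mat b b"
      and UU: "mat_adjoint U * U = 1\<^sub>m b" by auto
    note HB = similar_mat_witD2(3)[OF H sim]
    have U': "mat_adjoint U \<in> carrier_mat b b" using U by simp
    have "B = mat_adjoint U * H * U"
      using similar_mat_witD2(3)[OF B similar_mat_wit_sym[OF sim]] .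
    moreover have "mat_adjoint H = H"
      unfolding H_def using X by (subst mat_adjoint_mult[of _ b a _ b]) auto
    ultimately have BB: "mat_adjoint B = B"
      using U U' H by (simp add: mat_adjoint_mult[of _ b b _ b] assoc_mult_mat[of _ b b _ b _ b])
    \<comment> \<open>A triangular matrix that equals its adjoint is diagonal.\<close>
    have off: "B $$ (i, j) = 0" if "i < b" "j < b" "i \<noteq> j" for i j
    proof (cases "j < i")
      case True thus ?thesis using ut that B by auto
    next
      case False
      hence "B $$ (j, i) = 0" using ut that B by auto
      moreover have "B $$ (i, j) = cnj (B $$ (j, i))"
        using that B by (subst BB[symmetric]) (simp add: mat_adjoint_eq)
      ultimately show ?thesis by simp
    qed
    have dg: "B $$ (i, i) = es ! i" if "i < b" for i
      using that B by (simp add: diag[symmetric] diag_mat_def)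
    \<comment> \<open>w holds the coordinates of v in the first s columns of U; the equations say
      that Q annihilates v.\<close>
    obtain w where w0: "\<exists>i<s. w i \<noteq> 0"
      and w: "\<And>e. e < r \<Longrightarrow> (\<Sum>i<s. (\<Sum>j<b. Q e j * U $$ (j, i)) * w i) = 0"
      using underdetermined_kernel[OF r, of "\<lambda>e i. \<Sum>j<b. Q e j * U $$ (j, i)"] by blast
    define w' where "w' = vec b (\<lambda>i. if i < s then w i else 0)"
    have w': "w' \<in> carrier_vec b" by (simp add: w'_def)
    define v where "v = U *\<^sub>v w'"
    have v: "v \<in> carrier_vec b" using U w' by (simp add: v_def)
    define x where "x = X *\<^sub>v v"
    have x: "x \<in> carrier_vec a" using X v by (simp add: x_def)
    have vw: "v $ j = (\<Sum>i<s. U $$ (j, i) * w i)" if "j < b" for j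
    proof -
      have "v $ j = (\<Sum>i<b. U $$ (j, i) * (if i < s then w i else 0))"
        using that U by (simp add: v_def w'_def scalar_prod_def lessThan_atLeast0)
      also have "\<dots> = (\<Sum>i<s. U $$ (j, i) * w i)"
        using True by (intro sum.mono_neutral_cong_right) auto
      finally show ?thesis .
    qed
    have Qv: "(\<Sum>j<b. Q e j * v $ j) = 0" if "e < r" for e
    proof -
      have "(\<Sum>j<b. Q e j * v $ j) = (\<Sum>j<b. \<Sum>i<s. Q e j * U $$ (j, i) * w i)"
        by (simp add: vw sum_distrib_left mult.assoc)
      also have "\<dots> = 0"
        using w[OF that] by (subst sum.swap) (simp add: sum_distrib_right)
      finally show ?thesis .
    qed
    have xi: "x $ i = (\<Sum>j<b. Y i j * v $ j)" if "i < a" for i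
    proof -
      have "x $ i = (\<Sum>j<b. X $$ (i, j) * v $ j)"
        using that X v by (simp add: x_def scalar_prod_def lessThan_atLeast0)
      also have "\<dots> = (\<Sum>j<b. \<Sum>e<r. P i e * (Q e j * v $ j)) + (\<Sum>j<b. Y i j * v $ j)"
        using that by (simp add: dec algebra_simps sum.distrib sum_distrib_left)
      also have "(\<Sum>j<b. \<Sum>e<r. P i e * (Q e j * v $ j)) = 0"
        using Qv by (subst sum.swap) (simp flip: sum_distrib_left)
      finally show ?thesis by simp
    qed
    let ?x = "vnorm a (\<lambda>i. x $ i)" and ?v = "vnorm b (\<lambda>i. v $ i)"
    \<comment> \<open>The form of Y is tested with y the conjugate of X v, which turns it into a
      squared norm.\<close>
    have "?x\<^sup>2 = cmod (complex_of_real (?x\<^sup>2))" by (simp only: norm_of_real) simp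
    also have "complex_of_real (?x\<^sup>2) = (\<Sum>i<a. cnj (x $ i) * x $ i)"
      unfolding vnorm_square of_real_sum
      by (intro sum.cong refl) (metis complex_norm_square mult.commute of_real_power)
    also have "\<dots> = (\<Sum>i<a. \<Sum>j<b. cnj (x $ i) * Y i j * v $ j)"
      by (intro sum.cong refl) (auto simp: xi sum_distrib_left mult.assoc)
    also have "cmod \<dots> \<le> \<epsilon> * vnorm a (\<lambda>i. cnj (x $ i)) * ?v"
      by (rule Y[unfolded form_bound_def, rule_format, of "\<lambda>i. cnj (x $ i)" "\<lambda>j. v $ j"])
    also have "vnorm a (\<lambda>i. cnj (x $ i)) = ?x" by (simp add: vnorm_def)
    finally have "?x * ?x \<le> ?x * (\<epsilon> * ?v)" by (simp add: power2_eq_square mult_ac)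
    hence le: "?x \<le> \<epsilon> * ?v"
      using \<epsilon> by (cases "?x = 0") (auto simp: mult_le_cancel_left less_le)
    have UUw: "mat_adjoint U *\<^sub>v (U *\<^sub>v u) = u" if "u \<in> carrier_vec b" for u
      using that by (simp add: assoc_mult_mat_vec[OF U' U that, symmetric] UU)
    have "H *\<^sub>v v = (U * B) *\<^sub>v (mat_adjoint U *\<^sub>v v)"
      unfolding HB using U B U' v by (intro assoc_mult_mat_vec) auto
    also have "\<dots> = U *\<^sub>v (B *\<^sub>v w')"
      unfolding v_def UUw[OF w'] using U B w' by (intro assoc_mult_mat_vec) auto
    finally have Hv: "H *\<^sub>v v = U *\<^sub>v (B *\<^sub>v w')" .
    have "x \<bullet>c x = v \<bullet>c (H *\<^sub>v v)"
      using cscalar_adjoint[OF X v x] X v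
      by (simp add: x_def H_def assoc_mult_mat_vec[of _ b a _ b])
    also have "\<dots> = w' \<bullet>c (mat_adjoint U *\<^sub>v (U *\<^sub>v (B *\<^sub>v w')))"
      unfolding Hv unfolding v_def using U B w' by (intro cscalar_adjoint) auto
    also have "mat_adjoint U *\<^sub>v (U *\<^sub>v (B *\<^sub>v w')) = B *\<^sub>v w'"
      using B w' by (intro UUw) auto
    finally have xx: "x \<bullet>c x = w' \<bullet>c (B *\<^sub>v w')" .
    have "v \<bullet>c v = w' \<bullet>c (mat_adjoint U *\<^sub>v (U *\<^sub>v w'))"
      unfolding v_def using U w' by (intro cscalar_adjoint) auto
    also have "mat_adjoint U *\<^sub>v (U *\<^sub>v w') = w'"
      by (rule UUw[OF w'])
    finally have vv: "v \<bullet>c v = w' \<bullet>c w'" .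
    have vsq: "?v\<^sup>2 = (\<Sum>i<b. (cmod (w' $ i))\<^sup>2)"
      using vv unfolding cscalar_self[OF v] cscalar_self[OF w'] vnorm_square
      by (simp only: of_real_eq_iff)
    have Bw: "(B *\<^sub>v w') $ i = es ! i * w' $ i" if "i < b" for i
    proof -
      have "(B *\<^sub>v w') $ i = (\<Sum>j<b. B $$ (i, j) * w' $ j)"
        using that B w' by (simp add: scalar_prod_def lessThan_atLeast0)
      also have "\<dots> = (\<Sum>j\<in>{i}. B $$ (i, j) * w' $ j)"
        using that off by (intro sum.mono_neutral_right) auto
      finally show ?thesis using that by (simp add: dg)
    qed
    have "complex_of_real (?x\<^sup>2) = (\<Sum>i<b. w' $ i * cnj (es ! i * w' $ i))"
      using xx B w' unfolding cscalar_self[OF x]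
      by (simp add: scalar_prod_def lessThan_atLeast0 Bw del: index_mult_mat_vec)
    hence "?x\<^sup>2 = Re (\<Sum>i<b. w' $ i * cnj (es ! i * w' $ i))"
      by (metis Re_complex_of_real)
    also have "\<dots> = (\<Sum>i<b. Re (es ! i) * (cmod (w' $ i))\<^sup>2)"
      unfolding Re_sum
      by (intro sum.cong refl) (simp add: cmod_power2, simp add: power2_eq_square algebra_simps)
    \<comment> \<open>Only the first s coordinates of w' can be nonzero, and there the eigenvalues
      have real part at least \<mu>.\<close>
    also have "\<dots> \<ge> (\<Sum>i<b. \<mu> * (cmod (w' $ i))\<^sup>2)"
      using ge by (intro sum_mono) (auto simp: w'_def intro!: mult_right_mono)
    finally have "\<mu> * ?v\<^sup>2 \<le> ?x\<^sup>2" by (simp add: vsq sum_distrib_left)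
    also have "\<dots> \<le> (\<epsilon> * ?v)\<^sup>2" using le by (intro power_mono) auto
    finally have fin: "\<mu> * ?v\<^sup>2 \<le> \<epsilon>\<^sup>2 * ?v\<^sup>2" by (simp add: power_mult_distrib)
    have "?v\<^sup>2 > 0"
    proof -
      obtain i where "i < s" "w i \<noteq> 0" using w0 by blast
      thus ?thesis unfolding vsq using True by (intro sum_pos2[of _ i]) (auto simp: w'_def)
    qed
    with fin have "\<mu> \<le> \<epsilon>\<^sup>2" by simp
    thus ?thesis unfolding \<sigma> using \<epsilon> real_le_lsqrt by auto
  qed
qed

subsection \<open>Laurent series with nonnegative coefficients\<close>

lemma has_sum_finite_sum:
  fixes f :: "'i \<Rightarrow> 'a \<Rightarrow> 'b :: topological_comm_monoid_add"
  assumes "\<And>i. i \<in> I \<Longrightarrow> (f i has_sum S i) A"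
  shows "((\<lambda>x. \<Sum>i\<in>I. f i x) has_sum (\<Sum>i\<in>I. S i)) A"
  using assms by (induction I rule: infinite_finite_induct) (auto intro!: has_sum_add)

text \<open>For \<open>a n = \<zeta> powi n * c n\<close> these are the N components of a Laurent
  series under rotation by N-th roots of unity; the component \<open>p = 0\<close> is the image
  under \<open>I_op N\<close>, evaluated at \<open>\<zeta> ^ N\<close>.\<close>

definition residue_sum :: "nat \<Rightarrow> (int \<Rightarrow> 'a) \<Rightarrow> int \<Rightarrow> 'a :: {comm_monoid_add, t2_space}" where
  "residue_sum N a p = (\<Sum>\<^sub>\<infinity>n\<in>{n. n mod int N = p mod int N}. a n)"

lemma has_sum_residue_sum:
  fixes a :: "int \<Rightarrow> 'a :: banach"
  assumes "a summable_on UNIV"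
  shows "(a has_sum residue_sum N a p) {n. n mod int N = p mod int N}"
  unfolding residue_sum_def
  by (rule has_sum_infsum, rule summable_on_subset_banach[OF assms]) auto

lemma residue_sum_1 [simp]: "residue_sum (Suc 0) a p = (\<Sum>\<^sub>\<infinity>n. a n)"
  by (simp add: residue_sum_def)

lemma residue_sum_mod [simp]: "residue_sum N a (p mod int N) = residue_sum N a p"
  by (simp add: residue_sum_def)

text \<open>Absolute convergence of the double series permits any grouping. The pairs (p, q) with p
  + q in a given class form N products of classes, one for each class of q; grouping the same pairs
  by n = p + q gives the coefficients of the product.\<close>

lemma convolution_residue:
  fixes a b :: "int \<Rightarrow> complex"
  assumes a: "a summable_on UNIV" and b: "b summable_on UNIV" and N: "N > 0"
  shows "((\<lambda>n. \<Sum>\<^sub>\<infinity>p. a p * b (n - p)) has_sum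
           (\<Sum>q\<in>{0..<int N}. residue_sum N a (s - q) * residue_sum N b q))
         {n. n mod int N = s mod int N}"
    and "(\<lambda>p. a p * b (n - p)) summable_on UNIV"
proof -
  let ?R = "\<lambda>p. {n. n mod int N = p mod int N}"
  define c where "c = (\<lambda>(p, q). a p * b q)"
  have a': "a abs_summable_on UNIV" and b': "b abs_summable_on UNIV"
    using a b summable_on_iff_abs_summable_on_complex by blast+
  have "c abs_summable_on UNIV \<times> UNIV"
    using a' b' unfolding abs_summable_on_Sigma_iff
    by (auto simp: c_def norm_mult infsum_cmult_right' abs_mult infsum_nonneg
        intro!: summable_on_cmult_right summable_on_cmult_left)
  hence c: "c summable_on UNIV \<times> UNIV" using abs_summable_summable by blast
  have c': "c summable_on S" for S
    by (rule summable_on_subset_banach[OF c]) auto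
  define S where "S = {(p, q). (p + q) mod int N = s mod int N}"
  have Seq: "S = (\<Union>q'\<in>{0..<int N}. ?R (s - q') \<times> ?R q')"
  proof (intro subset_antisym subrelI)
    fix p q assume "(p, q) \<in> S"
    hence "(s - q) mod int N = p mod int N"
      unfolding S_def by simp (metis add_diff_cancel_right' mod_diff_left_eq)
    hence "p mod int N = (s - q mod int N) mod int N"
      by (simp add: mod_diff_right_eq)
    thus "(p, q) \<in> (\<Union>q'\<in>{0..<int N}. ?R (s - q') \<times> ?R q')"
      using N by (auto intro!: bexI[of _ "q mod int N"])
  next
    fix p q assume "(p, q) \<in> (\<Union>q'\<in>{0..<int N}. ?R (s - q') \<times> ?R q')"
    then obtain q' where h: "p mod int N = (s - q') mod int N" "q mod int N = q' mod int N" by blast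
    have "(p + q) mod int N = ((s - q') + q') mod int N"
      using h by (metis mod_add_eq)
    thus "(p, q) \<in> S" by (simp add: S_def)
  qed
  have residue: "(c has_sum (residue_sum N a (s - q') * residue_sum N b q')) (?R (s - q') \<times> ?R q')" for q'
  proof (rule has_sum_SigmaI)
    show "((\<lambda>y. c (p, y)) has_sum a p * residue_sum N b q') (?R q')" for p
      unfolding c_def by simp (intro has_sum_cmult_right has_sum_residue_sum b)
    show "((\<lambda>p. a p * residue_sum N b q') has_sum residue_sum N a (s - q') * residue_sum N b q') (?R (s - q'))"
      by (intro has_sum_cmult_left has_sum_residue_sum a)
  qed (rule c')
  have "(c has_sum (\<Sum>q'\<in>{0..<int N}. residue_sum N a (s - q') * residue_sum N b q')) S"
    unfolding Seq
  proof (rule sum_has_sum, goal_cases)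
    case (2 q)
    show ?case by (rule residue)
  next
    case (3 q1 q2)
    thus ?case by auto
  qed simp
  also have "?this \<longleftrightarrow> ((\<lambda>(n, p). a p * b (n - p)) has_sum (\<Sum>q'\<in>{0..<int N}. residue_sum N a (s - q') * residue_sum N b q')) (?R s \<times> UNIV)"
    by (rule has_sum_reindex_bij_witness[where i = "\<lambda>(n, p). (p, n - p)" and j = "\<lambda>(p, q). (p + q, p)"])
      (auto simp: S_def c_def)
  finally have 1: "((\<lambda>(n, p). a p * b (n - p)) has_sum (\<Sum>q'\<in>{0..<int N}. residue_sum N a (s - q') * residue_sum N b q')) (?R s \<times> UNIV)" .
  have 2: "(\<lambda>p. a p * b (n - p)) summable_on UNIV" for n
  proof -
    have "c summable_on (\<lambda>p. (p, n - p)) ` UNIV" by (rule c')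
    thus ?thesis
      by (subst (asm) summable_on_reindex) (auto simp: inj_on_def c_def o_def)
  qed
  show "(\<lambda>p. a p * b (n - p)) summable_on UNIV" by (rule 2)
  show "((\<lambda>n. \<Sum>\<^sub>\<infinity>p. a p * b (n - p)) has_sum
           (\<Sum>q\<in>{0..<int N}. residue_sum N a (s - q) * residue_sum N b q)) (?R s)"
    by (rule has_sum_SigmaD[OF 1]) (use 2 in auto)
qed

definition nonneg_laurent :: "real \<Rightarrow> (int \<Rightarrow> real) \<Rightarrow> (complex \<Rightarrow> complex) \<Rightarrow> bool" where
  "nonneg_laurent t f F \<longleftrightarrow> (\<forall>n. f n \<ge> 0) \<and>
     (\<forall>z\<in>annulus (1 / t) t. ((\<lambda>n. z powi n * complex_of_real (f n)) has_sum F z) UNIV)"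

lemma annulus_nonzero: "z \<in> annulus (1 / t) t \<Longrightarrow> t > 1 \<Longrightarrow> z \<noteq> 0"
  by (auto simp: annulus_def)

lemma of_real_annulus: "z \<in> annulus r1 r2 \<Longrightarrow> complex_of_real (cmod z) \<in> annulus r1 r2"
  by (auto simp: annulus_def)

text \<open>With nonnegative coefficients the terms at |z| are the absolute values of the terms at
  z, so the value at the positive real point of a circle dominates the whole circle.\<close>

lemma nonneg_laurentD:
  assumes "nonneg_laurent t f F" "z \<in> annulus (1 / t) t"
  shows "((\<lambda>n. z powi n * complex_of_real (f n)) has_sum F z) UNIV"
    "((\<lambda>n. cmod z powi n * f n) has_sum Re (F (complex_of_real (cmod z)))) UNIV"
    "Im (F (complex_of_real (cmod z))) = 0" "Re (F (complex_of_real (cmod z))) \<ge> 0"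
    "F (complex_of_real (cmod z)) = complex_of_real (Re (F (complex_of_real (cmod z))))"
    "cmod (F z) \<le> Re (F (complex_of_real (cmod z)))"
proof -
  let ?r = "complex_of_real (cmod z)"
  show 1: "((\<lambda>n. z powi n * complex_of_real (f n)) has_sum F z) UNIV"
    using assms by (auto simp: nonneg_laurent_def)
  have 2: "((\<lambda>n. complex_of_real (cmod z powi n * f n)) has_sum F ?r) UNIV"
    using assms of_real_annulus[OF assms(2)] by (auto simp: nonneg_laurent_def)
  show 3: "((\<lambda>n. cmod z powi n * f n) has_sum Re (F ?r)) UNIV"
    using has_sum_Re[OF 2] by (simp only: Re_complex_of_real)
  have "((\<lambda>n :: int. 0) has_sum Im (F ?r)) UNIV"
    using has_sum_Im[OF 2] by (simp only: Im_complex_of_real)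
  thus 4: "Im (F ?r) = 0"
    by (rule has_sum_unique) simp
  show "F ?r = complex_of_real (Re (F ?r))" using 4 by (simp add: complex_eq_iff)
  have nn: "f n \<ge> 0" for n using assms by (simp add: nonneg_laurent_def)
  show "Re (F ?r) \<ge> 0" by (rule has_sum_nonneg[OF 3]) (simp add: nn)
  show "cmod (F z) \<le> Re (F ?r)"
    by (rule norm_has_sum_bound[OF _ 1]) (use 3 in \<open>simp add: norm_mult norm_power_int nn\<close>)
qed

lemma nonneg_laurent_const:
  "c \<ge> 0 \<Longrightarrow> nonneg_laurent t (\<lambda>n. if n = 0 then c else 0) (\<lambda>z. complex_of_real c)"
  unfolding nonneg_laurent_def
  by (auto intro!: has_sum_finite_neutralI[where B = "{0}"] split: if_splits)

lemma nonneg_laurent_monom: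
  "c \<ge> 0 \<Longrightarrow> nonneg_laurent t (\<lambda>n. if n = l then c else 0) (\<lambda>z. z powi l * complex_of_real c)"
  unfolding nonneg_laurent_def
  by (auto intro!: has_sum_finite_neutralI[where B = "{l}"] split: if_splits)

lemma nonneg_laurent_add:
  assumes "nonneg_laurent t f F" "nonneg_laurent t g G"
  shows "nonneg_laurent t (\<lambda>n. f n + g n) (\<lambda>z. F z + G z)"
  using assms unfolding nonneg_laurent_def
  by (auto simp: ring_distribs intro!: has_sum_add)

lemma nonneg_laurent_sum:
  assumes "\<And>i. i \<in> I \<Longrightarrow> nonneg_laurent t (f i) (F i)"
  shows "nonneg_laurent t (\<lambda>n. \<Sum>i\<in>I. f i n) (\<lambda>z. \<Sum>i\<in>I. F i z)"
  using assms unfolding nonneg_laurent_def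
  by (auto simp: sum_distrib_left intro!: sum_nonneg has_sum_finite_sum)

lemma convolution_powi:
  fixes z :: complex
  assumes "t > 1" "z \<in> annulus (1 / t) t" "nonneg_laurent t f F" "nonneg_laurent t g G"
  shows "(\<Sum>\<^sub>\<infinity>p. (z powi p * complex_of_real (f p)) * (z powi (n - p) * complex_of_real (g (n - p))))
    = z powi n * complex_of_real (\<Sum>\<^sub>\<infinity>p. f p * g (n - p))"
proof -
  \<comment> \<open>Since 1 lies in the annulus, the coefficients themselves are summable, and hence
    so is each convolution series.\<close>
  have one: "1 \<in> annulus (1 / t) t" using assms(1) by (simp add: annulus_def)
  have s: "(\<lambda>p. complex_of_real (f p)) summable_on UNIV" "(\<lambda>p. complex_of_real (g p)) summable_on UNIV"
    using nonneg_laurentD(1)[OF assms(3) one] nonneg_laurentD(1)[OF assms(4) one]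
    by (auto dest: has_sum_imp_summable)
  have "(\<lambda>p. Re (complex_of_real (f p) * complex_of_real (g (n - p)))) summable_on UNIV"
    by (rule summable_on_Re, rule convolution_residue(2)[OF s, of 1]) simp
  hence "((\<lambda>p. f p * g (n - p)) has_sum (\<Sum>\<^sub>\<infinity>p. f p * g (n - p))) UNIV"
    by simp
  from has_sum_cmult_right[OF has_sum_of_real[OF this], of "z powi n"]
  show ?thesis
    using annulus_nonzero[OF assms(2,1)]
    by (intro infsumI) (simp add: power_int_diff field_simps)
qed

lemma nonneg_laurent_mult:
  assumes "t > 1" "nonneg_laurent t f F" "nonneg_laurent t g G"
  shows "nonneg_laurent t (\<lambda>n. \<Sum>\<^sub>\<infinity>p. f p * g (n - p)) (\<lambda>z. F z * G z)"
  unfolding nonneg_laurent_def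
proof (intro conjI allI ballI)
  show "0 \<le> (\<Sum>\<^sub>\<infinity>p. f p * g (n - p))" for n
    using assms by (intro infsum_nonneg) (auto simp: nonneg_laurent_def)
  fix z assume z: "z \<in> annulus (1 / t) t"
  note F = nonneg_laurentD(1)[OF assms(2) z] and G = nonneg_laurentD(1)[OF assms(3) z]
  \<comment> \<open>For \<open>N = 1\<close> there is a single residue class and the convolution
    formula is the Cauchy product.\<close>
  show "((\<lambda>n. z powi n * complex_of_real (\<Sum>\<^sub>\<infinity>p. f p * g (n - p))) has_sum F z * G z) UNIV"
    using convolution_residue(1)[OF has_sum_imp_summable[OF F] has_sum_imp_summable[OF G], of 1 0]
    unfolding convolution_powi[OF assms(1) z assms(2,3)]
    by (simp add: infsumI[OF F] infsumI[OF G])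
qed

text \<open>At |z| all terms of the double series are nonnegative and the inner sums add up to a
  finite value of \<open>S\<close>. This gives absolute convergence at z and allows the two
  summations to be exchanged.\<close>

lemma nonneg_laurent_suminf:
  assumes t: "t > 1" and "\<And>k. nonneg_laurent t (f k) (F k)"
    and S: "\<And>z. z \<in> annulus (1 / t) t \<Longrightarrow> ((\<lambda>k :: nat. F k z) has_sum S z) UNIV"
  shows "nonneg_laurent t (\<lambda>n. \<Sum>\<^sub>\<infinity>k. f k n) S"
  unfolding nonneg_laurent_def
proof (intro conjI allI ballI)
  have nn: "f k n \<ge> 0" for k n using assms(2) by (simp add: nonneg_laurent_def)
  thus "0 \<le> (\<Sum>\<^sub>\<infinity>k. f k n)" for n by (intro infsum_nonneg) auto
  fix z assume z: "z \<in> annulus (1 / t) t"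
  let ?r = "complex_of_real (cmod z)"
  note D = nonneg_laurentD[OF assms(2) z]
  have "(\<lambda>(k, n). cmod z powi n * f k n) summable_on UNIV \<times> UNIV"
  proof (rule summable_on_SigmaI)
    show "((\<lambda>n. case (k, n) of (k, n) \<Rightarrow> cmod z powi n * f k n) has_sum Re (F k ?r)) UNIV" for k
      using D(2) by simp
    show "(\<lambda>k. Re (F k ?r)) summable_on UNIV"
      using has_sum_Re[OF S[OF of_real_annulus[OF z]]] by (auto dest: has_sum_imp_summable)
  qed (simp add: nn)
  hence "(\<lambda>(k, n). z powi n * complex_of_real (f k n)) abs_summable_on UNIV \<times> UNIV"
    by (simp add: case_prod_unfold norm_mult norm_power_int nn)
  hence sm: "(\<lambda>(k, n). z powi n * complex_of_real (f k n)) summable_on UNIV \<times> UNIV"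
    using abs_summable_summable by blast
  have "((\<lambda>(k, n). z powi n * complex_of_real (f k n)) has_sum S z) (UNIV \<times> UNIV)"
  proof (rule has_sum_SigmaI[where g = "\<lambda>k. F k z"])
    show "((\<lambda>n. case (k, n) of (k, n) \<Rightarrow> z powi n * complex_of_real (f k n)) has_sum F k z) UNIV" for k
      using D(1) by simp
  qed (use S[OF z] sm in auto)
  hence sw: "((\<lambda>(n, k). z powi n * complex_of_real (f k n)) has_sum S z) (UNIV \<times> UNIV)"
    by (subst (asm) has_sum_swap) (simp add: case_prod_unfold)
  show "((\<lambda>n. z powi n * complex_of_real (\<Sum>\<^sub>\<infinity>k. f k n)) has_sum S z) UNIV"
  proof (rule has_sum_SigmaD[OF sw])
    fix n :: int
    have "(\<lambda>(n, k). z powi n * complex_of_real (f k n)) summable_on (UNIV \<times> UNIV)"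
      using sw by (rule has_sum_imp_summable)
    from summable_on_SigmaD1[OF this UNIV_I, of n]
    have "(\<lambda>k. z powi n * complex_of_real (f k n)) summable_on UNIV" .
    \<comment> \<open>Dividing by the nonzero power of z isolates the coefficients, whose sum over k
      inherits convergence from the double series.\<close>
    hence "(\<lambda>k. Re (inverse (z powi n) * (z powi n * complex_of_real (f k n)))) summable_on UNIV"
      by (rule summable_on_Re[OF summable_on_cmult_right])
    moreover have "Re (inverse (z powi n) * (z powi n * complex_of_real (f k n))) = f k n" for k
      using annulus_nonzero[OF z t] by (simp add: field_simps)
    ultimately have "(\<lambda>k. f k n) summable_on UNIV" by simp
    hence "((\<lambda>k. f k n) has_sum (\<Sum>\<^sub>\<infinity>k. f k n)) UNIV" by simp
    from has_sum_cmult_right[OF has_sum_of_real[OF this], of "z powi n"]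
    show "((\<lambda>y. case (n, y) of (n, k) \<Rightarrow> z powi n * complex_of_real (f k n)) has_sum
          z powi n * complex_of_real (\<Sum>\<^sub>\<infinity>k. f k n)) UNIV" by simp
  qed
qed

section \<open>Square sums over residue classes\<close>

lemma one_le_power_int_nonpos: "0 < (s :: real) \<Longrightarrow> s \<le> 1 \<Longrightarrow> k \<le> 0 \<Longrightarrow> 1 \<le> s powi k"
  using power_int_decreasing[of k 0 s] by simp

lemma sum_residue_le:
  fixes a :: "int \<Rightarrow> real"
  assumes "\<And>n. a n \<ge> 0" "a summable_on UNIV" "N > 0"
  shows "(\<Sum>p\<in>{0..<int N}. residue_sum N a p) = (\<Sum>\<^sub>\<infinity>n. a n)"
proof -
  have "(a has_sum (\<Sum>p\<in>{0..<int N}. residue_sum N a p)) (\<Union>p\<in>{0..<int N}. {n. n mod int N = p mod int N})"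
  proof (rule sum_has_sum, goal_cases)
    case (2 p)
    show ?case by (rule has_sum_residue_sum[OF assms(2)])
  qed auto
  also have "(\<Union>p\<in>{0..<int N}. {n. n mod int N = p mod int N}) = UNIV"
    using assms(3) by (auto intro!: bexI[of _ "_ mod int N"])
  finally show ?thesis by (simp add: infsumI)
qed

lemma sum_squares_le_square_sum:
  fixes f :: "'i \<Rightarrow> real"
  assumes "\<And>i. i \<in> I \<Longrightarrow> f i \<ge> 0" "finite I"
  shows "(\<Sum>i\<in>I. (f i)\<^sup>2) \<le> (\<Sum>i\<in>I. f i)\<^sup>2"
  using assms(2,1)
proof (induction I rule: finite_induct)
  case (insert x F)
  moreover have "0 \<le> f x * sum f F" using insert by (auto intro!: mult_nonneg_nonneg sum_nonneg)
  ultimately show ?case by (simp add: power2_sum)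
qed simp

text \<open>Nonnegativity takes the place of orthogonality: squares of nonnegative numbers add up to
  at most the square of their sum, without a factor N.\<close>

lemma sum_residue_squares_le:
  fixes a :: "int \<Rightarrow> real"
  assumes nn: "\<And>n. a n \<ge> 0" and s: "a summable_on UNIV" and N: "N > 0" and J: "J \<subseteq> {0..<int N}"
  shows "(\<Sum>p\<in>J. (residue_sum N a p)\<^sup>2) \<le> (\<Sum>\<^sub>\<infinity>n. a n)\<^sup>2"
proof -
  have "(\<Sum>p\<in>J. (residue_sum N a p)\<^sup>2) \<le> (\<Sum>p\<in>{0..<int N}. (residue_sum N a p)\<^sup>2)"
    using J by (intro sum_mono2) auto
  also have "\<dots> \<le> (\<Sum>p\<in>{0..<int N}. residue_sum N a p)\<^sup>2"
    by (rule sum_squares_le_square_sum) (auto simp: residue_sum_def intro!: infsum_nonneg nn)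
  finally show ?thesis by (simp add: sum_residue_le[OF nn s N])
qed

text \<open>The part of the residue sum with nonnegative indices only involves indices at least \<open>p\<close>, the
  rest only indices at most \<open>p - N\<close>.\<close>

lemma residue_sum_tail:
  fixes d :: "int \<Rightarrow> real"
  assumes nn: "\<And>n. d n \<ge> 0" and s: "0 < s" "s \<le> 1" and N: "N > 0"
    and \<alpha>: "((\<lambda>n. inverse s powi n * d n) has_sum \<alpha>) UNIV"
    and \<beta>: "((\<lambda>n. s powi n * d n) has_sum \<beta>) UNIV"
    and J: "J \<subseteq> {int j + 1..int N - 1 - int j}"
  shows "(\<Sum>p\<in>J. (residue_sum N d p)\<^sup>2) \<le> (s ^ (2 * (j + 1)) + s ^ N) * (\<alpha>\<^sup>2 + \<beta>\<^sup>2)"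
proof -
  \<comment> \<open>The weights are those of the two radii 1/s and s. An index
    \<open>n \<ge> p\<close> pays the factor s^p against a, an index \<open>n \<le> p - N\<close>
    the factor s^(N-p) against b.\<close>
  define a where "a n = (if n \<ge> 0 then inverse s powi n * d n else 0)" for n
  define b where "b n = (if n < 0 then s powi n * d n else 0)" for n
  let ?R = "residue_sum N"
  have ann: "a n \<ge> 0" and bnn: "b n \<ge> 0" for n using nn s by (auto simp: a_def b_def)
  have asum: "a summable_on UNIV"
    by (rule summable_on_comparison_test[OF has_sum_imp_summable[OF \<alpha>]]) (use nn s in \<open>auto simp: a_def\<close>)
  have bsum: "b summable_on UNIV"
    by (rule summable_on_comparison_test[OF has_sum_imp_summable[OF \<beta>]]) (use nn s in \<open>auto simp: b_def\<close>)
  have absum: "a summable_on S" "b summable_on S" for S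
    by (auto intro: summable_on_subset_banach[OF asum] summable_on_subset_banach[OF bsum])
  have dsum: "d summable_on S" for S
  proof (rule summable_on_subset_banach[where A = UNIV])
    show "d summable_on UNIV"
    proof (rule summable_on_comparison_test[OF summable_on_add[OF has_sum_imp_summable[OF \<alpha>] has_sum_imp_summable[OF \<beta>]]])
      fix n :: int
      have "1 \<le> inverse s powi n + s powi n"
      proof (cases "n \<ge> 0")
        case True
        hence "1 \<le> inverse s powi n" using s by (intro one_le_power_int) (auto simp: field_simps)
        moreover have "0 \<le> s powi n" using s by (intro zero_le_power_int) auto
        ultimately show ?thesis by linarith
      next
        case False
        hence "1 \<le> s powi n" by (intro one_le_power_int_nonpos s) auto
        moreover have "0 \<le> inverse s powi n" using s by (intro zero_le_power_int) auto
        ultimately show ?thesis by linarith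
      qed
      from mult_right_mono[OF this nn[of n]]
      show "d n \<le> inverse s powi n * d n + s powi n * d n" by (simp add: algebra_simps)
    qed (rule nn)
  qed simp
  have ale: "(\<Sum>\<^sub>\<infinity>n. a n) \<le> \<alpha>"
    unfolding infsumI[OF \<alpha>, symmetric]
    by (rule infsum_mono[OF asum has_sum_imp_summable[OF \<alpha>]]) (use nn s in \<open>auto simp: a_def\<close>)
  have ble: "(\<Sum>\<^sub>\<infinity>n. b n) \<le> \<beta>"
    unfolding infsumI[OF \<beta>, symmetric]
    by (rule infsum_mono[OF bsum has_sum_imp_summable[OF \<beta>]]) (use nn s in \<open>auto simp: b_def\<close>)
  have Rnn: "?R a p \<ge> 0" "?R b p \<ge> 0" "?R d p \<ge> 0" for p
    by (auto simp: residue_sum_def intro!: infsum_nonneg ann bnn nn)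
  have key: "(?R d p)\<^sup>2 \<le> (s ^ (2 * (j + 1)) + s ^ N) * ((?R a p)\<^sup>2 + (?R b p)\<^sup>2)" if p: "p \<in> J" for p
  proof -
    have p': "int j + 1 \<le> p" "p \<le> int N - 1 - int j" using p J by auto
    let ?S = "{n. n mod int N = p mod int N}"
    have pm: "p mod int N = p" using p' by (intro mod_pos_pos_trivial) auto
    have "d n \<le> s powi p * a n + s powi (int N - p) * b n" if n: "n \<in> ?S" for n
    proof -
      have "int N dvd n - p" using n by (simp add: mod_eq_dvd_iff)
      then obtain q where q: "n = p + int N * q" by (metis dvdE diff_add_cancel add.commute)
      show ?thesis
      proof (cases "n \<ge> 0")
        case True
        have "q \<ge> 0"
        proof (rule ccontr)
          assume "\<not> q \<ge> 0"
          hence "int N * q \<le> int N * (-1)" using N by (intro mult_left_mono) auto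
          thus False using True q p' by simp
        qed
        hence "p - n \<le> 0" using q by simp
        hence "1 \<le> s powi (p - n)" by (rule one_le_power_int_nonpos[OF s])
        hence "d n \<le> s powi (p - n) * d n" using nn[of n] mult_right_mono[of 1 _ "d n"] by simp
        also have "\<dots> = s powi p * a n"
          using True s by (simp add: a_def power_int_diff field_simps power_int_inverse)
        finally show ?thesis using True by (simp add: b_def)
      next
        case False
        have "q \<le> -1"
        proof (rule ccontr)
          assume "\<not> q \<le> -1"
          hence "int N * q \<ge> 0" by simp
          thus False using False q p' by simp
        qed
        hence "int N * q \<le> int N * (-1)" using N by (intro mult_left_mono) auto
        hence "(int N - p) + n \<le> 0" using q by simp
        hence "1 \<le> s powi ((int N - p) + n)" by (rule one_le_power_int_nonpos[OF s])
        hence "d n \<le> s powi ((int N - p) + n) * d n" using nn[of n] mult_right_mono[of 1 _ "d n"] by simp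
        also have "\<dots> = s powi (int N - p) * b n"
          using False s by (simp add: b_def power_int_add)
        finally show ?thesis using False by (simp add: a_def)
      qed
    qed
    hence "?R d p \<le> (\<Sum>\<^sub>\<infinity>n\<in>?S. s powi p * a n + s powi (int N - p) * b n)"
      unfolding residue_sum_def
      by (intro infsum_mono dsum summable_on_add summable_on_cmult_right absum) auto
    also have "\<dots> = s powi p * ?R a p + s powi (int N - p) * ?R b p"
      unfolding residue_sum_def
      by (subst infsum_add) (auto intro!: summable_on_cmult_right absum simp: infsum_cmult_right absum)
    finally have 1: "?R d p \<le> s powi p * ?R a p + s powi (int N - p) * ?R b p" .
    let ?u = "s powi p" and ?v = "s powi (int N - p)"
    \<comment> \<open>The product of the two weights does not depend on p, so the cross term
      contributes s^N times a sum of two squares, which can again be summed over p.\<close>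
    have uv: "?u * ?v = s ^ N" using s by (simp add: power_int_add[symmetric])
    have u2: "?u\<^sup>2 \<le> s ^ (2 * (j + 1))" and v2: "?v\<^sup>2 \<le> s ^ (2 * (j + 1))"
    proof -
      have "s powi p \<le> s powi (int j + 1)" "s powi (int N - p) \<le> s powi (int j + 1)"
        using p' s by (auto intro!: power_int_decreasing)
      moreover have "s powi (int j + 1) = s ^ (j + 1)"
        by (metis of_nat_1 of_nat_add power_int_of_nat)
      ultimately have "?u \<le> s ^ (j + 1)" "?v \<le> s ^ (j + 1)" by (simp_all only:)
      moreover have "0 \<le> ?u" "0 \<le> ?v" using s by simp_all
      moreover have "(s ^ (j + 1))\<^sup>2 = s ^ (2 * (j + 1))"
        by (simp only: power_mult[symmetric] mult.commute)
      ultimately show "?u\<^sup>2 \<le> s ^ (2 * (j + 1))" "?v\<^sup>2 \<le> s ^ (2 * (j + 1))"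
        by (metis power_mono)+
    qed
    have "(?R d p)\<^sup>2 \<le> (?u * ?R a p + ?v * ?R b p)\<^sup>2"
      using 1 Rnn by (intro power_mono) auto
    also have "\<dots> = ?u\<^sup>2 * (?R a p)\<^sup>2 + ?v\<^sup>2 * (?R b p)\<^sup>2 + s ^ N * (2 * ?R a p * ?R b p)"
      by (simp add: uv[symmetric] power2_eq_square algebra_simps)
    also have "\<dots> \<le> s ^ (2 * (j + 1)) * (?R a p)\<^sup>2 + s ^ (2 * (j + 1)) * (?R b p)\<^sup>2
        + s ^ N * ((?R a p)\<^sup>2 + (?R b p)\<^sup>2)"
      using s sum_squares_bound[of "?R a p" "?R b p"]
      by (intro add_mono mult_right_mono mult_left_mono u2 v2) auto
    finally show ?thesis by (simp add: algebra_simps)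
  qed
  have J': "J \<subseteq> {0..<int N}" using J by auto
  have "(\<Sum>p\<in>J. (?R d p)\<^sup>2) \<le> (\<Sum>p\<in>J. (s ^ (2 * (j + 1)) + s ^ N) * ((?R a p)\<^sup>2 + (?R b p)\<^sup>2))"
    by (intro sum_mono key)
  also have "\<dots> = (s ^ (2 * (j + 1)) + s ^ N) * ((\<Sum>p\<in>J. (?R a p)\<^sup>2) + (\<Sum>p\<in>J. (?R b p)\<^sup>2))"
    by (simp only: sum.distrib[symmetric] sum_distrib_left)
  also have "\<dots> \<le> (s ^ (2 * (j + 1)) + s ^ N) * (\<alpha>\<^sup>2 + \<beta>\<^sup>2)"
  proof (intro mult_left_mono add_mono)
    show "(\<Sum>p\<in>J. (?R a p)\<^sup>2) \<le> \<alpha>\<^sup>2"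
      using sum_residue_squares_le[OF ann asum N J'] power_mono[OF ale infsum_nonneg, of 2] ann
      by (meson order_trans)
    show "(\<Sum>p\<in>J. (?R b p)\<^sup>2) \<le> \<beta>\<^sup>2"
      using sum_residue_squares_le[OF bnn bsum N J'] power_mono[OF ble infsum_nonneg, of 2] bnn
      by (meson order_trans)
  qed (use s in auto)
  finally show ?thesis .
qed

subsection \<open>Bounds for bilinear forms\<close>

lemma vnorm_cnj [simp]: "vnorm n (\<lambda>i. cnj (v i)) = vnorm n v"
  by (simp add: vnorm_def)

lemma vnorm_cmod [simp]: "vnorm n (\<lambda>i. complex_of_real (cmod (v i))) = vnorm n v"
  by (simp add: vnorm_def)

lemma vnorm_cauchy: "cmod (\<Sum>i<n. y i * u i) \<le> vnorm n y * vnorm n u"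
proof -
  have "cmod (\<Sum>i<n. y i * u i) \<le> (\<Sum>i<n. \<bar>cmod (y i)\<bar> * \<bar>cmod (u i)\<bar>)"
    by (rule order_trans[OF norm_sum]) (simp add: norm_mult)
  also have "\<dots> \<le> vnorm n y * vnorm n u"
    unfolding vnorm_def by (rule L2_set_mult_ineq)
  finally show ?thesis .
qed

lemma form_boundD:
  "form_bound a b K c \<Longrightarrow> cmod (\<Sum>i<a. \<Sum>j<b. y i * K i j * v j) \<le> c * vnorm a y * vnorm b v"
  by (simp add: form_bound_def)

lemma form_bound_transpose:
  assumes "form_bound a b K c"
  shows "form_bound b a (\<lambda>j i. K i j) c"
  unfolding form_bound_def
proof (intro allI)
  fix y v
  have "(\<Sum>i<b. \<Sum>j<a. y i * K j i * v j) = (\<Sum>i<a. \<Sum>j<b. v i * K i j * y j)"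
    by (subst sum.swap) (simp add: mult_ac)
  thus "cmod (\<Sum>i<b. \<Sum>j<a. y i * K j i * v j) \<le> c * vnorm b y * vnorm a v"
    using form_boundD[OF assms, of v y] by (simp add: mult_ac)
qed

text \<open>The form is tested with y the conjugate of K v; one factor of the norm then
  cancels.\<close>

lemma form_bound_vnorm:
  assumes "form_bound a b K c" "c \<ge> 0"
  shows "vnorm a (\<lambda>i. \<Sum>j<b. K i j * v j) \<le> c * vnorm b v"
proof -
  let ?x = "\<lambda>i. \<Sum>j<b. K i j * v j"
  have "(vnorm a ?x)\<^sup>2 = cmod (complex_of_real ((vnorm a ?x)\<^sup>2))" by (simp only: norm_of_real) simp
  also have "complex_of_real ((vnorm a ?x)\<^sup>2) = (\<Sum>i<a. cnj (?x i) * ?x i)"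
    unfolding vnorm_square of_real_sum
    by (intro sum.cong refl) (metis complex_norm_square mult.commute of_real_power)
  also have "\<dots> = (\<Sum>i<a. \<Sum>j<b. cnj (?x i) * K i j * v j)"
    by (intro sum.cong refl) (simp add: sum_distrib_left mult.assoc)
  also have "cmod \<dots> \<le> c * vnorm a (\<lambda>i. cnj (?x i)) * vnorm b v"
    by (rule form_boundD[OF assms(1)])
  finally have "vnorm a ?x * vnorm a ?x \<le> vnorm a ?x * (c * vnorm b v)"
    by (simp only: vnorm_cnj power2_eq_square mult_ac)
  thus ?thesis
    using assms(2) vnorm_nonneg[of a ?x] by (cases "vnorm a ?x = 0") (auto simp: mult_le_cancel_left less_le)
qed

text \<open>Replacing y and v by their entrywise absolute values keeps the norms and only enlarges
  the form.\<close>

lemma form_bound_mono: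
  assumes "form_bound a b (\<lambda>i j. complex_of_real (k i j)) c"
    and "\<And>i j. i < a \<Longrightarrow> j < b \<Longrightarrow> cmod (K i j) \<le> k i j"
  shows "form_bound a b K c"
  unfolding form_bound_def
proof (intro allI)
  fix y v
  have "cmod (\<Sum>i<a. \<Sum>j<b. y i * K i j * v j) \<le> (\<Sum>i<a. \<Sum>j<b. cmod (y i * K i j * v j))"
    by (intro order_trans[OF norm_sum] sum_mono order_refl)
  also have "\<dots> \<le> (\<Sum>i<a. \<Sum>j<b. cmod (y i) * k i j * cmod (v j))"
    unfolding norm_mult by (intro sum_mono mult_right_mono mult_left_mono assms(2)) auto
  also have "\<dots> \<le> cmod (complex_of_real (\<Sum>i<a. \<Sum>j<b. cmod (y i) * k i j * cmod (v j)))"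
    by (simp only: norm_of_real abs_ge_self)
  also have "complex_of_real (\<Sum>i<a. \<Sum>j<b. cmod (y i) * k i j * cmod (v j)) =
    (\<Sum>i<a. \<Sum>j<b. complex_of_real (cmod (y i)) * complex_of_real (k i j) * complex_of_real (cmod (v j)))"
    by simp
  also have "cmod \<dots> \<le> c * vnorm a (\<lambda>i. complex_of_real (cmod (y i))) * vnorm b (\<lambda>i. complex_of_real (cmod (v i)))"
    by (rule form_boundD[OF assms(1)])
  finally show "cmod (\<Sum>i<a. \<Sum>j<b. y i * K i j * v j) \<le> c * vnorm a y * vnorm b v"
    by simp
qed

lemma sum_shifted_support:
  fixes f :: "nat \<Rightarrow> 'a :: comm_monoid_add"
  assumes "r0 + a \<le> m"
  shows "(\<Sum>i<m. if r0 \<le> i \<and> i < r0 + a then f (i - r0) else 0) = (\<Sum>i<a. f i)"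
proof -
  have "(\<Sum>i<m. if r0 \<le> i \<and> i < r0 + a then f (i - r0) else 0) = (\<Sum>i\<in>{r0..<r0 + a}. f (i - r0))"
    using assms by (intro sum.mono_neutral_cong_right) auto
  also have "\<dots> = (\<Sum>i<a. f i)"
    by (rule sum.reindex_bij_witness[of _ "\<lambda>i. i + r0" "\<lambda>i. i - r0"]) auto
  finally show ?thesis .
qed

text \<open>Extending y and v by zero to length m changes neither the norms nor the form.\<close>

lemma form_bound_block:
  assumes K: "form_bound m m K c" and "r0 + a \<le> m" "c0 + b \<le> m"
  shows "form_bound a b (\<lambda>i j. K (r0 + i) (c0 + j)) c"
  unfolding form_bound_def
proof (intro allI)
  fix y v :: "nat \<Rightarrow> complex"
  define y' where "y' i = (if r0 \<le> i \<and> i < r0 + a then y (i - r0) else 0)" for i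
  define v' where "v' i = (if c0 \<le> i \<and> i < c0 + b then v (i - c0) else 0)" for i
  have "(\<Sum>j<m. y' i * K i j * v' j) =
    (if r0 \<le> i \<and> i < r0 + a then \<Sum>j<b. y (i - r0) * K (r0 + (i - r0)) (c0 + j) * v j else 0)" for i
    using sum_shifted_support[OF assms(3), of "\<lambda>j. y (i - r0) * K i (c0 + j) * v j"]
    by (simp add: y'_def v'_def if_distrib[of "\<lambda>x. _ * x"] cong: if_cong)
  hence "(\<Sum>i<m. \<Sum>j<m. y' i * K i j * v' j) = (\<Sum>i<a. \<Sum>j<b. y i * K (r0 + i) (c0 + j) * v j)"
    using sum_shifted_support[OF assms(2), of "\<lambda>i. \<Sum>j<b. y i * K (r0 + i) (c0 + j) * v j"] by simp
  moreover have "vnorm m y' = vnorm a y"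
    using sum_shifted_support[OF assms(2), of "\<lambda>i. (cmod (y i))\<^sup>2"]
    by (simp add: vnorm_def L2_set_def y'_def if_distrib[of "\<lambda>x. (cmod x)\<^sup>2"] cong: if_cong)
  moreover have "vnorm m v' = vnorm b v"
    using sum_shifted_support[OF assms(3), of "\<lambda>i. (cmod (v i))\<^sup>2"]
    by (simp add: vnorm_def L2_set_def v'_def if_distrib[of "\<lambda>x. (cmod x)\<^sup>2"] cong: if_cong)
  ultimately show "cmod (\<Sum>i<a. \<Sum>j<b. y i * K (r0 + i) (c0 + j) * v j) \<le> c * vnorm a y * vnorm b v"
    using form_boundD[OF K, of y' v'] by simp
qed

section \<open>From the spectral norm to bilinear forms\<close>

lemma euclid_norm_vnorm: "euclid_norm v = vnorm (dim_vec v) (\<lambda>i. v $ i)"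
  by (simp add: euclid_norm_def vnorm_def L2_set_def)

lemma spectral_norm_upper:
  assumes M: "M \<in> carrier_mat a b" and v: "v \<in> carrier_vec b"
  shows "euclid_norm (M *\<^sub>v v) \<le> spectral_norm M * euclid_norm v" "spectral_norm M \<ge> 0"
proof -
  define S where "S = {v \<in> carrier_vec (dim_col M). euclid_norm v \<le> 1}"
  define f where "f v = euclid_norm (M *\<^sub>v v)" for v
  \<comment> \<open>A supremum of reals bounds its members only if the set is bounded above; the sum
    of the row norms is a crude bound.\<close>
  have bdd: "bdd_above (f ` S)"
  proof (rule bdd_aboveI2)
    fix v assume "v \<in> S"
    hence v: "v \<in> carrier_vec b" "vnorm b (\<lambda>i. v $ i) \<le> 1" using M by (auto simp: S_def euclid_norm_vnorm)
    have "f v = vnorm a (\<lambda>i. (M *\<^sub>v v) $ i)" using M by (simp add: f_def euclid_norm_vnorm)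
    also have "\<dots> \<le> (\<Sum>i<a. cmod ((M *\<^sub>v v) $ i))"
      unfolding vnorm_def by (rule L2_set_le_sum) auto
    also have "\<dots> \<le> (\<Sum>i<a. vnorm b (\<lambda>j. M $$ (i, j)))"
    proof (intro sum_mono)
      fix i assume "i \<in> {..<a}"
      hence "(M *\<^sub>v v) $ i = (\<Sum>j<b. M $$ (i, j) * v $ j)"
        using M v by (simp add: scalar_prod_def lessThan_atLeast0)
      also have "cmod \<dots> \<le> vnorm b (\<lambda>j. M $$ (i, j)) * vnorm b (\<lambda>j. v $ j)" by (rule vnorm_cauchy)
      also have "\<dots> \<le> vnorm b (\<lambda>j. M $$ (i, j)) * 1" using v(2) by (intro mult_left_mono) auto
      finally show "cmod ((M *\<^sub>v v) $ i) \<le> vnorm b (\<lambda>j. M $$ (i, j))" by simp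
    qed
    finally show "f v \<le> (\<Sum>i<a. vnorm b (\<lambda>j. M $$ (i, j)))" .
  qed
  have sn: "spectral_norm M = (SUP v\<in>S. f v)" by (simp add: spectral_norm_def S_def f_def)
  have up: "f v \<le> spectral_norm M" if "v \<in> S" for v
    unfolding sn by (rule cSUP_upper[OF that bdd])
  have "0\<^sub>v b \<in> S" using M by (auto simp: S_def euclid_norm_def)
  moreover have "f (0\<^sub>v b) \<ge> 0" by (simp add: f_def euclid_norm_vnorm)
  ultimately show nn: "spectral_norm M \<ge> 0" using up by force
  show "euclid_norm (M *\<^sub>v v) \<le> spectral_norm M * euclid_norm v"
  proof (cases "euclid_norm v = 0")
    case True
    hence "\<forall>i<b. v $ i = 0" using v by (auto simp: euclid_norm_vnorm vnorm_def L2_set_eq_0_iff)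
    hence "v = 0\<^sub>v b" using v by auto
    hence "M *\<^sub>v v = 0\<^sub>v a" using M by auto
    thus ?thesis using nn by (simp add: euclid_norm_def sum_nonneg)
  next
    case False
    let ?n = "euclid_norm v"
    have n: "?n > 0" using False by (metis euclid_norm_vnorm vnorm_nonneg less_le)
    define u where "u = complex_of_real (1 / ?n) \<cdot>\<^sub>v v"
    have en: "euclid_norm (complex_of_real (1 / ?n) \<cdot>\<^sub>v w) = euclid_norm w / ?n" for w
      using n by (simp add: euclid_norm_def norm_mult power_mult_distrib norm_divide
          sum_distrib_left[symmetric] real_sqrt_mult power_divide sum_divide_distrib[symmetric] real_sqrt_divide)
    have "u \<in> S" using v M en[of v] n by (auto simp: S_def u_def)
    from up[OF this] have "euclid_norm (M *\<^sub>v v) / ?n \<le> spectral_norm M"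
      using M v by (simp add: f_def u_def mult_mat_vec en del: of_real_divide)
    thus ?thesis using n by (simp add: field_simps)
  qed
qed

lemma spectral_norm_form_bound:
  assumes M: "M \<in> carrier_mat a b" and "spectral_norm M \<le> c"
  shows "form_bound a b (\<lambda>i j. M $$ (i, j)) c"
  unfolding form_bound_def
proof (intro allI)
  fix y v :: "nat \<Rightarrow> complex"
  let ?v = "vec b v"
  have n: "euclid_norm ?v = vnorm b v" by (simp add: euclid_norm_vnorm vnorm_def cong: L2_set_cong_simp)
  have e: "(M *\<^sub>v ?v) $ i = (\<Sum>j<b. M $$ (i, j) * v j)" if "i < a" for i
    using that M by (simp add: scalar_prod_def lessThan_atLeast0)
  have "cmod (\<Sum>i<a. \<Sum>j<b. y i * M $$ (i, j) * v j) = cmod (\<Sum>i<a. y i * (M *\<^sub>v ?v) $ i)"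
    by (simp add: e sum_distrib_left mult.assoc del: index_mult_mat_vec)
  also have "\<dots> \<le> vnorm a y * vnorm a (\<lambda>i. (M *\<^sub>v ?v) $ i)" by (rule vnorm_cauchy)
  also have "\<dots> \<le> vnorm a y * (c * vnorm b v)"
  proof (intro mult_left_mono)
    have "vnorm a (\<lambda>i. (M *\<^sub>v ?v) $ i) = euclid_norm (M *\<^sub>v ?v)"
      using M by (simp add: euclid_norm_vnorm)
    also have "\<dots> \<le> spectral_norm M * vnorm b v"
      using spectral_norm_upper(1)[OF M, of ?v] n by simp
    also have "\<dots> \<le> c * vnorm b v" using assms(2) by (intro mult_right_mono) auto
    finally show "vnorm a (\<lambda>i. (M *\<^sub>v ?v) $ i) \<le> c * vnorm b v" .
  qed simp
  finally show "cmod (\<Sum>i<a. \<Sum>j<b. y i * M $$ (i, j) * v j) \<le> c * vnorm a y * vnorm b v"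
    by (simp only: mult_ac)
qed

lemma vnorm_of_real_square: "(vnorm n (\<lambda>i. complex_of_real (x i)))\<^sup>2 = (\<Sum>i<n. (x i)\<^sup>2)"
  by (simp add: vnorm_square)

text \<open>Row by row everything is dominated by the scalar series \<open>d i\<close>, the
  coefficients of row i applied to |v|, whose value at a real point r is \<open>e r i\<close>; the
  form bound at r controls the square sum of these values over i. The total comes from r = 1, the
  tail from the pair s, 1/s, hence the factor 2.\<close>

lemma nonneg_laurent_residue_sums:
  fixes K :: "nat \<Rightarrow> nat \<Rightarrow> int \<Rightarrow> real" and F :: "complex \<Rightarrow> nat \<Rightarrow> nat \<Rightarrow> complex"
  assumes t: "t > 1" and N: "N > 0" and \<zeta>: "cmod \<zeta> = 1" and \<delta>: "\<delta> \<ge> 0"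
    and K: "\<And>i j. i < a \<Longrightarrow> j < b \<Longrightarrow> nonneg_laurent t (K i j) (\<lambda>z. F z i j)"
    and F: "\<And>r. 1 / t < r \<Longrightarrow> r < t \<Longrightarrow> form_bound a b (F (complex_of_real r)) \<delta>"
  defines "R \<equiv> \<lambda>p i j. residue_sum N (\<lambda>n. \<zeta> powi n * complex_of_real (K i j n)) p"
  shows "(\<Sum>p\<in>{0..<int N}. (vnorm a (\<lambda>i. \<Sum>j<b. R p i j * v j))\<^sup>2) \<le> (\<delta> * vnorm b v)\<^sup>2"
    and "J \<subseteq> {int l + 1..int N - 1 - int l} \<Longrightarrow>
      (\<Sum>p\<in>J. (vnorm a (\<lambda>i. \<Sum>j<b. R p i j * v j))\<^sup>2)
        \<le> 2 * ((1 / t) ^ (2 * (l + 1)) + (1 / t) ^ N) * (\<delta> * vnorm b v)\<^sup>2"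
proof -
  define d where "d i n = (\<Sum>j<b. K i j n * cmod (v j))" for i n
  define e where "e r i = (\<Sum>j<b. Re (F (complex_of_real r) i j) * cmod (v j))" for r i
  have Knn: "K i j n \<ge> 0" if "i < a" "j < b" for i j n
    using K[OF that] by (simp add: nonneg_laurent_def)
  have dnn: "d i n \<ge> 0" if "i < a" for i n
    using Knn that by (auto simp: d_def intro!: sum_nonneg)
  have ann: "complex_of_real r \<in> annulus (1 / t) t" if "1 / t < r" "r < t" for r
  proof -
    have "0 < 1 / t" using t by simp
    hence "0 < r" using that(1) by linarith
    thus ?thesis using that by (simp add: annulus_def)
  qed
  have rpos: "r > 0" if "1 / t < r" for r
  proof -
    have "0 < 1 / t" using t by simp
    with that show ?thesis by linarith
  qed
  have Ksum: "((\<lambda>n. r powi n * K i j n) has_sum Re (F (complex_of_real r) i j)) UNIV"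
    and Freal: "F (complex_of_real r) i j = complex_of_real (Re (F (complex_of_real r) i j))"
    if "1 / t < r" "r < t" "i < a" "j < b" for r i j
    using nonneg_laurentD(2,5)[OF K[OF that(3,4)] ann[OF that(1,2)]] rpos[OF that(1)] by auto
  have dsum: "((\<lambda>n. r powi n * d i n) has_sum e r i) UNIV" if "1 / t < r" "r < t" "i < a" for r i
    unfolding d_def e_def sum_distrib_left mult.assoc[symmetric]
    using Ksum that by (intro has_sum_finite_sum has_sum_cmult_left) auto
  have ebound: "(\<Sum>i<a. (e r i)\<^sup>2) \<le> (\<delta> * vnorm b v)\<^sup>2" if r: "1 / t < r" "r < t" for r
  proof -
    have "vnorm a (\<lambda>i. complex_of_real (e r i)) =
        vnorm a (\<lambda>i. \<Sum>j<b. F (complex_of_real r) i j * complex_of_real (cmod (v j)))"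
      unfolding vnorm_def e_def
    proof (intro L2_set_cong refl arg_cong[where f = cmod])
      fix i assume i: "i \<in> {..<a}"
      have "F (complex_of_real r) i j * complex_of_real (cmod (v j)) =
          complex_of_real (Re (F (complex_of_real r) i j) * cmod (v j))" if "j < b" for j
        using i that by (subst Freal[OF r]) auto
      thus "complex_of_real (\<Sum>j<b. Re (F (complex_of_real r) i j) * cmod (v j)) =
          (\<Sum>j<b. F (complex_of_real r) i j * complex_of_real (cmod (v j)))"
        unfolding of_real_sum by (intro sum.cong refl) (simp only: lessThan_iff)
    qed
    also have "\<dots> \<le> \<delta> * vnorm b (\<lambda>j. complex_of_real (cmod (v j)))"
      by (rule form_bound_vnorm[OF F[OF r] \<delta>])
    finally have "vnorm a (\<lambda>i. complex_of_real (e r i)) \<le> \<delta> * vnorm b v" by simp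
    from power_mono[OF this vnorm_nonneg, of 2] show ?thesis by (simp add: vnorm_of_real_square)
  qed
  have one: "1 / t < 1" "1 < t" using t by auto
  have Ksm: "K i j summable_on S" if "i < a" "j < b" for i j S
    using summable_on_subset_banach[OF has_sum_imp_summable[OF Ksum[OF one that]], of S] by simp
  have dsm: "d i summable_on UNIV" if "i < a" for i
    using has_sum_imp_summable[OF dsum[OF one that]] by simp
  have le: "cmod (\<Sum>j<b. R p i j * v j) \<le> residue_sum N (d i) p" if i: "i < a" for i p
  proof -
    let ?S = "{n. n mod int N = p mod int N}"
    have "cmod (\<Sum>j<b. R p i j * v j) \<le> (\<Sum>j<b. residue_sum N (K i j) p * cmod (v j))"
    proof (intro order_trans[OF norm_sum] sum_mono)
      fix j assume "j \<in> {..<b}"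
      hence j: "j < b" by simp
      have eq: "cmod (\<zeta> powi n * complex_of_real (K i j n)) = K i j n" for n
        using Knn[OF i j, of n] by (simp add: norm_mult norm_power_int \<zeta>)
      have "cmod (R p i j) \<le> residue_sum N (K i j) p"
        unfolding R_def residue_sum_def
        using norm_infsum_bound[of "\<lambda>n. \<zeta> powi n * complex_of_real (K i j n)" ?S] Ksm[OF i j]
        by (simp only: eq)
      thus "cmod (R p i j * v j) \<le> residue_sum N (K i j) p * cmod (v j)"
        by (simp add: norm_mult mult_right_mono)
    qed
    also have "\<dots> = residue_sum N (d i) p"
      unfolding residue_sum_def d_def
      by (rule infsumI[symmetric], intro has_sum_finite_sum has_sum_cmult_left has_sum_infsum Ksm i) auto
    finally show ?thesis .
  qed
  have red: "(\<Sum>p\<in>J. (vnorm a (\<lambda>i. \<Sum>j<b. R p i j * v j))\<^sup>2) \<le> (\<Sum>i<a. \<Sum>p\<in>J. (residue_sum N (d i) p)\<^sup>2)" for J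
  proof -
    have "(\<Sum>p\<in>J. (vnorm a (\<lambda>i. \<Sum>j<b. R p i j * v j))\<^sup>2) \<le> (\<Sum>p\<in>J. \<Sum>i<a. (residue_sum N (d i) p)\<^sup>2)"
      unfolding vnorm_square by (intro sum_mono power_mono le) auto
    thus ?thesis by (subst sum.swap)
  qed
  show "(\<Sum>p\<in>{0..<int N}. (vnorm a (\<lambda>i. \<Sum>j<b. R p i j * v j))\<^sup>2) \<le> (\<delta> * vnorm b v)\<^sup>2"
  proof -
    have "(\<Sum>i<a. \<Sum>p\<in>{0..<int N}. (residue_sum N (d i) p)\<^sup>2) \<le> (\<Sum>i<a. (e 1 i)\<^sup>2)"
    proof (intro sum_mono)
      fix i assume "i \<in> {..<a}"
      hence i: "i < a" by simp
      have "(\<Sum>\<^sub>\<infinity>n. d i n) = e 1 i" using infsumI[OF dsum[OF one i]] by simp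
      thus "(\<Sum>p\<in>{0..<int N}. (residue_sum N (d i) p)\<^sup>2) \<le> (e 1 i)\<^sup>2"
        using sum_residue_squares_le[OF dnn[OF i] dsm[OF i] N subset_refl] by simp
    qed
    with red[of "{0..<int N}"] ebound[OF one] show ?thesis by linarith
  qed
  assume J: "J \<subseteq> {int l + 1..int N - 1 - int l}"
  let ?L = "\<Sum>p\<in>J. (vnorm a (\<lambda>i. \<Sum>j<b. R p i j * v j))\<^sup>2"
  \<comment> \<open>No bound is given on the boundary circle, so the estimate is made for s > 1/t
    and then passed to the limit.\<close>
  have bound: "?L \<le> 2 * (s ^ (2 * (l + 1)) + s ^ N) * (\<delta> * vnorm b v)\<^sup>2" if s: "1 / t < s" "s < 1" for s
  proof -
    have s0: "s > 0" by (rule rpos[OF s(1)])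
    have st: "s < t" "1 / t < inverse s" "inverse s < t"
      using s t s0 by (auto simp: field_simps)
    have "?L \<le> (\<Sum>i<a. (s ^ (2 * (l + 1)) + s ^ N) * ((e (inverse s) i)\<^sup>2 + (e s i)\<^sup>2))"
      using dnn s s0 st dsum
      by (intro order_trans[OF red] sum_mono residue_sum_tail[OF _ _ _ N _ _ J]) auto
    also have "\<dots> = (s ^ (2 * (l + 1)) + s ^ N) * ((\<Sum>i<a. (e (inverse s) i)\<^sup>2) + (\<Sum>i<a. (e s i)\<^sup>2))"
      by (simp only: sum.distrib[symmetric] sum_distrib_left)
    also have "\<dots> \<le> (s ^ (2 * (l + 1)) + s ^ N) * ((\<delta> * vnorm b v)\<^sup>2 + (\<delta> * vnorm b v)\<^sup>2)"
      using s0 by (intro mult_left_mono add_mono ebound s st) auto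
    finally show ?thesis by (simp only: mult_2 ring_distribs)
  qed
  show "?L \<le> 2 * ((1 / t) ^ (2 * (l + 1)) + (1 / t) ^ N) * (\<delta> * vnorm b v)\<^sup>2"
  proof (rule tendsto_lowerbound)
    show "((\<lambda>s. 2 * (s ^ (2 * (l + 1)) + s ^ N) * (\<delta> * vnorm b v)\<^sup>2) \<longlongrightarrow>
        2 * ((1 / t) ^ (2 * (l + 1)) + (1 / t) ^ N) * (\<delta> * vnorm b v)\<^sup>2) (at_right (1 / t))"
      by (intro tendsto_intros)
    show "\<forall>\<^sub>F s in at_right (1 / t). ?L \<le> 2 * (s ^ (2 * (l + 1)) + s ^ N) * (\<delta> * vnorm b v)\<^sup>2"
      using eventually_at_right_less[of "1 / t"] eventually_at_right_real[OF one(1)]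
      by eventually_elim (use bound in auto)
  qed simp
qed

subsection \<open>Folded products\<close>

lemma singular_value_le_finite:
  assumes X: "X \<in> carrier_mat a b" and I: "finite I" "card I < s"
    and dec: "\<And>i j. i < a \<Longrightarrow> j < b \<Longrightarrow> X $$ (i, j) = (\<Sum>e\<in>I. P e i * Q e j) + Y i j"
    and Y: "form_bound a b Y \<epsilon>" and \<epsilon>: "\<epsilon> \<ge> 0"
  shows "\<sigma> s X \<le> \<epsilon>"
proof -
  obtain h where h: "bij_betw h {..<card I} I"
    using ex_bij_betw_nat_finite[OF I(1)] by (auto simp: lessThan_atLeast0)
  show ?thesis
  proof (rule singular_value_le[OF X _ I(2) _ Y \<epsilon>])
    show "1 \<le> s" using I by simp
    fix i j assume "i < a" "j < b"
    thus "X $$ (i, j) = (\<Sum>e<card I. P (h e) i * Q (h e) j) + Y i j"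
      using dec sum.reindex_bij_betw[OF h, of "\<lambda>e. P e i * Q e j"] by simp
  qed
qed

lemma sum_swap4:
  "(\<Sum>i\<in>A. \<Sum>j\<in>B. \<Sum>u\<in>U. \<Sum>w\<in>W u. f i j u w) = (\<Sum>u\<in>U. \<Sum>w\<in>W u. \<Sum>i\<in>A. \<Sum>j\<in>B. f i j u w)"
  (is "?l = ?r")
proof -
  have "?l = (\<Sum>i\<in>A. \<Sum>u\<in>U. \<Sum>j\<in>B. \<Sum>w\<in>W u. f i j u w)" by (intro sum.cong refl sum.swap)
  also have "\<dots> = (\<Sum>u\<in>U. \<Sum>i\<in>A. \<Sum>j\<in>B. \<Sum>w\<in>W u. f i j u w)" by (rule sum.swap)
  also have "\<dots> = (\<Sum>u\<in>U. \<Sum>i\<in>A. \<Sum>w\<in>W u. \<Sum>j\<in>B. f i j u w)" by (intro sum.cong refl sum.swap)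
  also have "\<dots> = ?r" by (intro sum.cong refl sum.swap)
  finally show ?thesis .
qed

text \<open>Abstracts the product of FD, the three-term C and FE. In the application FD is the
  inverse of I - D, FE the upper left block of \<psi>, and \<zeta> an N-th root of the point where
  the folded series is evaluated.\<close>

locale folded_product =
  fixes t \<delta> L :: real and N a b :: nat and \<zeta> :: complex
    and KD KE :: "nat \<Rightarrow> nat \<Rightarrow> int \<Rightarrow> real" and FD FE :: "complex \<Rightarrow> nat \<Rightarrow> nat \<Rightarrow> complex"
    and C :: "int \<Rightarrow> nat \<Rightarrow> nat \<Rightarrow> complex"
  assumes t: "t > 1" and N: "N > 0" and \<zeta>: "cmod \<zeta> = 1" and \<delta>: "\<delta> \<ge> 0" and L: "L \<ge> 0"
    and KD: "\<And>i j. i < a \<Longrightarrow> j < a \<Longrightarrow> nonneg_laurent t (KD i j) (\<lambda>z. FD z i j)"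
    and FD: "\<And>r. 1 / t < r \<Longrightarrow> r < t \<Longrightarrow> form_bound a a (FD (complex_of_real r)) \<delta>"
    and KE: "\<And>i j. i < b \<Longrightarrow> j < b \<Longrightarrow> nonneg_laurent t (KE i j) (\<lambda>z. FE z i j)"
    and FE: "\<And>r. 1 / t < r \<Longrightarrow> r < t \<Longrightarrow> form_bound b b (FE (complex_of_real r)) \<delta>"
    and C: "\<And>l. l \<in> {-1, 0, 1} \<Longrightarrow> form_bound a b (C l) L"
begin

definition "RD p i j = residue_sum N (\<lambda>n. \<zeta> powi n * complex_of_real (KD i j n)) p"
definition "RE p i j = residue_sum N (\<lambda>n. \<zeta> powi n * complex_of_real (KE i j n)) p"

definition "summand l q i j =
  \<zeta> powi l * (\<Sum>u<a. \<Sum>w<b. RD (- l - q) i u * C l u w * RE q w j)"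

text \<open>S depends on l because one splitting, \<open>both_tails\<close>, restricts q differently
  for each l.\<close>

definition "part S i j = (\<Sum>l\<in>{-1, 0, 1 :: int}. \<Sum>q\<in>S l. summand l q i j)"

text \<open>The residues at cyclic distance more than j from 0. The set is empty unless
  \<open>N \<ge> 2 * j + 2\<close>.\<close>

definition "tail j = {int j + 1..int N - 1 - int j}"

definition "x = 1 / t"

lemma x: "0 < x" "x < 1"
  using t by (auto simp: x_def)

lemma tail_subset: "tail j \<subseteq> {0..<int N}"
  by (auto simp: tail_def)

lemma RD_mod [simp]: "RD (p mod int N) = RD p"
  by (intro ext) (simp add: RD_def)

definition "nE q v = vnorm b (\<lambda>i. \<Sum>j<b. RE q i j * v j)"
definition "nD p y = vnorm a (\<lambda>j. \<Sum>i<a. y i * RD p i j)"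

lemma nE_total:
  assumes "S \<subseteq> {0..<int N}"
  shows "(\<Sum>q\<in>S. (nE q v)\<^sup>2) \<le> (\<delta> * vnorm b v)\<^sup>2"
proof -
  have "(\<Sum>q\<in>S. (nE q v)\<^sup>2) \<le> (\<Sum>q\<in>{0..<int N}. (nE q v)\<^sup>2)"
    using assms by (intro sum_mono2) auto
  also have "\<dots> \<le> (\<delta> * vnorm b v)\<^sup>2"
    unfolding nE_def RE_def by (rule nonneg_laurent_residue_sums(1)[OF t N \<zeta> \<delta> KE FE])
  finally show ?thesis .
qed

text \<open>A nonempty tail forces \<open>2 * (j + 1) \<le> N\<close>, so x^N is absorbed by the
  other term. The unsimplified bound is kept for \<open>both_tails\<close>, where this loss would be
  too large.\<close>

lemma tail_bound_simplify:
  assumes "tail j \<noteq> {}"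
  shows "2 * (x ^ (2 * (j + 1)) + x ^ N) \<le> (2 * x ^ (j + 1))\<^sup>2"
proof -
  have "2 * (j + 1) \<le> N" using assms by (auto simp: tail_def)
  hence "x ^ N \<le> x ^ (2 * (j + 1))" using x by (intro power_decreasing) auto
  hence "2 * (x ^ (2 * (j + 1)) + x ^ N) \<le> 2 * (x ^ (2 * (j + 1)) + x ^ (2 * (j + 1)))"
    by (intro mult_left_mono add_left_mono) auto
  also have "\<dots> = 2\<^sup>2 * (x ^ (j + 1))\<^sup>2"
    by (simp only: power_mult[symmetric] mult.commute[of 2 "j + 1"]) (simp only: mult_2[symmetric] power2_eq_square mult.assoc)
  finally show ?thesis by (simp only: power_mult_distrib)
qed

lemma nE_tail_sharp:
  "S \<subseteq> tail j \<Longrightarrow> (\<Sum>q\<in>S. (nE q v)\<^sup>2) \<le> 2 * (x ^ (2 * (j + 1)) + x ^ N) * (\<delta> * vnorm b v)\<^sup>2"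
  unfolding nE_def RE_def tail_def x_def
  by (rule nonneg_laurent_residue_sums(2)[OF t N \<zeta> \<delta> KE FE])

lemma nE_tail:
  assumes "S \<subseteq> tail j"
  shows "(\<Sum>q\<in>S. (nE q v)\<^sup>2) \<le> (2 * x ^ (j + 1) * \<delta> * vnorm b v)\<^sup>2"
proof (cases "S = {}")
  case False
  hence "tail j \<noteq> {}" using assms by auto
  from mult_right_mono[OF tail_bound_simplify[OF this] zero_le_power2, of "\<delta> * vnorm b v"]
  have "2 * (x ^ (2 * (j + 1)) + x ^ N) * (\<delta> * vnorm b v)\<^sup>2 \<le> (2 * x ^ (j + 1) * \<delta> * vnorm b v)\<^sup>2"
    by (simp only: power_mult_distrib mult.assoc)
  with nE_tail_sharp[OF assms, of v] show ?thesis by (rule order_trans)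
qed simp

text \<open>The estimate for row vectors is the one for column vectors applied to the transposed
  family, which satisfies the same form bound.\<close>

lemma nD_total_all: "(\<Sum>p\<in>{0..<int N}. (nD p y)\<^sup>2) \<le> (\<delta> * vnorm a y)\<^sup>2"
  unfolding nD_def RD_def mult.commute[of "y _"]
  by (rule nonneg_laurent_residue_sums(1)[OF t N \<zeta> \<delta> KD form_bound_transpose[OF FD]])

lemma nD_tail_all:
  "(\<Sum>p\<in>tail j. (nD p y)\<^sup>2) \<le> 2 * (x ^ (2 * (j + 1)) + x ^ N) * (\<delta> * vnorm a y)\<^sup>2"
  unfolding nD_def RD_def mult.commute[of "y _"] tail_def x_def
  by (rule nonneg_laurent_residue_sums(2)[OF t N \<zeta> \<delta> KD form_bound_transpose[OF FD] subset_refl])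

text \<open>On residues the map from q to - l - q is injective, so a sum of left factors over q runs
  over distinct classes p.\<close>

lemma nD_reflect:
  assumes S: "S \<subseteq> {0..<int N}" and J: "(\<lambda>q. (- l - q) mod int N) ` S \<subseteq> J" "finite J"
  shows "(\<Sum>q\<in>S. (nD (- l - q) y)\<^sup>2) \<le> (\<Sum>p\<in>J. (nD p y)\<^sup>2)"
proof -
  let ?f = "\<lambda>q. (- l - q) mod int N"
  have inj: "inj_on ?f S"
  proof (rule inj_onI)
    fix p q assume pq: "p \<in> S" "q \<in> S" "?f p = ?f q"
    hence "int N dvd (- l - p) - (- l - q)" by (simp only: mod_eq_dvd_iff)
    hence "int N dvd q - p" by simp
    hence "q mod int N = p mod int N" by (simp only: mod_eq_dvd_iff)
    thus "p = q" using pq S by (auto simp: mod_pos_pos_trivial subset_iff)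
  qed
  have "(\<Sum>q\<in>S. (nD (- l - q) y)\<^sup>2) = (\<Sum>q\<in>S. (nD (?f q) y)\<^sup>2)"
    by (simp add: nD_def)
  also have "\<dots> = (\<Sum>p\<in>?f ` S. (nD p y)\<^sup>2)" by (simp add: sum.reindex[OF inj])
  also have "\<dots> \<le> (\<Sum>p\<in>J. (nD p y)\<^sup>2)" using J by (intro sum_mono2) auto
  finally show ?thesis .
qed

lemma nD_total: "S \<subseteq> {0..<int N} \<Longrightarrow> (\<Sum>q\<in>S. (nD (- l - q) y)\<^sup>2) \<le> (\<delta> * vnorm a y)\<^sup>2"
  using nD_reflect[of S l "{0..<int N}" y] nD_total_all[of y] N by force

lemma nD_tail:
  assumes S: "S \<subseteq> {0..<int N}" and J: "(\<lambda>q. (- l - q) mod int N) ` S \<subseteq> tail j"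
  shows "(\<Sum>q\<in>S. (nD (- l - q) y)\<^sup>2) \<le> 2 * (x ^ (2 * (j + 1)) + x ^ N) * (\<delta> * vnorm a y)\<^sup>2"
    and "(\<Sum>q\<in>S. (nD (- l - q) y)\<^sup>2) \<le> (2 * x ^ (j + 1) * \<delta> * vnorm a y)\<^sup>2"
proof -
  show 1: "(\<Sum>q\<in>S. (nD (- l - q) y)\<^sup>2) \<le> 2 * (x ^ (2 * (j + 1)) + x ^ N) * (\<delta> * vnorm a y)\<^sup>2"
    using nD_reflect[OF S J, of y] nD_tail_all[of y j] by (simp add: tail_def)
  show "(\<Sum>q\<in>S. (nD (- l - q) y)\<^sup>2) \<le> (2 * x ^ (j + 1) * \<delta> * vnorm a y)\<^sup>2"
  proof (cases "S = {}")
    case False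
    hence "tail j \<noteq> {}" using J by auto
    from mult_right_mono[OF tail_bound_simplify[OF this] zero_le_power2, of "\<delta> * vnorm a y"]
    have "2 * (x ^ (2 * (j + 1)) + x ^ N) * (\<delta> * vnorm a y)\<^sup>2 \<le> (2 * x ^ (j + 1) * \<delta> * vnorm a y)\<^sup>2"
      by (simp only: power_mult_distrib mult.assoc)
    with 1 show ?thesis by (rule order_trans)
  qed simp
qed

text \<open>Negation preserves the cyclic distance from 0, and a shift by l changes it by at most
  one.\<close>

lemma reflect_tail:
  assumes q: "q \<in> tail j"
  shows "(- 0 - q) mod int N \<in> tail j"
    and "l \<in> {-1, 0, 1} \<Longrightarrow> j \<ge> 1 \<Longrightarrow> (- l - q) mod int N \<in> tail (j - 1)"
proof -
  have *: "(- l - q) mod int N = int N - l - q" if "0 < l + q" "l + q < int N" for l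
  proof -
    have "(- l - q) mod int N = (int N - l - q) mod int N"
      using mod_add_self2[of "- l - q" "int N"] by (simp add: algebra_simps)
    also have "\<dots> = int N - l - q" using that by (intro mod_pos_pos_trivial) auto
    finally show ?thesis .
  qed
  show "(- 0 - q) mod int N \<in> tail j" using *[of 0] q by (auto simp: tail_def)
  show "(- l - q) mod int N \<in> tail (j - 1)" if "l \<in> {-1, 0, 1}" "j \<ge> 1"
    using *[of l] q that by (auto simp: tail_def of_nat_diff)
qed

text \<open>Each summand is the form of C_l between y RD and RE v, so it costs
  \<open>L * nD * nE\<close>; Cauchy-Schwarz over q then pairs the square sums. The constants may
  vary with l because for \<open>l \<noteq> 0\<close> the reflected tail only fits into a larger
  one.\<close>

lemma part_form_bound:
  assumes c: "\<And>l. l \<in> {-1, 0, 1} \<Longrightarrow> c l \<ge> 0" and d: "\<And>l. l \<in> {-1, 0, 1} \<Longrightarrow> d l \<ge> 0"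
    and D: "\<And>l y. l \<in> {-1, 0, 1} \<Longrightarrow> (\<Sum>q\<in>S l. (nD (- l - q) y)\<^sup>2) \<le> (c l * vnorm a y)\<^sup>2"
    and E: "\<And>l v. l \<in> {-1, 0, 1} \<Longrightarrow> (\<Sum>q\<in>S l. (nE q v)\<^sup>2) \<le> (d l * vnorm b v)\<^sup>2"
  shows "form_bound a b (part S) (\<Sum>l\<in>{-1, 0, 1 :: int}. L * (c l * d l))"
  unfolding form_bound_def
proof (intro allI)
  fix y v
  have one: "cmod (\<Sum>i<a. \<Sum>j<b. y i * summand l q i j * v j) \<le> L * nD (- l - q) y * nE q v"
    if l: "l \<in> {-1, 0, 1}" for l q
  proof -
    have "(\<Sum>i<a. \<Sum>j<b. y i * summand l q i j * v j) =
      (\<Sum>i<a. \<Sum>j<b. \<Sum>u<a. \<Sum>w<b. \<zeta> powi l * (y i * RD (- l - q) i u * C l u w * (RE q w j * v j)))"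
      unfolding summand_def sum_distrib_left sum_distrib_right
      by (intro sum.cong refl) (simp only: mult_ac)
    also have "\<dots> = (\<Sum>u<a. \<Sum>w<b. \<Sum>i<a. \<Sum>j<b. \<zeta> powi l * (y i * RD (- l - q) i u * C l u w * (RE q w j * v j)))"
      by (rule sum_swap4)
    also have "\<dots> = \<zeta> powi l * (\<Sum>u<a. \<Sum>w<b. (\<Sum>i<a. y i * RD (- l - q) i u) * C l u w * (\<Sum>j<b. RE q w j * v j))"
    proof -
      have "(\<Sum>i<a. \<Sum>j<b. \<zeta> powi l * (y i * RD (- l - q) i u * C l u w * (RE q w j * v j))) =
          \<zeta> powi l * ((\<Sum>i<a. y i * RD (- l - q) i u) * C l u w * (\<Sum>j<b. RE q w j * v j))" for u w
        by (subst sum_distrib_right, subst sum_product) (simp only: sum_distrib_left)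
      thus ?thesis by (simp only: sum_distrib_left[of "\<zeta> powi l", symmetric])
    qed
    finally have "cmod (\<Sum>i<a. \<Sum>j<b. y i * summand l q i j * v j) =
        cmod (\<zeta> powi l * (\<Sum>u<a. \<Sum>w<b. (\<Sum>i<a. y i * RD (- l - q) i u) * C l u w * (\<Sum>j<b. RE q w j * v j)))"
      by (rule arg_cong)
    also have "\<dots> = cmod (\<Sum>u<a. \<Sum>w<b. (\<Sum>i<a. y i * RD (- l - q) i u) * C l u w * (\<Sum>j<b. RE q w j * v j))"
      by (simp only: norm_mult norm_power_int \<zeta> power_int_1_left mult_1)
    also have "\<dots> \<le> L * nD (- l - q) y * nE q v"
      unfolding nD_def nE_def
      by (rule form_boundD[OF C[OF l], of "\<lambda>u. \<Sum>i<a. y i * RD (- l - q) i u" "\<lambda>w. \<Sum>j<b. RE q w j * v j"])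
    finally show ?thesis .
  qed
  have two: "(\<Sum>q\<in>S l. L * nD (- l - q) y * nE q v) \<le> L * (c l * d l) * vnorm a y * vnorm b v"
    if l: "l \<in> {-1, 0, 1}" for l
  proof -
    have "(\<Sum>q\<in>S l. \<bar>nD (- l - q) y\<bar> * \<bar>nE q v\<bar>) \<le> L2_set (\<lambda>q. nD (- l - q) y) (S l) * L2_set (\<lambda>q. nE q v) (S l)"
      by (rule L2_set_mult_ineq)
    also have "\<dots> \<le> (c l * vnorm a y) * (d l * vnorm b v)"
      unfolding L2_set_def using c[OF l] d[OF l]
      by (intro mult_mono real_le_lsqrt D[OF l] E[OF l]) (auto simp: sum_nonneg)
    finally have "(\<Sum>q\<in>S l. nD (- l - q) y * nE q v) \<le> (c l * vnorm a y) * (d l * vnorm b v)"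
      by (simp add: nD_def nE_def)
    from mult_left_mono[OF this L] show ?thesis
      by (simp add: sum_distrib_left mult_ac)
  qed
  have eq: "(\<Sum>i<a. \<Sum>j<b. y i * part S i j * v j) =
    (\<Sum>l\<in>{-1, 0, 1 :: int}. \<Sum>q\<in>S l. \<Sum>i<a. \<Sum>j<b. y i * summand l q i j * v j)"
    unfolding part_def sum_distrib_left sum_distrib_right by (rule sum_swap4)
  have "cmod (\<Sum>i<a. \<Sum>j<b. y i * part S i j * v j) \<le>
      (\<Sum>l\<in>{-1, 0, 1 :: int}. \<Sum>q\<in>S l. L * nD (- l - q) y * nE q v)"
    unfolding eq by (intro order_trans[OF norm_sum] sum_mono one)
  also have "\<dots> \<le> (\<Sum>l\<in>{-1, 0, 1 :: int}. L * (c l * d l) * vnorm a y * vnorm b v)"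
    by (intro sum_mono two)
  also have "\<dots> = (\<Sum>l\<in>{-1, 0, 1 :: int}. L * (c l * d l)) * vnorm a y * vnorm b v"
    by (simp only: sum_distrib_right)
  finally show "cmod (\<Sum>i<a. \<Sum>j<b. y i * part S i j * v j) \<le>
    (\<Sum>l\<in>{-1, 0, 1 :: int}. L * (c l * d l)) * vnorm a y * vnorm b v" .
qed

lemma part_split:
  assumes "\<And>l. l \<in> {-1, 0, 1} \<Longrightarrow> S l \<subseteq> T l \<and> finite (T l)"
  shows "part T i j = part (\<lambda>l. T l - S l) i j + part S i j"
  unfolding part_def sum.distrib[symmetric] using assms
  by (intro sum.cong refl sum.subset_diff) auto

text \<open>The residue 0 and at most two residues at each cyclic distance 1, ..., j.\<close>

lemma card_kept: "card ({0..<int N} - tail j) \<le> 2 * j + 1"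
proof -
  have "{0..<int N} - tail j \<subseteq> {0..int j} \<union> {int N - int j..<int N}"
    by (auto simp: tail_def)
  hence "card ({0..<int N} - tail j) \<le> card ({0..int j} \<union> {int N - int j..<int N})"
    by (intro card_mono) auto
  also have "\<dots> \<le> card {0..int j} + card {int N - int j..<int N}" by (rule card_Un_le)
  finally show ?thesis by simp
qed

end

text \<open>In the next two lemmas the cubic left after splitting off \<open>y (y\<^sup>2 - 2/5)\<^sup>2\<close> is bounded by its tangent line
  near its minimum, using \<open>y\<^sup>3 - 3 c\<^sup>2 y + 2 c\<^sup>3 = (y - c)\<^sup>2 (y + 2 c)\<close>.\<close>

lemma sqrt_bound_1:
  fixes y :: real
  assumes "0 \<le> y" "y \<le> 1"
  shows "y * (2 + y\<^sup>2) * (1 - y\<^sup>2) \<le> 1"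
proof -
  have "0 \<le> y * (y\<^sup>2 - 2/5)\<^sup>2 + 9/5 * ((y - 16/25)\<^sup>2 * (y + 32/25)) + (y * (9/5 * 3 * (16/25)\<^sup>2 - 54/25) + (1 - 9/5 * 2 * (16/25)^3))"
    using assms by (intro add_nonneg_nonneg mult_nonneg_nonneg) (auto simp: power2_eq_square power3_eq_cube)
  also have "\<dots> = 1 - y * (2 + y\<^sup>2) * (1 - y\<^sup>2)"
    by (simp add: power2_eq_square power3_eq_cube field_simps)
  finally show ?thesis by simp
qed

lemma sqrt_bound_2:
  fixes y :: real
  assumes "0 \<le> y"
  shows "3 * y * (1 - y ^ 4) \<le> 2"
proof -
  have "0 \<le> y * (y\<^sup>2 - 2/5)\<^sup>2 + 4/5 * ((y - 7/10)\<^sup>2 * (y + 7/5)) + (y * (4/5 * 3 * (7/10)\<^sup>2 - 29/25) + (2/3 - 4/5 * 2 * (7/10)^3))"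
    using assms by (intro add_nonneg_nonneg mult_nonneg_nonneg) (auto simp: power2_eq_square power3_eq_cube)
  also have "\<dots> = (2 - 3 * y * (1 - y ^ 4)) / 3"
    by (simp add: power2_eq_square power3_eq_cube power4_eq_xxxx field_simps)
  finally show ?thesis by simp
qed

lemma form_bound_eqI: "form_bound a b K c \<Longrightarrow> c = c' \<Longrightarrow> form_bound a b K c'"
  by simp

section \<open>Singular value bounds from a choice of kept residues\<close>

context folded_product
begin

text \<open>The constant of the theorem, since exp(- N log t) = x^N.\<close>

definition "M = 4 * L * \<delta>\<^sup>2 / ((1 - x ^ N) * (1 - x))"

text \<open>Both factors of the denominator lie between 0 and 1. The bound with 1 - x serves the
  tridiagonal case, the cruder one the low-rank case.\<close>

lemma M_ge: "4 * L * \<delta>\<^sup>2 / (1 - x) \<le> M" "4 * L * \<delta>\<^sup>2 \<le> M" "0 \<le> M"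
proof -
  have xN: "0 < 1 - x ^ N" "1 - x ^ N \<le> 1"
    using x N power_less_one_iff[of x N] by auto
  have Ld: "0 \<le> 4 * L * \<delta>\<^sup>2" using L by simp
  have "(1 - x ^ N) * (1 - x) \<le> 1 * (1 - x)" using xN x by (intro mult_right_mono) auto
  thus 1: "4 * L * \<delta>\<^sup>2 / (1 - x) \<le> M"
    unfolding M_def using xN x Ld by (intro divide_left_mono mult_pos_pos) auto
  have "4 * L * \<delta>\<^sup>2 / 1 \<le> 4 * L * \<delta>\<^sup>2 / (1 - x)"
    using x Ld by (intro divide_left_mono) auto
  thus "4 * L * \<delta>\<^sup>2 \<le> M" using 1 by simp
  thus "0 \<le> M" using Ld by linarith
qed

text \<open>The right factor decays on the tail for every l. The three variants below differ only in
  what they use of the left factor: its total, its decay for \<open>l = 0\<close>, or its decay for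
  all l.\<close>

lemma tail_form_bound:
  assumes c: "\<And>l. l \<in> {-1, 0, 1} \<Longrightarrow> c l \<ge> 0"
    and D: "\<And>l y. l \<in> {-1, 0, 1} \<Longrightarrow> (\<Sum>q\<in>tail j. (nD (- l - q) y)\<^sup>2) \<le> (c l * vnorm a y)\<^sup>2"
  shows "form_bound a b (part (\<lambda>_. tail j)) (L * (2 * x ^ (j + 1) * \<delta>) * (c (-1) + c 0 + c 1))"
proof -
  have "form_bound a b (part (\<lambda>_. tail j)) (\<Sum>l\<in>{-1, 0, 1 :: int}. L * (c l * (2 * x ^ (j + 1) * \<delta>)))"
    using x \<delta> by (intro part_form_bound c D nE_tail) auto
  also have "(\<Sum>l\<in>{-1, 0, 1 :: int}. L * (c l * (2 * x ^ (j + 1) * \<delta>))) =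
      L * (2 * x ^ (j + 1) * \<delta>) * (c (-1) + c 0 + c 1)"
    by (simp add: algebra_simps)
  finally show ?thesis .
qed

lemma tail_form_bound_1: "form_bound a b (part (\<lambda>_. tail j)) (6 * L * \<delta>\<^sup>2 * x ^ (j + 1))"
  using tail_form_bound[of "\<lambda>_. \<delta>" j] nD_total[OF tail_subset] \<delta>
  by (simp add: power2_eq_square mult_ac)

lemma tail_form_bound_2:
  "form_bound a b (part (\<lambda>_. tail j)) (4 * L * \<delta>\<^sup>2 * x ^ (j + 1) * (1 + x ^ (j + 1)))"
proof (rule form_bound_eqI[OF tail_form_bound])
  let ?c = "\<lambda>l :: int. if l = 0 then 2 * x ^ (j + 1) * \<delta> else \<delta>"
  show "?c l \<ge> 0" for l using \<delta> x by simp
  show "(\<Sum>q\<in>tail j. (nD (- l - q) y)\<^sup>2) \<le> (?c l * vnorm a y)\<^sup>2" for l y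
  proof (cases "l = 0")
    case True
    have "(\<lambda>q. (- 0 - q) mod int N) ` tail j \<subseteq> tail j" using reflect_tail(1) by blast
    from nD_tail(2)[OF tail_subset this] show ?thesis by (simp only: True if_True refl)
  qed (use nD_total[OF tail_subset] in simp)
  show "L * (2 * x ^ (j + 1) * \<delta>) * (?c (-1) + ?c 0 + ?c 1) = 4 * L * \<delta>\<^sup>2 * x ^ (j + 1) * (1 + x ^ (j + 1))"
    by (simp add: power2_eq_square algebra_simps)
qed

lemma tail_form_bound_3:
  assumes j: "j \<ge> 1"
  shows "form_bound a b (part (\<lambda>_. tail j)) (4 * L * \<delta>\<^sup>2 * x ^ (j + 1) * (2 * x ^ j + x ^ (j + 1)))"
proof (rule form_bound_eqI[OF tail_form_bound])
  let ?c = "\<lambda>l :: int. if l = 0 then 2 * x ^ (j + 1) * \<delta> else 2 * x ^ j * \<delta>"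
  show "?c l \<ge> 0" for l using \<delta> x by simp
  show "(\<Sum>q\<in>tail j. (nD (- l - q) y)\<^sup>2) \<le> (?c l * vnorm a y)\<^sup>2" if l: "l \<in> {-1, 0, 1}" for l y
  proof (cases "l = 0")
    case True
    have "(\<lambda>q. (- 0 - q) mod int N) ` tail j \<subseteq> tail j" using reflect_tail(1) by blast
    from nD_tail(2)[OF tail_subset this] show ?thesis by (simp only: True if_True refl)
  next
    case False
    have "(\<lambda>q. (- l - q) mod int N) ` tail j \<subseteq> tail (j - 1)" using reflect_tail(2)[OF _ l j] by blast
    from nD_tail(2)[OF tail_subset this] have "(\<Sum>q\<in>tail j. (nD (- l - q) y)\<^sup>2) \<le> (2 * x ^ (j - 1 + 1) * \<delta> * vnorm a y)\<^sup>2" .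
    moreover have "j - 1 + 1 = j" using j by simp
    ultimately show ?thesis by (simp only: False if_False)
  qed
  show "L * (2 * x ^ (j + 1) * \<delta>) * (?c (-1) + ?c 0 + ?c 1) =
      4 * L * \<delta>\<^sup>2 * x ^ (j + 1) * (2 * x ^ j + x ^ (j + 1))"
    by (simp add: power2_eq_square algebra_simps)
qed

text \<open>For the third singular value in the tridiagonal case the tails alone are too large; there the residue \<open>0\<close>
  is removed from both factors, at the cost of only two rank-one terms.\<close>

definition "both_tails l = {q \<in> tail 0. (- l - q) mod int N \<in> tail 0}"

lemma both_tails_form_bound: "form_bound a b (part both_tails) (6 * L * \<delta>\<^sup>2 * (x\<^sup>2 + x ^ N))"
proof -
  \<comment> \<open>The square root of the sharp tail bound at \<open>j = 0\<close>, valid for both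
    factors. Keeping x^N instead of a second x^2 leaves the room that the case \<open>s = 3\<close>
    requires.\<close>
  define c where "c = sqrt (2 * (x\<^sup>2 + x ^ N)) * \<delta>"
  have c2: "c\<^sup>2 = 2 * (x\<^sup>2 + x ^ N) * \<delta>\<^sup>2" using x by (simp add: c_def power_mult_distrib)
  have "form_bound a b (part both_tails) (\<Sum>l\<in>{-1, 0, 1 :: int}. L * (c * c))"
  proof (intro part_form_bound)
    fix l :: int and y
    have sub: "both_tails l \<subseteq> tail 0" by (auto simp: both_tails_def)
    have c3: "(c * r)\<^sup>2 = 2 * (x ^ (2 * (0 + 1)) + x ^ N) * (\<delta> * r)\<^sup>2" for r
      by (simp add: power_mult_distrib c2)
    show "(\<Sum>q\<in>both_tails l. (nE q y)\<^sup>2) \<le> (c * vnorm b y)\<^sup>2"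
      unfolding c3 by (rule nE_tail_sharp[OF sub])
    show "(\<Sum>q\<in>both_tails l. (nD (- l - q) y)\<^sup>2) \<le> (c * vnorm a y)\<^sup>2"
      unfolding c3 by (rule nD_tail(1)) (use sub tail_subset[of 0] in \<open>auto simp: both_tails_def\<close>)
  qed (use \<delta> x in \<open>auto simp: c_def\<close>)
  thus ?thesis
    by (rule form_bound_eqI) (simp add: power2_eq_square[of c, symmetric] c2)
qed

lemma summand_low_rank:
  fixes U V :: "nat \<Rightarrow> nat \<Rightarrow> complex"
  assumes "\<And>u w. u < a \<Longrightarrow> w < b \<Longrightarrow> C l u w = (\<Sum>\<kappa><k. U u \<kappa> * V \<kappa> w)"
  shows "summand l q i j = (\<Sum>\<kappa><k. (\<zeta> powi l * (\<Sum>u<a. RD (- l - q) i u * U u \<kappa>)) * (\<Sum>w<b. V \<kappa> w * RE q w j))"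
proof -
  have "(\<Sum>u<a. \<Sum>w<b. RD (- l - q) i u * C l u w * RE q w j) =
      (\<Sum>u<a. \<Sum>w<b. \<Sum>\<kappa><k. (RD (- l - q) i u * U u \<kappa>) * (V \<kappa> w * RE q w j))"
    by (intro sum.cong refl) (simp add: assms sum_distrib_left sum_distrib_right mult_ac)
  also have "\<dots> = (\<Sum>\<kappa><k. \<Sum>u<a. \<Sum>w<b. (RD (- l - q) i u * U u \<kappa>) * (V \<kappa> w * RE q w j))"
    by (subst (2) sum.swap, subst sum.swap) (rule refl)
  also have "\<dots> = (\<Sum>\<kappa><k. (\<Sum>u<a. RD (- l - q) i u * U u \<kappa>) * (\<Sum>w<b. V \<kappa> w * RE q w j))"
    by (simp only: sum_product)
  finally show ?thesis
    unfolding summand_def by (simp only:) (subst sum_distrib_left, simp only: mult.assoc)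
qed

text \<open>The residues outside S form the low-rank part, those in S the perturbation.\<close>

lemma singular_value_part:
  assumes X: "X \<in> carrier_mat a b"
    and Xe: "\<And>i j. i < a \<Longrightarrow> j < b \<Longrightarrow> X $$ (i, j) = part (\<lambda>_. {0..<int N}) i j"
    and S: "\<And>l. l \<in> {-1, 0, 1} \<Longrightarrow> S l \<subseteq> {0..<int N}"
    and I: "finite I" "card I < s"
    and R: "\<And>i j. i < a \<Longrightarrow> j < b \<Longrightarrow> part (\<lambda>l. {0..<int N} - S l) i j = (\<Sum>e\<in>I. P e i * Q e j)"
    and Y: "form_bound a b (part S) \<epsilon>" and \<epsilon>: "\<epsilon> \<ge> 0"
  shows "\<sigma> s X \<le> \<epsilon>"
proof (rule singular_value_le_finite[OF X I _ Y \<epsilon>])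
  fix i j assume ij: "i < a" "j < b"
  show "X $$ (i, j) = (\<Sum>e\<in>I. P e i * Q e j) + part S i j"
    using part_split[of S "\<lambda>_. {0..<int N}" i j] S ij by (simp add: Xe R)
qed

text \<open>For \<open>s \<le> 3 * k\<close> the exponent is not positive and the bound of the full
  sum suffices. Otherwise at most 2j + 1 residues are kept, each with three matrices C_l of rank at
  most k.\<close>

theorem singular_value_low_rank:
  fixes k s :: nat
  assumes X: "X \<in> carrier_mat a b"
    and Xe: "\<And>i j. i < a \<Longrightarrow> j < b \<Longrightarrow> X $$ (i, j) = part (\<lambda>_. {0..<int N}) i j"
    and U: "\<And>l u w. l \<in> {-1, 0, 1} \<Longrightarrow> u < a \<Longrightarrow> w < b \<Longrightarrow> C l u w = (\<Sum>\<kappa><k. U l u \<kappa> * V l \<kappa> w)"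
    and k: "k \<ge> 1" and s: "s \<ge> 1"
  shows "\<sigma> s X \<le> 3 * M * x powr ((real s - 3 * real k) / (6 * real k))"
proof (cases "s \<le> 3 * k")
  case True
  have "form_bound a b (part (\<lambda>_. {0..<int N})) (\<Sum>l\<in>{-1, 0, 1 :: int}. L * (\<delta> * \<delta>))"
    using \<delta> by (intro part_form_bound nD_total nE_total) auto
  hence "form_bound a b (part (\<lambda>_. {0..<int N})) (3 * L * \<delta>\<^sup>2)"
    by (rule form_bound_eqI) (simp add: power2_eq_square)
  hence "\<sigma> s X \<le> 3 * L * \<delta>\<^sup>2"
    using s L by (intro singular_value_part[OF X Xe, where I = "{} :: nat set"]) (auto simp: part_def)
  also have "\<dots> \<le> 3 * M"
  proof -
    have "0 \<le> L * \<delta>\<^sup>2" using L by simp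
    with M_ge(2) show ?thesis unfolding mult.assoc by linarith
  qed
  also have "\<dots> = 3 * M * 1" by simp
  also have "\<dots> \<le> 3 * M * x powr ((real s - 3 * real k) / (6 * real k))"
  proof (intro mult_left_mono)
    have "real s \<le> real (3 * k)" using True by (simp only: of_nat_le_iff)
    hence e: "(real s - 3 * real k) / (6 * real k) \<le> 0"
      by (simp add: divide_le_0_iff)
    have "x powr 0 \<le> x powr ((real s - 3 * real k) / (6 * real k))"
      using x e by (intro powr_mono') auto
    thus "1 \<le> x powr ((real s - 3 * real k) / (6 * real k))" using x by simp
  qed (use M_ge in auto)
  finally show ?thesis .
next
  case False
  \<comment> \<open>The largest j with \<open>3 * k * (2 * j + 1) < s\<close>. Maximality gives
    \<open>s \<le> 3 * k + 6 * k * (j + 1)\<close>, that is, the required exponent is at most j +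
    1.\<close>
  define j where "j = (s - 1 - 3 * k) div (6 * k)"
  have j1: "6 * k * j \<le> s - 1 - 3 * k" unfolding j_def by simp
  have j2: "s - 1 - 3 * k < 6 * k * (j + 1)"
    unfolding j_def using k dividend_less_times_div[of "6 * k" "s - 1 - 3 * k"] by (simp add: algebra_simps)
  let ?I = "{-1, 0, 1 :: int} \<times> ({0..<int N} - tail j) \<times> {..<k}"
  have "card ?I = 3 * (card ({0..<int N} - tail j) * k)" by (simp add: card_cartesian_product)
  also have "\<dots> \<le> 3 * ((2 * j + 1) * k)" using card_kept by (intro mult_left_mono mult_right_mono) auto
  also have "\<dots> < s" using j1 False by (simp add: algebra_simps)
  finally have I: "card ?I < s" .
  have "\<sigma> s X \<le> 6 * L * \<delta>\<^sup>2 * x ^ (j + 1)"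
  proof (rule singular_value_part[OF X Xe tail_subset _ I _ tail_form_bound_1])
    fix i i'
    have "part (\<lambda>_. {0..<int N} - tail j) i i' =
      (\<Sum>l\<in>{-1, 0, 1 :: int}. \<Sum>q\<in>{0..<int N} - tail j. \<Sum>\<kappa><k.
        (\<zeta> powi l * (\<Sum>u<a. RD (- l - q) i u * U l u \<kappa>)) * (\<Sum>w<b. V l \<kappa> w * RE q w i'))"
      unfolding part_def by (intro sum.cong refl summand_low_rank U)
    also have "\<dots> = (\<Sum>(l, q, \<kappa>)\<in>?I.
        (\<zeta> powi l * (\<Sum>u<a. RD (- l - q) i u * U l u \<kappa>)) * (\<Sum>w<b. V l \<kappa> w * RE q w i'))"
      by (simp only: sum.cartesian_product)
    finally show "part (\<lambda>_. {0..<int N} - tail j) i i' =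
       (\<Sum>e\<in>?I. (case e of (l, q, \<kappa>) \<Rightarrow> \<lambda>i. \<zeta> powi l * (\<Sum>u<a. RD (- l - q) i u * U l u \<kappa>)) i *
          (case e of (l, q, \<kappa>) \<Rightarrow> \<lambda>i'. \<Sum>w<b. V l \<kappa> w * RE q w i') i')"
      by (simp only: case_prod_unfold)
  qed (use L x in auto)
  also have "\<dots> \<le> 3 * M * x ^ (j + 1)"
  proof (intro mult_right_mono)
    have "0 \<le> L * \<delta>\<^sup>2" using L by simp
    with M_ge(2) show "6 * L * \<delta>\<^sup>2 \<le> 3 * M" unfolding mult.assoc by linarith
  qed (use x in auto)
  also have "\<dots> \<le> 3 * M * x powr ((real s - 3 * real k) / (6 * real k))"
  proof (intro mult_left_mono)
    have "s \<le> 3 * k + 6 * k * (j + 1)" using j2 False by linarith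
    hence "real s \<le> real (3 * k + 6 * k * (j + 1))" by (simp only: of_nat_le_iff)
    hence "real s \<le> 3 * real k + 6 * real k * (real j + 1)" by (simp add: algebra_simps)
    hence "(real s - 3 * real k) / (6 * real k) \<le> real (j + 1)"
      using k by (simp add: pos_divide_le_eq algebra_simps)
    hence "x powr real (j + 1) \<le> x powr ((real s - 3 * real k) / (6 * real k))"
      using x by (intro powr_mono') auto
    thus "x ^ (j + 1) \<le> x powr ((real s - 3 * real k) / (6 * real k))"
      using x by (simp only: powr_realpow)
  qed (use M_ge in auto)
  finally show ?thesis .
qed

text \<open>All l share the right vector \<open>RE q w\<close>, so the sum over l moves into the
  left vector and a kept residue costs rank one instead of three.\<close>

lemma singular_value_corner_tail:
  assumes X: "X \<in> carrier_mat a b"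
    and Xe: "\<And>i j. i < a \<Longrightarrow> j < b \<Longrightarrow> X $$ (i, j) = part (\<lambda>_. {0..<int N}) i j"
    and c: "\<And>l q i j. l \<in> {-1, 0, 1} \<Longrightarrow> summand l q i j = f l q i * RE q w j"
    and s: "card ({0..<int N} - tail j) < s" and Y: "form_bound a b (part (\<lambda>_. tail j)) \<epsilon>" and \<epsilon>: "\<epsilon> \<ge> 0"
  shows "\<sigma> s X \<le> \<epsilon>"
proof (rule singular_value_part[OF X Xe tail_subset _ s _ Y \<epsilon>])
  fix i i'
  have "part (\<lambda>_. {0..<int N} - tail j) i i' =
      (\<Sum>l\<in>{-1, 0, 1}. \<Sum>q\<in>{0..<int N} - tail j. f l q i * RE q w i')"
    unfolding part_def by (intro sum.cong refl c)
  thus "part (\<lambda>_. {0..<int N} - tail j) i i' =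
      (\<Sum>q\<in>{0..<int N} - tail j. (\<Sum>l\<in>{-1, 0, 1}. f l q i) * RE q w i')"
    by (subst (asm) sum.swap) (simp only: sum_distrib_right)
qed auto

text \<open>In terms of y = sqrt x the target is y^s. Keeping at most 2j + 1 residues serves s = 2j
  + 2 directly; for s = 2j + 3 the same residues are kept, and the missing factor y comes from the
  decay of the left factor. No tail contains the residue 0, which costs rank one, so the method
  starts at s = 2.\<close>

theorem singular_value_corner:
  fixes s :: nat and c :: "int \<Rightarrow> complex"
  assumes X: "X \<in> carrier_mat a b"
    and Xe: "\<And>i j. i < a \<Longrightarrow> j < b \<Longrightarrow> X $$ (i, j) = part (\<lambda>_. {0..<int N}) i j"
    and c: "\<And>l u w. l \<in> {-1, 0, 1} \<Longrightarrow> u < a \<Longrightarrow> w < b \<Longrightarrow>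
      C l u w = (if u = 0 \<and> w = b - 1 then c l else 0)"
    and a: "a > 0" and b: "b > 0" and s: "s \<ge> 2"
  shows "\<sigma> s X \<le> M * x powr (real s / 2)"
proof -
  define K where "K = 4 * L * \<delta>\<^sup>2"
  have K: "K \<ge> 0" using L by (simp add: K_def)
  have KM: "K / (1 - x) \<le> M" using M_ge by (simp add: K_def)
  define y where "y = sqrt x"
  have y: "0 < y" "y < 1" and y2: "y\<^sup>2 = x" using x by (auto simp: y_def)
  have ypow: "x powr (real s / 2) = y ^ s"
  proof -
    have "x powr (real s / 2) = (x powr (1 / 2)) powr real s" by (simp add: powr_powr)
    also have "\<dots> = y ^ s" using y x by (simp add: powr_half_sqrt y_def powr_realpow)
    finally show ?thesis .
  qed
  have suff: "e \<le> M * x powr (real s / 2)" if "e \<le> K / (1 - x) * y ^ s" for e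
    unfolding ypow using that mult_right_mono[OF KM, of "y ^ s"] y by simp
  define f where "f l q i = \<zeta> powi l * RD (- l - q) i 0 * c l" for l q i
  have summand: "summand l q i j = f l q i * RE q (b - 1) j" if l: "l \<in> {-1, 0, 1}" for l q i j
  proof -
    have "(\<Sum>w<b. RD (- l - q) i u * C l u w * RE q w j) =
        (if u = 0 then RD (- l - q) i 0 * c l * RE q (b - 1) j else 0)" if u: "u < a" for u
    proof -
      have "(\<Sum>w<b. RD (- l - q) i u * C l u w * RE q w j) =
          (\<Sum>w<b. if w = b - 1 then if u = 0 then RD (- l - q) i 0 * c l * RE q (b - 1) j else 0 else 0)"
        by (intro sum.cong refl) (simp add: c[OF l u])
      thus ?thesis using b by simp
    qed
    hence "(\<Sum>u<a. \<Sum>w<b. RD (- l - q) i u * C l u w * RE q w j) =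
        (\<Sum>u<a. if u = 0 then RD (- l - q) i 0 * c l * RE q (b - 1) j else 0)"
      by (intro sum.cong refl) simp
    also have "\<dots> = RD (- l - q) i 0 * c l * RE q (b - 1) j" using a by simp
    finally show ?thesis by (simp only: summand_def f_def mult.assoc)
  qed
  note corner = singular_value_corner_tail[OF X Xe summand]
  have even_bound: "\<sigma> s X \<le> K * x ^ (j + 1) * (1 + x ^ (j + 1))"
    if "card ({0..<int N} - tail j) < s" for j
    unfolding K_def by (rule corner[OF _ _ _ that tail_form_bound_2]) (use L x in auto)
  have odd_bound: "\<sigma> s X \<le> K * x ^ (j + 1) * (2 * x ^ j + x ^ (j + 1))"
    if "card ({0..<int N} - tail j) < s" "j \<ge> 1" for j
    unfolding K_def by (rule corner[OF _ _ _ that(1) tail_form_bound_3[OF that(2)]]) (use L x in auto)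
  have odd_arith: "K * x ^ (j + 1) * (2 * x ^ j + x ^ (j + 1)) \<le> K / (1 - x) * y ^ (2 * j + 3)" if j: "j \<ge> 1" for j
  proof -
    \<comment> \<open>The worst case is \<open>j = 1\<close>, which \<open>sqrt_bound_1\<close>
      settles.\<close>
    have "x ^ j * (2 + x) * (1 - x) \<le> x ^ 1 * (2 + x) * (1 - x)"
      using x j by (intro mult_right_mono power_decreasing) auto
    also have "\<dots> = y * (y * (2 + y\<^sup>2) * (1 - y\<^sup>2))" by (simp add: y2[symmetric] power2_eq_square)
    also have "\<dots> \<le> y * 1" using y by (intro mult_left_mono sqrt_bound_1) auto
    finally have "x ^ j * (2 + x) \<le> y / (1 - x)" using x by (simp add: pos_le_divide_eq)
    from mult_left_mono[OF this, of "K * x ^ (j + 1)"]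
    have "K * x ^ (j + 1) * (2 * x ^ j + x ^ (j + 1)) \<le> K * x ^ (j + 1) * (y / (1 - x))"
      using K x by (simp add: algebra_simps)
    also have "\<dots> = K / (1 - x) * (x ^ (j + 1) * y)" by simp
    also have "x ^ (j + 1) * y = y ^ (2 * j + 3)"
    proof -
      have "2 * j + 3 = Suc (2 * (j + 1))" by simp
      thus ?thesis by (simp only: y2[symmetric] power_mult power_Suc2)
    qed
    finally show ?thesis .
  qed
  \<comment> \<open>For \<open>s = 3\<close> at most two residues may be kept. Unless
    \<open>N \<le> 2\<close> this means j = 0, where the tails yield no decay of the left factor for
    \<open>l \<noteq> 0\<close>, and another splitting is used.\<close>
  have "even s \<or> (odd s \<and> s \<ge> 5) \<or> (s = 3 \<and> N \<ge> 3) \<or> (s = 3 \<and> N \<le> 2)"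
    using s by presburger
  then consider "even s" | "odd s" "s \<ge> 5" | "s = 3" "N \<ge> 3" | "s = 3" "N \<le> 2" by blast
  thus ?thesis
  proof cases
    case 1
    define j where "j = s div 2 - 1"
    have sj: "s = 2 * j + 2" using 1 s by (auto simp: j_def elim!: evenE)
    have "card ({0..<int N} - tail j) < s" using card_kept[of j] sj by simp
    note even_bound[OF this]
    also have "K * x ^ (j + 1) * (1 + x ^ (j + 1)) \<le> K * x ^ (j + 1) * (1 / (1 - x))"
    proof (intro mult_left_mono)
      have "x ^ (j + 1) \<le> x" using x power_decreasing[of 1 "j + 1" x] by simp
      hence "(1 + x ^ (j + 1)) * (1 - x) \<le> (1 + x) * (1 - x)" using x by (intro mult_right_mono) auto
      also have "\<dots> \<le> 1" by (simp add: algebra_simps)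
      finally show "1 + x ^ (j + 1) \<le> 1 / (1 - x)" using x by (simp add: pos_le_divide_eq)
    qed (use K x in auto)
    also have "x ^ (j + 1) = y ^ s"
      unfolding y2[symmetric] power_mult[symmetric] sj by (simp add: mult.commute)
    finally show ?thesis by (intro suff) simp
  next
    case 2
    define j where "j = (s - 3) div 2"
    have sj: "s = 2 * j + 3" "j \<ge> 1" using 2 by (auto simp: j_def elim!: oddE)
    have "card ({0..<int N} - tail j) < s" using card_kept[of j] sj by simp
    from order_trans[OF odd_bound[OF this sj(2)] odd_arith[OF sj(2)]]
    show ?thesis by (intro suff) (simp only: sj(1))
  next
    case 3
    \<comment> \<open>Term 0 collects \<open>q = 0\<close>, where all l share the right factor; term
      1 collects \<open>q = (- l) mod int N\<close>, where all l share the left factor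
      \<open>RD 0\<close>. The case distinction in Q avoids counting q = 0 twice.\<close>
    define P where "P e i = (if e = (0 :: nat) then \<Sum>l\<in>{-1, 0, 1}. f l 0 i else RD 0 i 0)" for e i
    define Q where "Q e j = (if e = (0 :: nat) then RE 0 (b - 1) j else
      \<Sum>l\<in>{-1, 0, 1}. if (- l) mod int N = 0 then 0 else \<zeta> powi l * c l * RE ((- l) mod int N) (b - 1) j)" for e j
    have kept: "{0..<int N} - both_tails l = insert 0 {(- l) mod int N}" for l
    proof -
      have t0: "p \<in> tail 0 \<longleftrightarrow> p \<noteq> 0" if "p \<in> {0..<int N}" for p
        using that by (auto simp: tail_def)
      have "int N dvd - l - q \<longleftrightarrow> q = (- l) mod int N" if "q \<in> {0..<int N}" for q
      proof -
        have "int N dvd - l - q \<longleftrightarrow> (- l) mod int N = q mod int N"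
          by (simp only: mod_eq_dvd_iff)
        thus ?thesis using that by auto
      qed
      thus ?thesis using N t0 by (auto simp: both_tails_def)
    qed
    have RD0: "RD (- l - (- l) mod int N) = RD 0" for l
      by (metis RD_mod minus_mod_eq_mult_div mod_mult_self1_is_0 mod_0)
    have "\<sigma> s X \<le> 6 * L * \<delta>\<^sup>2 * (x\<^sup>2 + x ^ N)"
    proof (rule singular_value_part[OF X Xe _ _ _ _ both_tails_form_bound])
      show "both_tails l \<subseteq> {0..<int N}" for l using tail_subset[of 0] by (auto simp: both_tails_def)
      show "finite {0, 1 :: nat}" "card {0, 1 :: nat} < s" using 3 by auto
      fix i j
      have "(\<Sum>q\<in>{0..<int N} - both_tails l. summand l q i j) =
          f l 0 i * RE 0 (b - 1) j + RD 0 i 0 *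
            (if (- l) mod int N = 0 then 0 else \<zeta> powi l * c l * RE ((- l) mod int N) (b - 1) j)"
        if "l \<in> {-1, 0, 1}" for l
      proof (cases "(- l) mod int N = 0")
        case True
        thus ?thesis unfolding kept by (simp add: summand[OF that])
      next
        case False
        hence "(\<Sum>q\<in>{0..<int N} - both_tails l. summand l q i j) = summand l 0 i j + summand l ((- l) mod int N) i j"
          unfolding kept by (subst sum.insert) auto
        also have "\<dots> = f l 0 i * RE 0 (b - 1) j + \<zeta> powi l * RD 0 i 0 * c l * RE ((- l) mod int N) (b - 1) j"
          by (simp only: summand[OF that] f_def RD0)
        finally show ?thesis using False by (simp add: mult_ac)
      qed
      thus "part (\<lambda>l. {0..<int N} - both_tails l) i j = (\<Sum>e\<in>{0, 1}. P e i * Q e j)"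
        unfolding part_def P_def Q_def by (simp add: algebra_simps)
    qed (use L x in auto)
    also have "\<dots> \<le> 6 * L * \<delta>\<^sup>2 * (x\<^sup>2 + x ^ 3)"
      using 3 x L by (intro mult_left_mono add_left_mono power_decreasing) auto
    also have "\<dots> \<le> K / (1 - x) * y ^ 3"
    proof -
      \<comment> \<open>Multiplied by 2 y^3 this reads 6 (x^2 + x^3) (1 - x) \<le> 4 y^3, since x =
        y^2.\<close>
      have "3 * y * (1 - y ^ 4) \<le> 2" using y by (intro sqrt_bound_2) auto
      hence "y ^ 3 * (3 * y * (1 - y ^ 4)) \<le> y ^ 3 * 2" using y by (intro mult_left_mono) auto
      moreover have "y ^ 3 * (3 * y * (1 - y ^ 4)) = 3 * (x\<^sup>2 + x ^ 3) * (1 - x)"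
        by (simp add: y2[symmetric] power2_eq_square power3_eq_cube power4_eq_xxxx algebra_simps)
      ultimately have "3 * (x\<^sup>2 + x ^ 3) * (1 - x) \<le> 2 * y ^ 3" by simp
      hence "3 * (x\<^sup>2 + x ^ 3) \<le> 2 * y ^ 3 / (1 - x)" using x by (simp add: pos_le_divide_eq)
      from mult_left_mono[OF this, of "2 * L * \<delta>\<^sup>2"] show ?thesis
        using L by (simp add: K_def algebra_simps)
    qed
    finally show ?thesis using 3 by (intro suff) simp
  next
    case 4
    \<comment> \<open>With at most two residues in all, even \<open>j = 1\<close> keeps fewer than
      three, and y^5 is more than enough.\<close>
    have "card ({0..<int N} - tail 1) \<le> card {0..<int N}" by (intro card_mono) auto
    hence "card ({0..<int N} - tail 1) < s" using 4 by simp
    from order_trans[OF odd_bound[OF this] odd_arith[of 1]]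
    have "\<sigma> s X \<le> K / (1 - x) * y ^ 5" by simp
    also have "\<dots> \<le> K / (1 - x) * y ^ 3"
      using K x y by (intro mult_left_mono power_decreasing) auto
    finally show ?thesis using 4 by (intro suff) simp
  qed
qed

end

subsection \<open>Nonnegative matrices\<close>

text \<open>The Collatz-Wielandt argument: for an eigenvector u take the row that maximizes |u_i| /
  v_i and compare both sides of the eigenvalue equation there.\<close>

lemma spectral_radius_less_one:
  fixes B :: "complex mat" and P :: "nat \<Rightarrow> nat \<Rightarrow> real" and v :: "nat \<Rightarrow> real"
  assumes B: "B \<in> carrier_mat n n" and n: "n > 0"
    and P: "\<And>i j. i < n \<Longrightarrow> j < n \<Longrightarrow> cmod (B $$ (i, j)) \<le> P i j"
    and v: "\<And>i. i < n \<Longrightarrow> v i > 0" and Pv: "\<And>i. i < n \<Longrightarrow> (\<Sum>j<n. P i j * v j) < v i"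
  shows "spectral_radius B < 1"
proof -
  have "cmod e < 1" if e: "eigenvalue B e" for e
  proof -
    obtain u where u: "u \<in> carrier_vec n" "u \<noteq> 0\<^sub>v n" "B *\<^sub>v u = e \<cdot>\<^sub>v u"
      using e B unfolding eigenvalue_def eigenvector_def by auto
    define c where "c = Max ((\<lambda>i. cmod (u $ i) / v i) ` {..<n})"
    have "c \<in> (\<lambda>i. cmod (u $ i) / v i) ` {..<n}"
      unfolding c_def using n by (intro Max_in) auto
    then obtain i where i: "i < n" "c = cmod (u $ i) / v i" by auto
    have cmax: "cmod (u $ j) \<le> c * v j" if "j < n" for j
    proof -
      have "cmod (u $ j) / v j \<le> c" unfolding c_def using that by (intro Max_ge) auto
      thus ?thesis using v[OF that] by (simp add: pos_divide_le_eq)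
    qed
    obtain j where j: "j < n" "u $ j \<noteq> 0" using u by (auto simp: vec_eq_iff)
    hence "0 < c * v j" using cmax[OF j(1)] zero_less_norm_iff[of "u $ j"] by linarith
    hence c0: "c > 0" using v[OF j(1)] by (simp add: zero_less_mult_iff)
    have ui: "cmod (u $ i) = c * v i" using i v[OF i(1)] by simp
    have "e * u $ i = (B *\<^sub>v u) $ i" using u i by simp
    also have "\<dots> = (\<Sum>j<n. B $$ (i, j) * u $ j)"
      using B u(1) i by (simp add: scalar_prod_def lessThan_atLeast0)
    finally have "cmod e * (c * v i) = cmod (\<Sum>j<n. B $$ (i, j) * u $ j)"
      by (metis norm_mult ui)
    also have "\<dots> \<le> (\<Sum>j<n. P i j * (c * v j))"
      unfolding norm_mult[symmetric]
      by (intro order_trans[OF norm_sum] sum_mono)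
        (auto simp: norm_mult intro!: mult_mono P cmax i(1) order_trans[OF norm_ge_zero P[OF i(1)]])
    also have "\<dots> = c * (\<Sum>j<n. P i j * v j)" by (simp add: sum_distrib_left mult_ac)
    also have "\<dots> < c * v i" using c0 Pv[OF i(1)] by simp
    finally show "cmod e < 1" using c0 v[OF i(1)] by simp
  qed
  moreover have "spectral_radius B \<in> norm ` spectrum B" by (rule spectral_radius_mem_max(1)[OF B n])
  ultimately show ?thesis by (auto simp: spectrum_def)
qed

lemma spectral_radius_smult_le:
  fixes A :: "complex mat"
  assumes A: "A \<in> carrier_mat n n" and n: "n > 0" and c: "c > 0"
  shows "spectral_radius (complex_of_real c \<cdot>\<^sub>m A) \<le> c * spectral_radius A"
proof -
  let ?B = "complex_of_real c \<cdot>\<^sub>m A"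
  have B: "?B \<in> carrier_mat n n" using A by simp
  obtain e where e: "eigenvalue ?B e" "spectral_radius ?B = cmod e"
    using spectral_radius_mem_max(1)[OF B n] by (auto simp: spectrum_def)
  obtain u where u: "u \<in> carrier_vec n" "u \<noteq> 0\<^sub>v n" "?B *\<^sub>v u = e \<cdot>\<^sub>v u"
    using e(1) B unfolding eigenvalue_def eigenvector_def by auto
  have "complex_of_real c \<cdot>\<^sub>v (A *\<^sub>v u) = e \<cdot>\<^sub>v u"
  proof -
    have "?B *\<^sub>v u = complex_of_real c \<cdot>\<^sub>v (A *\<^sub>v u)"
      using u(1) A by (intro eq_vecI) (auto simp: scalar_prod_def sum_distrib_left mult.assoc)
    thus ?thesis using u(3) by simp
  qed
  hence "complex_of_real (1 / c) \<cdot>\<^sub>v (complex_of_real c \<cdot>\<^sub>v (A *\<^sub>v u)) = complex_of_real (1 / c) \<cdot>\<^sub>v (e \<cdot>\<^sub>v u)"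
    by simp
  hence "A *\<^sub>v u = (e / complex_of_real c) \<cdot>\<^sub>v u"
    using c by (simp add: smult_smult_assoc)
  hence "eigenvalue A (e / complex_of_real c)"
    using u A unfolding eigenvalue_def eigenvector_def by auto
  hence "cmod (e / complex_of_real c) \<le> spectral_radius A"
    by (intro spectral_radius_mem_max(2)[OF A n]) (auto simp: spectrum_def)
  thus ?thesis using c e(2) by (simp add: norm_divide pos_divide_le_eq mult.commute)
qed

text \<open>The solution is the sum over k of P^k applied to the all-ones vector. A spectral radius
  below 1 gives bounded powers; applied to c P with c > 1 it gives the geometric decay that the sum
  requires.\<close>

lemma nonneg_resolvent_of_one:
  fixes P :: "complex mat" and p :: "nat \<Rightarrow> nat \<Rightarrow> real"
  assumes P: "P \<in> carrier_mat n n" and n: "n > 0" and sr: "spectral_radius P < 1"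
    and p: "\<And>i j. i < n \<Longrightarrow> j < n \<Longrightarrow> P $$ (i, j) = complex_of_real (p i j)"
      "\<And>i j. i < n \<Longrightarrow> j < n \<Longrightarrow> p i j \<ge> 0"
  obtains w where "\<And>i. i < n \<Longrightarrow> w i \<ge> (0 :: real)" "\<And>i. i < n \<Longrightarrow> w i = 1 + (\<Sum>j<n. p i j * w j)"
proof -
  have sr0: "spectral_radius P \<ge> 0" using spectral_radius_mem_max(1)[OF P n] by auto
  define c where "c = 2 / (1 + spectral_radius P)"
  have c: "c > 1" "c * spectral_radius P < 1" using sr sr0 by (auto simp: c_def field_simps)
  define Q where "Q = complex_of_real c \<cdot>\<^sub>m P"
  have Q: "Q \<in> carrier_mat n n" using P by (simp add: Q_def)
  have "spectral_radius Q < 1"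
    using spectral_radius_smult_le[OF P n, of c] c by (simp add: Q_def)
  then obtain B where B: "\<And>k. norm_bound (Q ^\<^sub>m k) B"
    using spectral_radius_jnf_norm_bound_less_1_upper_triangular[OF Q] by blast
  have Qk: "Q ^\<^sub>m k \<in> carrier_mat n n" for k using Q by simp
  define q where "q k i = (\<Sum>j<n. (Q ^\<^sub>m k) $$ (i, j))" for k i
  have q_Suc: "q (Suc k) i = (\<Sum>j<n. complex_of_real (c * p i j) * q k j)" if "i < n" for k i
  proof -
    have "Q ^\<^sub>m Suc k = Q * Q ^\<^sub>m k"
    proof (induction k)
      case (Suc k)
      have "Q ^\<^sub>m Suc (Suc k) = Q * Q ^\<^sub>m k * Q" using Suc by simp
      thus ?case using Q Qk by (simp add: assoc_mult_mat[of _ n n _ n _ n])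
    qed (use Q in auto)
    hence "q (Suc k) i = (\<Sum>j<n. \<Sum>l<n. Q $$ (i, l) * (Q ^\<^sub>m k) $$ (l, j))"
      unfolding q_def using Q Qk[of k] that by (intro sum.cong refl) (simp add: scalar_prod_def lessThan_atLeast0)
    also have "\<dots> = (\<Sum>l<n. Q $$ (i, l) * q k l)"
      unfolding q_def sum_distrib_left by (rule sum.swap)
    finally show ?thesis using that P by (simp add: Q_def p)
  qed
  have q_real: "i < n \<Longrightarrow> q k i = complex_of_real (Re (q k i)) \<and> Re (q k i) \<ge> 0" for k i
  proof (induction k arbitrary: i)
    case 0
    thus ?case using Q by (simp add: q_def one_mat_def)
  next
    case (Suc k)
    have "q (Suc k) i = complex_of_real (\<Sum>j<n. c * p i j * Re (q k j))"
      unfolding q_Suc[OF Suc.prems] of_real_sum of_real_mult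
      using Suc.IH by (intro sum.cong refl) (metis lessThan_iff)
    moreover have "(\<Sum>j<n. c * p i j * Re (q k j)) \<ge> 0"
      using c p Suc by (intro sum_nonneg mult_nonneg_nonneg) auto
    ultimately show ?case by simp
  qed
  define a where "a i k = (1 / c) ^ k * Re (q k i)" for i k
  have a_le: "\<bar>a i k\<bar> \<le> real n * B * (1 / c) ^ k" if "i < n" for i k
  proof -
    have "cmod (q k i) \<le> (\<Sum>j<n. B)"
      unfolding q_def using B[of k] Qk[of k] Q that
      by (intro order_trans[OF norm_sum] sum_mono) (auto simp: norm_bound_def split: if_splits)
    hence "\<bar>Re (q k i)\<bar> \<le> real n * B" using abs_Re_le_cmod[of "q k i"] by simp
    from mult_left_mono[OF this, of "(1 / c) ^ k"] show ?thesis
      using c by (simp add: a_def abs_mult mult_ac)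
  qed
  have smb: "summable (\<lambda>k. a i k)" if "i < n" for i
    by (rule summable_comparison_test[where g = "\<lambda>k. real n * B * (1 / c) ^ k"])
      (use a_le[OF that] c in \<open>auto intro!: summable_mult summable_geometric\<close>)
  define w where "w i = (\<Sum>k. a i k)" for i
  show ?thesis
  proof (rule that[of w])
    fix i assume i: "i < n"
    show "w i \<ge> 0" unfolding w_def
      by (intro suminf_nonneg smb i) (use q_real[OF i] c in \<open>auto simp: a_def\<close>)
    have "a i (Suc k) = (\<Sum>j<n. p i j * a j k)" for k
    proof -
      have "q (Suc k) i = complex_of_real (\<Sum>j<n. c * p i j * Re (q k j))"
        unfolding q_Suc[OF i] of_real_sum of_real_mult
        using q_real by (intro sum.cong refl) (metis lessThan_iff)
      hence "Re (q (Suc k) i) = (\<Sum>j<n. c * p i j * Re (q k j))" by simp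
      thus ?thesis using c by (simp add: a_def sum_distrib_left mult_ac)
    qed
    hence "(\<Sum>k. a i (Suc k)) = (\<Sum>k. \<Sum>j<n. p i j * a j k)" by simp
    also have "\<dots> = (\<Sum>j<n. \<Sum>k. p i j * a j k)"
      by (intro suminf_sum summable_mult smb) auto
    also have "\<dots> = (\<Sum>j<n. p i j * w j)"
      unfolding w_def by (intro sum.cong refl suminf_mult smb) auto
    finally have "(\<Sum>j<n. p i j * w j) = w i - a i 0"
      using suminf_split_head[OF smb[OF i]] by (simp add: w_def)
    moreover have "a i 0 = 1" using i Q by (simp add: a_def q_def one_mat_def)
    ultimately show "w i = 1 + (\<Sum>j<n. p i j * w j)" by simp
  qed
qed

text \<open>The equation leaves a gap: a nonnegative solution is at least 1. So the interval is
  covered by two disjoint open sets, where all entries are positive or some entry is negative, and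
  r0 lies in the first.\<close>

lemma nonneg_solution_propagates:
  fixes w :: "real \<Rightarrow> nat \<Rightarrow> real" and p :: "real \<Rightarrow> nat \<Rightarrow> nat \<Rightarrow> real"
  assumes I: "connected I" "open I" and r0: "r0 \<in> I" "\<And>i. i < n \<Longrightarrow> w r0 i \<ge> 0"
    and p: "\<And>r i j. r \<in> I \<Longrightarrow> i < n \<Longrightarrow> j < n \<Longrightarrow> p r i j \<ge> 0"
    and w: "\<And>r i. r \<in> I \<Longrightarrow> i < n \<Longrightarrow> w r i = 1 + (\<Sum>j<n. p r i j * w r j)"
    and cont: "\<And>i. i < n \<Longrightarrow> continuous_on I (\<lambda>r. w r i)"
    and r: "r \<in> I" and i: "i < n"
  shows "w r i \<ge> 1"
proof -
  have ge1: "w r i \<ge> 1" if "r \<in> I" "\<And>i. i < n \<Longrightarrow> w r i \<ge> 0" "i < n" for r i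
    using w[OF that(1,3)] sum_nonneg[of "{..<n}" "\<lambda>j. p r i j * w r j"] p[OF that(1,3)] that(2) by simp
  define U where "U = (\<Inter>i\<in>{..<n}. {r \<in> I. w r i > 0})"
  define V where "V = (\<Union>i\<in>{..<n}. {r \<in> I. w r i < 0})"
  have op: "open {r \<in> I. w r i > 0}" "open {r \<in> I. w r i < 0}" if "i < n" for i
    using continuous_on_open_vimage[OF I(2), THEN iffD1, OF cont[OF that], rule_format, of "{0<..}"]
      continuous_on_open_vimage[OF I(2), THEN iffD1, OF cont[OF that], rule_format, of "{..<0}"]
    by (auto simp: vimage_def Int_def conj_commute)
  have "open (U \<inter> I)" unfolding U_def using op i by (intro open_Int open_INT I) auto
  moreover have "open V" unfolding V_def using op by auto
  moreover have "(U \<inter> I) \<inter> V \<inter> I = {}" by (auto simp: U_def V_def) (metis less_asym lessThan_iff)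
  moreover have "I \<subseteq> (U \<inter> I) \<union> V"
  proof
    fix r assume r: "r \<in> I"
    show "r \<in> (U \<inter> I) \<union> V"
    proof (cases "\<exists>i<n. w r i < 0")
      case True thus ?thesis using r by (auto simp: V_def)
    next
      case False
      hence "w r i \<ge> 1" if "i < n" for i using ge1[OF r _ that] by force
      hence "r \<in> U" using r by (force simp: U_def)
      thus ?thesis using r by auto
    qed
  qed
  moreover have "r0 \<in> (U \<inter> I) \<inter> I"
    using ge1[OF r0] r0 by (force simp: U_def)
  ultimately have "V \<inter> I = {}" using I(1) unfolding connected_def by (metis empty_iff)
  hence "w r i \<ge> 0" if "i < n" for i using r that by (force simp: V_def)
  from ge1[OF r this i] show ?thesis .
qed

section \<open>Neumann series of a dominated matrix\<close>

primrec neumann_term :: "nat \<Rightarrow> (nat \<Rightarrow> nat \<Rightarrow> complex) \<Rightarrow> nat \<Rightarrow> nat \<Rightarrow> nat \<Rightarrow> complex" where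
  "neumann_term n A 0 i j = (if i = j then 1 else 0)"
| "neumann_term n A (Suc k) i j = (\<Sum>l<n. A i l * neumann_term n A k l j)"

definition neumann :: "nat \<Rightarrow> (nat \<Rightarrow> nat \<Rightarrow> complex) \<Rightarrow> nat \<Rightarrow> nat \<Rightarrow> complex" where
  "neumann n A i j = (\<Sum>k. neumann_term n A k i j)"

text \<open>Entries are measured against the weights v, for which the dominating matrix contracts by
  \<theta>; \<open>v \<ge> 1\<close> starts the induction.\<close>

lemma neumann_term_bound:
  fixes v :: "nat \<Rightarrow> real"
  assumes P: "\<And>i j. i < n \<Longrightarrow> j < n \<Longrightarrow> cmod (A i j) \<le> p i j"
    and v: "\<And>i. i < n \<Longrightarrow> v i \<ge> 1" and pv: "\<And>i. i < n \<Longrightarrow> (\<Sum>j<n. p i j * v j) \<le> \<theta> * v i"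
    and \<theta>: "\<theta> \<ge> 0" and j: "j < n"
  shows "i < n \<Longrightarrow> cmod (neumann_term n A k i j) \<le> \<theta> ^ k * v i"
proof (induction k arbitrary: i)
  case 0
  thus ?case using v[of i] by auto
next
  case (Suc k)
  have "cmod (neumann_term n A (Suc k) i j) \<le> (\<Sum>l<n. p i l * (\<theta> ^ k * v l))"
    unfolding neumann_term.simps
    by (intro order_trans[OF norm_sum] sum_mono)
      (auto simp: norm_mult intro!: mult_mono P Suc order_trans[OF norm_ge_zero P[OF Suc.prems]])
  also have "\<dots> = \<theta> ^ k * (\<Sum>l<n. p i l * v l)" by (simp add: sum_distrib_left mult_ac)
  also have "\<dots> \<le> \<theta> ^ k * (\<theta> * v i)" using \<theta> by (intro mult_left_mono pv Suc) auto
  finally show ?case by (simp add: mult_ac)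
qed

lemma neumann_has_sum:
  fixes v :: "nat \<Rightarrow> real"
  assumes P: "\<And>i j. i < n \<Longrightarrow> j < n \<Longrightarrow> cmod (A i j) \<le> p i j"
    and v: "\<And>i. i < n \<Longrightarrow> v i \<ge> 1" and pv: "\<And>i. i < n \<Longrightarrow> (\<Sum>j<n. p i j * v j) \<le> v i - 1"
    and i: "i < n" and j: "j < n"
  shows "((\<lambda>k. neumann_term n A k i j) has_sum neumann n A i j) UNIV"
    and "summable (\<lambda>k. neumann_term n A k i j)"
proof -
  \<comment> \<open>B is a common upper bound of the weights; it converts the additive slack 1 into
    the contraction factor 1 - 1 / B.\<close>
  define B where "B = (\<Sum>i<n. v i)"
  have vB: "v i \<le> B" if "i < n" for i
    unfolding B_def using that v by (intro member_le_sum) (auto intro: order_trans[of 0 1])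
  have B: "B \<ge> 1" using vB[OF i] v[OF i] by simp
  define \<theta> where "\<theta> = 1 - 1 / B"
  have \<theta>: "0 \<le> \<theta>" "\<theta> < 1" using B by (auto simp: \<theta>_def)
  have "(\<Sum>j<n. p i j * v j) \<le> \<theta> * v i" if "i < n" for i
  proof -
    have "v i / B \<le> 1" using vB[OF that] B by simp
    thus ?thesis using pv[OF that] by (simp add: \<theta>_def algebra_simps)
  qed
  from neumann_term_bound[OF P v this \<theta>(1) j i]
  have b: "cmod (neumann_term n A k i j) \<le> \<theta> ^ k * v i" for k .
  have sn: "summable (\<lambda>k. cmod (neumann_term n A k i j))"
    by (rule summable_comparison_test[where g = "\<lambda>k. \<theta> ^ k * v i"])
      (use b \<theta> in \<open>auto intro!: summable_mult2 summable_geometric\<close>)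
  thus 1: "summable (\<lambda>k. neumann_term n A k i j)" by (rule summable_norm_cancel)
  show "((\<lambda>k. neumann_term n A k i j) has_sum neumann n A i j) UNIV"
    unfolding neumann_def by (rule norm_summable_imp_has_sum[OF sn summable_sums[OF 1]])
qed

text \<open>Splitting off the first term of the series gives Y = I + A Y; for square matrices a
  right inverse is also a left inverse.\<close>

lemma neumann_inverse:
  fixes v :: "nat \<Rightarrow> real"
  assumes P: "\<And>i j. i < n \<Longrightarrow> j < n \<Longrightarrow> cmod (A i j) \<le> p i j"
    and v: "\<And>i. i < n \<Longrightarrow> v i \<ge> 1" and pv: "\<And>i. i < n \<Longrightarrow> (\<Sum>j<n. p i j * v j) \<le> v i - 1"
  defines "X \<equiv> mat n n (\<lambda>(i, j). (if i = j then 1 else 0) - A i j)"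
    and "Y \<equiv> mat n n (\<lambda>(i, j). neumann n A i j)"
  shows "X * Y = 1\<^sub>m n" "Y * X = 1\<^sub>m n"
proof -
  have sm: "summable (\<lambda>k. neumann_term n A k i j)" if "i < n" "j < n" for i j
    by (rule neumann_has_sum(2)[OF P v pv that])
  have rec: "neumann n A i j = (if i = j then 1 else 0) + (\<Sum>l<n. A i l * neumann n A l j)"
    if "i < n" "j < n" for i j
  proof -
    have "neumann n A i j = neumann_term n A 0 i j + (\<Sum>k. neumann_term n A (Suc k) i j)"
      using suminf_split_head[OF sm[OF that]] by (simp add: neumann_def)
    also have "(\<Sum>k. neumann_term n A (Suc k) i j) = (\<Sum>l<n. \<Sum>k. A i l * neumann_term n A k l j)"
      unfolding neumann_term.simps by (intro suminf_sum summable_mult sm) (use that in auto)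
    also have "\<dots> = (\<Sum>l<n. A i l * neumann n A l j)"
      unfolding neumann_def by (intro sum.cong refl suminf_mult sm) (use that in auto)
    finally show ?thesis by simp
  qed
  show 1: "X * Y = 1\<^sub>m n"
  proof (rule eq_matI)
    fix i j assume ij: "i < dim_row (1\<^sub>m n :: complex mat)" "j < dim_col (1\<^sub>m n :: complex mat)"
    have "(X * Y) $$ (i, j) = (\<Sum>l<n. ((if i = l then 1 else 0) - A i l) * neumann n A l j)"
      using ij by (simp add: X_def Y_def scalar_prod_def lessThan_atLeast0)
    also have "\<dots> = (\<Sum>l<n. (if i = l then neumann n A l j else 0)) - (\<Sum>l<n. A i l * neumann n A l j)"
      by (simp add: left_diff_distrib sum_subtractf if_distrib[of "\<lambda>x. x * _"] cong: if_cong)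
    also have "\<dots> = (1\<^sub>m n) $$ (i, j)"
      using ij rec[of i j] by simp
    finally show "(X * Y) $$ (i, j) = (1\<^sub>m n) $$ (i, j)" .
  qed (auto simp: X_def Y_def)
  show "Y * X = 1\<^sub>m n"
    by (rule mat_mult_left_right_inverse[OF _ _ 1]) (auto simp: X_def Y_def)
qed

text \<open>The entries of each power are sums of products of nonnegative Laurent series. At each z
  the convergence comes from the weights at |z|, which may change with |z|.\<close>

lemma nonneg_laurent_neumann:
  assumes t: "t > 1" and \<alpha>: "\<And>i j. i < n \<Longrightarrow> j < n \<Longrightarrow> \<exists>f. nonneg_laurent t f (\<lambda>z. \<alpha> z i j)"
    and v: "\<And>r. 1 / t < r \<Longrightarrow> r < t \<Longrightarrow> \<exists>v :: nat \<Rightarrow> real. \<forall>i<n. v i \<ge> 1 \<and>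
      (\<Sum>j<n. Re (\<alpha> (complex_of_real r) i j) * v j) \<le> v i - 1"
    and ij: "i < n" "j < n"
  shows "\<exists>f. nonneg_laurent t f (\<lambda>z. neumann n (\<alpha> z) i j)"
proof -
  have ex: "i < n \<Longrightarrow> \<exists>f. nonneg_laurent t f (\<lambda>z. neumann_term n (\<alpha> z) k i j)" for k i
  proof (induction k arbitrary: i)
    case 0
    have "nonneg_laurent t (\<lambda>n. if n = 0 then (if i = j then 1 else 0) else 0) (\<lambda>z. complex_of_real (if i = j then 1 else 0))"
      by (rule nonneg_laurent_const) simp
    moreover have "(\<lambda>z. complex_of_real (if i = j then 1 else 0)) = (\<lambda>z. neumann_term n (\<alpha> z) 0 i j)"
      by auto
    ultimately show ?case by auto
  next
    case (Suc k)
    obtain g where g: "\<And>l. l < n \<Longrightarrow> nonneg_laurent t (g l) (\<lambda>z. neumann_term n (\<alpha> z) k l j)"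
      using Suc.IH by metis
    obtain f where f: "\<And>l. l < n \<Longrightarrow> nonneg_laurent t (f l) (\<lambda>z. \<alpha> z i l)"
      using \<alpha>[OF Suc.prems] by metis
    have "nonneg_laurent t (\<lambda>m. \<Sum>l<n. \<Sum>\<^sub>\<infinity>p. f l p * g l (m - p)) (\<lambda>z. \<Sum>l<n. \<alpha> z i l * neumann_term n (\<alpha> z) k l j)"
      using f g t by (intro nonneg_laurent_sum nonneg_laurent_mult) auto
    thus ?case by auto
  qed
  obtain f where f: "\<And>k. nonneg_laurent t (f k) (\<lambda>z. neumann_term n (\<alpha> z) k i j)"
    using ex[OF ij(1)] by metis
  have "nonneg_laurent t (\<lambda>m. \<Sum>\<^sub>\<infinity>k. f k m) (\<lambda>z. neumann n (\<alpha> z) i j)"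
  proof (rule nonneg_laurent_suminf[OF t f])
    fix z assume z: "z \<in> annulus (1 / t) t"
    hence r: "1 / t < cmod z" "cmod z < t" by (auto simp: annulus_def)
    obtain v :: "nat \<Rightarrow> real" where v: "\<And>i. i < n \<Longrightarrow> v i \<ge> 1"
      "\<And>i. i < n \<Longrightarrow> (\<Sum>j<n. Re (\<alpha> (complex_of_real (cmod z)) i j) * v j) \<le> v i - 1"
      using v[OF r] by auto
    show "((\<lambda>k. neumann_term n (\<alpha> z) k i j) has_sum neumann n (\<alpha> z) i j) UNIV"
    proof (rule neumann_has_sum(1)[OF _ v ij])
      fix i j assume "i < n" "j < n"
      then obtain f where "nonneg_laurent t f (\<lambda>z. \<alpha> z i j)" using \<alpha> by blast
      from nonneg_laurentD(6)[OF this z]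
      show "cmod (\<alpha> z i j) \<le> Re (\<alpha> (complex_of_real (cmod z)) i j)" .
    qed
  qed
  thus ?thesis by blast
qed

subsection \<open>Low-rank off-diagonal blocks\<close>

text \<open>A maximal independent set of columns spans all columns and has as many elements as the
  rank; the expansion is padded with zeros up to k terms.\<close>

lemma rank_factorization:
  fixes A :: "complex mat"
  assumes A: "A \<in> carrier_mat n nc" and k: "mat_rank A \<le> k"
  shows "\<exists>U V. \<forall>i<n. \<forall>j<nc. A $$ (i, j) = (\<Sum>\<kappa><k. U i \<kappa> * V \<kappa> j)"
proof -
  interpret vec_space "TYPE(complex)" n .
  have cols: "set (cols A) \<subseteq> carrier_vec n" using cols_dim[of A] A by simp
  have "lin_indpt {}" unfolding lin_dep_def by auto
  hence "\<exists>S. finite S \<and> maximal S (\<lambda>T. T \<subseteq> set (cols A) \<and> lin_indpt T) \<and> {} \<subseteq> S"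
    by (intro maximal_exists_superset[of "set (cols A)"]) auto
  then obtain S where S: "maximal S (\<lambda>T. T \<subseteq> set (cols A) \<and> lin_indpt T)" and fin: "finite S"
    by blast
  have SA: "S \<subseteq> set (cols A)" "lin_indpt S" using S by (auto simp: maximal_def)
  have Sc: "S \<subseteq> carrier_vec n" using SA cols by blast
  have card: "card S \<le> k"
    using rank_card_indpt[OF A S] k A by (simp add: mat_rank_def)
  have span: "c \<in> span S" if c: "c \<in> set (cols A)" for c
  proof (cases "c \<in> S")
    case True
    thus ?thesis using Sc span_mem by auto
  next
    case False
    have "\<not> lin_indpt (S \<union> {c})"
    proof
      assume "lin_indpt (S \<union> {c})"
      hence "S = S \<union> {c}" using S c SA unfolding maximal_def by blast
      thus False using False by blast
    qed
    thus ?thesis using lin_dep_iff_in_span[of S c] Sc SA c cols False by auto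
  qed
  have "\<exists>a. col A j = lincomb a S" if "j < nc" for j
  proof -
    have "col A j \<in> set (cols A)" using that A by (auto simp: cols_def)
    from span[OF this] show ?thesis using finite_span[OF fin] Sc by auto
  qed
  then obtain f where f: "\<And>j. j < nc \<Longrightarrow> col A j = lincomb (f j) S" by metis
  obtain h where h: "bij_betw h {..<card S} S"
    using ex_bij_betw_nat_finite[OF fin] by (auto simp: lessThan_atLeast0)
  show ?thesis
  proof (intro exI allI impI)
    fix i j assume ij: "i < n" "j < nc"
    have "A $$ (i, j) = col A j $ i" using A ij by simp
    also have "\<dots> = (\<Sum>x\<in>S. f j x * x $ i)" by (simp add: f[OF ij(2)] lincomb_index[OF ij(1) Sc])
    also have "\<dots> = (\<Sum>\<kappa><card S. f j (h \<kappa>) * h \<kappa> $ i)"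
      by (rule sum.reindex_bij_betw[OF h, symmetric])
    also have "\<dots> = (\<Sum>\<kappa><k. if \<kappa> < card S then f j (h \<kappa>) * h \<kappa> $ i else 0)"
      using card by (intro sum.mono_neutral_cong_left) auto
    also have "\<dots> = (\<Sum>\<kappa><k. (if \<kappa> < card S then h \<kappa> $ i else 0) * f j (h \<kappa>))"
      by (intro sum.cong refl) simp
    finally show "A $$ (i, j) = (\<Sum>\<kappa><k. (if \<kappa> < card S then h \<kappa> $ i else 0) * f j (h \<kappa>))" .
  qed
qed

lemma pick_atLeastLessThan: "i < m - n \<Longrightarrow> pick {n..<m} i = n + i"
proof (induction i)
  case 0
  show ?case unfolding DL_Missing_Sublist.pick.simps by (rule Least_equality) (use 0 in auto)
next
  case (Suc i)
  hence "pick {n..<m} i = n + i" by simp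
  thus ?case unfolding DL_Missing_Sublist.pick.simps by (intro Least_equality) (use Suc.prems in auto)
qed

text \<open>All row indices of the block exceed all its column indices, so it is one of the
  submatrices over which the maximum is taken.\<close>

lemma quasiseparable_lower_block:
  assumes A: "A \<in> carrier_mat m m" and q: "quasiseparable k A" and n: "n1 + n2 = m"
  shows "\<exists>U V. \<forall>u<n2. \<forall>w<n1. A $$ (n1 + u, w) = (\<Sum>\<kappa><k. U u \<kappa> * V \<kappa> w)"
proof -
  define B where "B = submatrix A {n1..<m} {0..<n1}"
  have c: "card {i. i < m \<and> i \<in> {n1..<m}} = n2" "card {j. j < m \<and> j \<in> {0..<n1}} = n1"
  proof -
    have "{i. i < m \<and> i \<in> {n1..<m}} = {n1..<m}" "{j. j < m \<and> j \<in> {0..<n1}} = {0..<n1}" using n by auto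
    thus "card {i. i < m \<and> i \<in> {n1..<m}} = n2" "card {j. j < m \<and> j \<in> {0..<n1}} = n1" using n by simp_all
  qed
  have B: "B \<in> carrier_mat n2 n1" 
    by (rule carrier_matI) (simp_all only: B_def dim_submatrix carrier_matD[OF A] c)
  have "off_diagonal_submatrices A \<subseteq> (\<lambda>(I, J). submatrix A I J) ` (Pow {..<m} \<times> Pow {..<m})"
    using A by (auto simp: off_diagonal_submatrices_def)
  hence fin: "finite (off_diagonal_submatrices A)" by (rule finite_subset) auto
  have "B \<in> off_diagonal_submatrices A"
    unfolding off_diagonal_submatrices_def B_def mem_Collect_eq using A n
    by (intro exI[of _ "{n1..<m}"] exI[of _ "{0..<n1}"]) auto
  hence "mat_rank B \<le> quasiseparable_rank A"
    unfolding quasiseparable_rank_def using fin by (intro Max_ge) auto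
  hence "mat_rank B \<le> k" using q by (simp add: quasiseparable_def)
  from rank_factorization[OF B this] obtain U V
    where UV: "\<forall>i<n2. \<forall>j<n1. B $$ (i, j) = (\<Sum>\<kappa><k. U i \<kappa> * V \<kappa> j)" by blast
  have "B $$ (u, w) = A $$ (n1 + u, w)" if "u < n2" "w < n1" for u w
  proof -
    have "B $$ (u, w) = A $$ (pick {n1..<m} u, pick {0..<n1} w)"
      unfolding B_def by (rule submatrix_index) (simp_all only: carrier_matD[OF A] c that)
    thus ?thesis using pick_atLeastLessThan[of u m n1] pick_atLeastLessThan[of w n1 0] that n by simp
  qed
  with UV show ?thesis by (intro exI[of _ U] exI[of _ V]) auto
qed

context folded_product
begin

text \<open>The factor \<zeta>^l shifts exponents, so the multiples of N in the product correspond
  to the class of - l in the product of the two outer series, which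
  \<open>convolution_residue\<close> describes.\<close>

lemma summand_has_sum:
  assumes l: "l \<in> {-1, 0, 1}" and ij: "i < a" "j < b"
  shows "((\<lambda>n. \<Sum>u<a. \<Sum>w<b. C l u w * (\<zeta> powi n *
             complex_of_real (\<Sum>\<^sub>\<infinity>p. KD i u p * KE w j (n - l - p)))) has_sum
          (\<Sum>q\<in>{0..<int N}. summand l q i j)) {n. n mod int N = 0}"
proof -
  have \<zeta>0: "\<zeta> \<noteq> 0" using \<zeta> by auto
  have \<zeta>a: "\<zeta> \<in> annulus (1 / t) t" using t \<zeta> by (simp add: annulus_def)
  have "((\<lambda>n. C l u w * (\<zeta> powi n * complex_of_real (\<Sum>\<^sub>\<infinity>p. KD i u p * KE w j (n - l - p)))) has_sum
      C l u w * (\<zeta> powi l * (\<Sum>q\<in>{0..<int N}. RD (- l - q) i u * RE q w j))) {n. n mod int N = 0}"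
    if uw: "u < a" "w < b" for u w
  proof (rule has_sum_cmult_right)
    let ?h = "\<lambda>n. \<Sum>\<^sub>\<infinity>p. KD i u p * KE w j (n - p)"
    note D = nonneg_laurentD(1)[OF KD[OF ij(1) uw(1)] \<zeta>a] and E = nonneg_laurentD(1)[OF KE[OF uw(2) ij(2)] \<zeta>a]
    have "((\<lambda>n. \<zeta> powi n * complex_of_real (?h n)) has_sum
        (\<Sum>q\<in>{0..<int N}. RD (- l - q) i u * RE q w j)) {n. n mod int N = (- l) mod int N}"
      using convolution_residue(1)[OF has_sum_imp_summable[OF D] has_sum_imp_summable[OF E] N, of "- l"]
      unfolding convolution_powi[OF t \<zeta>a KD[OF ij(1) uw(1)] KE[OF uw(2) ij(2)]]
      by (simp only: RD_def RE_def)
    from has_sum_cmult_right[OF this, of "\<zeta> powi l"]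
    have "((\<lambda>n. \<zeta> powi l * (\<zeta> powi n * complex_of_real (?h n))) has_sum
        \<zeta> powi l * (\<Sum>q\<in>{0..<int N}. RD (- l - q) i u * RE q w j)) {n. n mod int N = (- l) mod int N}" .
    also have "?this \<longleftrightarrow> ((\<lambda>n. \<zeta> powi n * complex_of_real (?h (n - l))) has_sum
        \<zeta> powi l * (\<Sum>q\<in>{0..<int N}. RD (- l - q) i u * RE q w j)) {n. n mod int N = 0}"
    proof (rule has_sum_reindex_bij_witness[where i = "\<lambda>n. n - l" and j = "\<lambda>n. n + l"])
      fix n assume "n \<in> {n. n mod int N = (- l) mod int N}"
      hence "int N dvd n - (- l)" by (simp only: mem_Collect_eq mod_eq_dvd_iff)
      thus "n + l \<in> {n. n mod int N = 0}" by simp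
      show "\<zeta> powi (n + l) * complex_of_real (?h (n + l - l)) = \<zeta> powi l * (\<zeta> powi n * complex_of_real (?h n))"
        using \<zeta>0 by (simp add: power_int_add)
    next
      fix n assume "n \<in> {n. n mod int N = 0}"
      hence "int N dvd (n - l) - (- l)" by auto
      thus "n - l \<in> {n. n mod int N = (- l) mod int N}" by (simp only: mem_Collect_eq mod_eq_dvd_iff)
    qed auto
    finally show "((\<lambda>n. \<zeta> powi n * complex_of_real (?h (n - l))) has_sum
        \<zeta> powi l * (\<Sum>q\<in>{0..<int N}. RD (- l - q) i u * RE q w j)) {n. n mod int N = 0}" .
  qed
  hence "((\<lambda>n. \<Sum>u<a. \<Sum>w<b. C l u w * (\<zeta> powi n *
             complex_of_real (\<Sum>\<^sub>\<infinity>p. KD i u p * KE w j (n - l - p)))) has_sum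
      (\<Sum>u<a. \<Sum>w<b. C l u w * (\<zeta> powi l * (\<Sum>q\<in>{0..<int N}. RD (- l - q) i u * RE q w j)))) {n. n mod int N = 0}"
    by (intro has_sum_finite_sum) auto
  also have "(\<Sum>u<a. \<Sum>w<b. C l u w * (\<zeta> powi l * (\<Sum>q\<in>{0..<int N}. RD (- l - q) i u * RE q w j))) =
      (\<Sum>u<a. \<Sum>w<b. \<Sum>q\<in>{0..<int N}. \<zeta> powi l * (RD (- l - q) i u * C l u w * RE q w j))"
    unfolding sum_distrib_left by (intro sum.cong refl) (simp only: mult_ac)
  also have "\<dots> = (\<Sum>u<a. \<Sum>q\<in>{0..<int N}. \<Sum>w<b. \<zeta> powi l * (RD (- l - q) i u * C l u w * RE q w j))"
    by (intro sum.cong refl sum.swap)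
  also have "\<dots> = (\<Sum>q\<in>{0..<int N}. summand l q i j)"
    unfolding summand_def sum_distrib_left by (rule sum.swap)
  finally show ?thesis .
qed

end

subsection \<open>The symbol on the annulus\<close>

lemma nonneg_laurent_cong:
  "nonneg_laurent t f F \<Longrightarrow> (\<And>z. z \<in> annulus (1 / t) t \<Longrightarrow> F z = G z) \<Longrightarrow> nonneg_laurent t f G"
  by (simp add: nonneg_laurent_def)

lemma form_bound_cong:
  assumes "form_bound a b K c" "\<And>i j. i < a \<Longrightarrow> j < b \<Longrightarrow> K i j = K' i j"
  shows "form_bound a b K' c"
  using assms by (simp add: form_bound_def)

lemma sum_lessThan_add:
  fixes f :: "nat \<Rightarrow> 'a :: comm_monoid_add"
  shows "(\<Sum>i<a + b. f i) = (\<Sum>i<a. f i) + (\<Sum>i<b. f (a + i))"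
  by (induction b) (simp_all add: add.assoc)

lemma sum_block_le:
  fixes f :: "nat \<Rightarrow> real"
  assumes "\<And>i. i < m \<Longrightarrow> f i \<ge> 0" "s + n \<le> m"
  shows "(\<Sum>i<n. f (s + i)) \<le> (\<Sum>i<m. f i)"
proof -
  have "(\<Sum>i<n. f (s + i)) \<le> (\<Sum>i<s. f i) + (\<Sum>i<n. f (s + i))"
    using assms sum_nonneg[of "{..<s}" f] by simp
  also have "\<dots> = (\<Sum>i<s + n. f i)" by (simp add: sum_lessThan_add)
  also have "\<dots> \<le> (\<Sum>i<m. f i)" using assms by (intro sum_mono2) auto
  finally show ?thesis .
qed

locale qbd =
  fixes m :: nat and A :: "int \<Rightarrow> complex mat" and L t \<delta> :: real and \<phi> \<psi> :: "complex \<Rightarrow> complex mat"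
  assumes m: "m \<ge> 1"
    and A: "\<And>l. l \<in> {-1, 0, 1} \<Longrightarrow> A l \<in> carrier_mat m m"
    and \<phi>: "\<And>z. \<phi> z = qbd_symbol m A z"
    and A_nonneg: "\<And>l i j. l \<in> {-1, 0, 1} \<Longrightarrow> i < m \<Longrightarrow> j < m \<Longrightarrow> A l $$ (i, j) \<in> \<real>\<^sub>\<ge>\<^sub>0"
    and radius_one: "spectral_radius (1\<^sub>m m - \<phi> 1) < 1"
    and A_norm: "\<And>l. l \<in> {-1, 0, 1} \<Longrightarrow> spectral_norm (A l) \<le> L"
    and t: "t > 1" and \<delta>: "\<delta> > 0"
    and \<psi>: "\<And>z. z \<in> annulus (1 / t) t \<Longrightarrow> inverts_mat (\<phi> z) (\<psi> z) \<and> inverts_mat (\<psi> z) (\<phi> z)"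
    and \<psi>_norm: "\<And>z. z \<in> annulus (1 / t) t \<Longrightarrow> spectral_norm (\<psi> z) \<le> \<delta>"
begin

definition "e l i j = Re (A l $$ (i, j))"
definition "\<alpha> z i j = z powi (-1) * A (-1) $$ (i, j) + A 0 $$ (i, j) + z * A 1 $$ (i, j)"
definition "\<alpha>r r i j = r powi (-1) * e (-1) i j + e 0 i j + r * e 1 i j"

lemma A_real: "l \<in> {-1, 0, 1} \<Longrightarrow> i < m \<Longrightarrow> j < m \<Longrightarrow> A l $$ (i, j) = complex_of_real (e l i j)"
  and e_nonneg: "l \<in> {-1, 0, 1} \<Longrightarrow> i < m \<Longrightarrow> j < m \<Longrightarrow> e l i j \<ge> 0"
  using A_nonneg[of l i j] by (auto simp: e_def complex_nonneg_Reals_iff complex_eq_iff)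

lemma \<phi>_carrier [simp]: "\<phi> z \<in> carrier_mat m m"
  unfolding \<phi> qbd_symbol_def by (intro minus_carrier_mat smult_carrier_mat A) simp

lemma \<phi>_index: "i < m \<Longrightarrow> j < m \<Longrightarrow> \<phi> z $$ (i, j) = (if i = j then 1 else 0) - \<alpha> z i j"
  using A[of "-1"] A[of 0] A[of 1] by (simp add: \<phi> qbd_symbol_def \<alpha>_def power_int_minus)

lemma \<psi>_carrier:
  assumes "z \<in> annulus (1 / t) t"
  shows "\<psi> z \<in> carrier_mat m m" "\<phi> z * \<psi> z = 1\<^sub>m m" "\<psi> z * \<phi> z = 1\<^sub>m m"
proof -
  have 1: "\<phi> z * \<psi> z = 1\<^sub>m m" using \<psi>[OF assms] \<phi>_carrier[of z] by (simp add: inverts_mat_def)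
  have 2: "\<psi> z * \<phi> z = 1\<^sub>m (dim_row (\<psi> z))" using \<psi>[OF assms] by (simp add: inverts_mat_def)
  have "dim_col (\<psi> z) = m" using arg_cong[OF 1, of dim_col] by simp
  moreover have "dim_row (\<psi> z) = m" using arg_cong[OF 2, of dim_col] \<phi>_carrier[of z] by simp
  ultimately show "\<psi> z \<in> carrier_mat m m" "\<phi> z * \<psi> z = 1\<^sub>m m" "\<psi> z * \<phi> z = 1\<^sub>m m"
    using 1 2 by auto
qed

lemma real_annulus: "1 / t < r \<Longrightarrow> r < t \<Longrightarrow> complex_of_real r \<in> annulus (1 / t) t"
  and real_pos: "1 / t < r \<Longrightarrow> r > 0"
proof -
  show pos: "r > 0" if "1 / t < r"
  proof -
    have "0 < 1 / t" using t by simp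
    with that show ?thesis by linarith
  qed
  show "complex_of_real r \<in> annulus (1 / t) t" if "1 / t < r" "r < t"
    using pos[OF that(1)] that by (simp add: annulus_def)
qed

lemma \<psi>_rows:
  assumes "z \<in> annulus (1 / t) t" "i < m" "j < m"
  shows "(\<Sum>k<m. \<phi> z $$ (i, k) * \<psi> z $$ (k, j)) = (if i = j then 1 else 0)"
    and "(\<Sum>k<m. \<psi> z $$ (i, k) * \<phi> z $$ (k, j)) = (if i = j then 1 else 0)"
proof -
  note c = \<psi>_carrier[OF assms(1)] and p = \<phi>_carrier[of z]
  have "(\<phi> z * \<psi> z) $$ (i, j) = (\<Sum>k<m. \<phi> z $$ (i, k) * \<psi> z $$ (k, j))"
    "(\<psi> z * \<phi> z) $$ (i, j) = (\<Sum>k<m. \<psi> z $$ (i, k) * \<phi> z $$ (k, j))"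
    using c(1) assms(2,3) by (simp_all add: scalar_prod_def lessThan_atLeast0 carrier_matD[OF p])
  thus "(\<Sum>k<m. \<phi> z $$ (i, k) * \<psi> z $$ (k, j)) = (if i = j then 1 else 0)"
    "(\<Sum>k<m. \<psi> z $$ (i, k) * \<phi> z $$ (k, j)) = (if i = j then 1 else 0)"
    using c(2,3) assms(2,3) by simp_all
qed

lemma \<psi>_form_bound: "z \<in> annulus (1 / t) t \<Longrightarrow> form_bound m m (\<lambda>i j. \<psi> z $$ (i, j)) \<delta>"
  by (intro spectral_norm_form_bound \<psi>_carrier \<psi>_norm)

lemma \<alpha>_laurent:
  assumes "i < m" "j < m"
  shows "\<exists>f. nonneg_laurent t f (\<lambda>z. \<alpha> z i j)"
proof -
  have "nonneg_laurent t (\<lambda>n. ((if n = -1 then e (-1) i j else 0) + (if n = 0 then e 0 i j else 0)) + (if n = 1 then e 1 i j else 0))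
     (\<lambda>z. (z powi (-1) * complex_of_real (e (-1) i j) + z powi 0 * complex_of_real (e 0 i j)) + z powi 1 * complex_of_real (e 1 i j))"
    using e_nonneg assms by (intro nonneg_laurent_add nonneg_laurent_monom) auto
  also have "(\<lambda>z. (z powi (-1) * complex_of_real (e (-1) i j) + z powi 0 * complex_of_real (e 0 i j)) + z powi 1 * complex_of_real (e 1 i j))
     = (\<lambda>z. \<alpha> z i j)"
    using A_real assms by (auto simp: \<alpha>_def)
  finally show ?thesis by blast
qed

lemma \<alpha>_of_real: "i < m \<Longrightarrow> j < m \<Longrightarrow> \<alpha> (complex_of_real r) i j = complex_of_real (\<alpha>r r i j)"
  using A_real by (simp add: \<alpha>_def \<alpha>r_def)

lemma \<alpha>r_nonneg: "r > 0 \<Longrightarrow> i < m \<Longrightarrow> j < m \<Longrightarrow> \<alpha>r r i j \<ge> 0"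
  using e_nonneg by (simp add: \<alpha>r_def)

lemma \<alpha>_le: "i < m \<Longrightarrow> j < m \<Longrightarrow> z \<in> annulus (1 / t) t \<Longrightarrow> cmod (\<alpha> z i j) \<le> \<alpha>r (cmod z) i j"
  using \<alpha>_laurent[of i j] nonneg_laurentD(6)[of t _ "\<lambda>z. \<alpha> z i j" z] by (auto simp: \<alpha>_of_real)

section \<open>The positive supersolution on the real interval\<close>

definition "W r i = (\<Sum>j<m. \<psi> (complex_of_real r) $$ (i, j))"

lemma W_eq:
  assumes "1 / t < r" "r < t" "i < m"
  shows "W r i = 1 + (\<Sum>j<m. complex_of_real (\<alpha>r r i j) * W r j)"
proof -
  have "(\<Sum>k<m. \<phi> (complex_of_real r) $$ (i, k) * W r k) =
      (\<Sum>j<m. \<Sum>k<m. \<phi> (complex_of_real r) $$ (i, k) * \<psi> (complex_of_real r) $$ (k, j))"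
    unfolding W_def sum_distrib_left by (rule sum.swap)
  also have "\<dots> = (\<Sum>j<m. if i = j then 1 else 0)"
    using assms by (intro sum.cong refl \<psi>_rows real_annulus) auto
  also have "\<dots> = 1" using assms by simp
  also have "(\<Sum>k<m. \<phi> (complex_of_real r) $$ (i, k) * W r k) =
      (\<Sum>k<m. (if i = k then W r k else 0) - complex_of_real (\<alpha>r r i k) * W r k)"
    using assms(3) by (intro sum.cong refl) (simp add: \<phi>_index \<alpha>_of_real left_diff_distrib)
  also have "\<dots> = W r i - (\<Sum>k<m. complex_of_real (\<alpha>r r i k) * W r k)"
    using assms(3) by (simp add: sum_subtractf)
  finally show ?thesis by (simp add: algebra_simps)
qed

text \<open>A solution v satisfies \<phi> v = u, and \<psi> is a left inverse. It serves at r = 1 to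
  identify a nonnegative solution with W, and for differences of W to prove continuity.\<close>

lemma W_unique:
  assumes r: "1 / t < r" "r < t" and v: "\<And>i. i < m \<Longrightarrow> v i = u i + (\<Sum>j<m. complex_of_real (\<alpha>r r i j) * v j)" and i: "i < m"
  shows "v i = (\<Sum>k<m. \<psi> (complex_of_real r) $$ (i, k) * u k)"
proof -
  let ?z = "complex_of_real r"
  have \<phi>v: "(\<Sum>j<m. \<phi> ?z $$ (k, j) * v j) = u k" if k: "k < m" for k
  proof -
    have "(\<Sum>j<m. \<phi> ?z $$ (k, j) * v j) = (\<Sum>j<m. (if k = j then v j else 0) - complex_of_real (\<alpha>r r k j) * v j)"
      using k by (intro sum.cong refl) (simp add: \<phi>_index \<alpha>_of_real left_diff_distrib)
    also have "\<dots> = v k - (\<Sum>j<m. complex_of_real (\<alpha>r r k j) * v j)"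
      using k by (simp add: sum_subtractf)
    also have "\<dots> = u k" using v[OF k] by (simp add: algebra_simps)
    finally show ?thesis .
  qed
  have "(\<Sum>k<m. \<psi> ?z $$ (i, k) * u k) = (\<Sum>k<m. \<Sum>j<m. \<psi> ?z $$ (i, k) * (\<phi> ?z $$ (k, j) * v j))"
    by (intro sum.cong refl) (simp add: \<phi>v flip: sum_distrib_left)
  also have "\<dots> = (\<Sum>j<m. \<Sum>k<m. \<psi> ?z $$ (i, k) * \<phi> ?z $$ (k, j) * v j)"
    by (subst sum.swap) (simp only: mult.assoc)
  also have "\<dots> = (\<Sum>j<m. (\<Sum>k<m. \<psi> ?z $$ (i, k) * \<phi> ?z $$ (k, j)) * v j)"
    by (simp only: sum_distrib_right)
  also have "\<dots> = (\<Sum>j<m. (if i = j then 1 else 0) * v j)"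
    using i by (intro sum.cong refl arg_cong2[where f = "(*)"] \<psi>_rows real_annulus r) auto
  also have "\<dots> = (\<Sum>j<m. if i = j then v j else 0)"
    by (intro sum.cong refl) auto
  also have "\<dots> = v i" using i by simp
  finally show ?thesis by simp
qed

text \<open>Here the spectral radius hypothesis enters: it supplies a nonnegative solution at 1,
  which uniqueness identifies with W.\<close>

lemma W_one_nonneg: "i < m \<Longrightarrow> Re (W 1 i) \<ge> 0"
proof -
  let ?P = "1\<^sub>m m - \<phi> 1"
  have P: "?P \<in> carrier_mat m m" by (rule minus_carrier_mat[OF \<phi>_carrier])
  have Pe: "?P $$ (i, j) = complex_of_real (\<alpha>r 1 i j)" if "i < m" "j < m" for i j
    using that \<alpha>_of_real[of i j 1] \<phi>_carrier[of 1] by (simp add: \<phi>_index carrier_matD[OF \<phi>_carrier])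
  obtain w where w: "\<And>i. i < m \<Longrightarrow> w i \<ge> (0 :: real)" "\<And>i. i < m \<Longrightarrow> w i = 1 + (\<Sum>j<m. \<alpha>r 1 i j * w j)"
  proof (rule nonneg_resolvent_of_one[OF P _ radius_one Pe])
    show "m > 0" using m by simp
    show "\<alpha>r 1 i j \<ge> 0" if "i < m" "j < m" for i j using that by (intro \<alpha>r_nonneg) auto
    fix w :: "nat \<Rightarrow> real"
    assume w: "\<And>i. i < m \<Longrightarrow> w i \<ge> 0" "\<And>i. i < m \<Longrightarrow> w i = 1 + (\<Sum>j<m. \<alpha>r 1 i j * w j)"
    show thesis by (rule that[OF w])
  qed
  assume i: "i < m"
  have "complex_of_real (w i) = (\<Sum>k<m. \<psi> (complex_of_real 1) $$ (i, k) * 1)"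
  proof (rule W_unique[where v = "\<lambda>i. complex_of_real (w i)"])
    fix i assume "i < m"
    from arg_cong[OF w(2)[OF this], of complex_of_real]
    show "complex_of_real (w i) = 1 + (\<Sum>j<m. complex_of_real (\<alpha>r 1 i j) * complex_of_real (w j))" by simp
  qed (use t i in auto)
  hence "W 1 i = complex_of_real (w i)" by (simp add: W_def)
  thus "Re (W 1 i) \<ge> 0" using w(1)[OF i] by simp
qed

text \<open>Resolvent identity: W r - W s is \<psi>(r) applied to the vector (\<alpha>(r) -
  \<alpha>(s)) W s. As \<psi> is uniformly bounded by \<delta>, continuity of \<alpha>
  suffices.\<close>

lemma W_continuous:
  assumes i: "i < m"
  shows "continuous_on {1 / t<..<t} (\<lambda>r. Re (W r i))"
proof -
  have "isCont (\<lambda>r. Re (W r i)) s" if s: "s \<in> {1 / t<..<t}" for s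
  proof -
    define d where "d r k = (\<Sum>j<m. complex_of_real (\<alpha>r r k j - \<alpha>r s k j) * W s j)" for r k
    have s0: "s > 0" using real_pos s by auto
    have diff: "W r k - W s k = (\<Sum>l<m. \<psi> (complex_of_real r) $$ (k, l) * d r l)"
      if r: "r \<in> {1 / t<..<t}" and k: "k < m" for r k
    proof (rule W_unique[of r "\<lambda>k. W r k - W s k"])
      fix k assume k: "k < m"
      show "W r k - W s k = d r k + (\<Sum>j<m. complex_of_real (\<alpha>r r k j) * (W r j - W s j))"
        using W_eq[of r k] W_eq[of s k] r s k
        by (simp add: d_def right_diff_distrib left_diff_distrib sum_subtractf)
    qed (use r k in auto)
    have ev: "\<forall>\<^sub>F r in at s. norm (Re (W r i) - Re (W s i)) \<le> \<delta> * vnorm m (d r)"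
    proof -
      have "\<forall>\<^sub>F r in at s. r \<in> {1 / t<..<t}"
        using s by (intro eventually_at_in_open') auto
      thus ?thesis
      proof eventually_elim
        case (elim r)
        have "norm (Re (W r i) - Re (W s i)) \<le> cmod (W r i - W s i)"
          using abs_Re_le_cmod[of "W r i - W s i"] by simp
        also have "\<dots> \<le> vnorm m (\<lambda>k. W r k - W s k)"
          unfolding vnorm_def using i by (intro member_le_L2_set) auto
        also have "\<dots> = vnorm m (\<lambda>k. \<Sum>l<m. \<psi> (complex_of_real r) $$ (k, l) * d r l)"
          unfolding vnorm_def using diff[OF elim] by (intro L2_set_cong refl) auto
        also have "\<dots> \<le> \<delta> * vnorm m (d r)"
          using elim \<delta> by (intro form_bound_vnorm \<psi>_form_bound real_annulus) auto
        finally show ?case .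
      qed
    qed
    have "((\<lambda>r. \<delta> * vnorm m (d r)) \<longlongrightarrow> \<delta> * vnorm m (\<lambda>k. \<Sum>j<m. complex_of_real (\<alpha>r s k j - \<alpha>r s k j) * W s j)) (at s)"
      unfolding vnorm_def L2_set_def d_def \<alpha>r_def using s0 by (intro tendsto_intros) auto
    hence lim: "((\<lambda>r. \<delta> * vnorm m (d r)) \<longlongrightarrow> 0) (at s)"
      by (simp add: vnorm_def L2_set_def)
    have "((\<lambda>r. Re (W r i) - Re (W s i)) \<longlongrightarrow> 0) (at s)"
    proof (rule tendsto_0_le[where K = 1, OF lim], rule eventually_mono[OF ev])
      fix r assume "norm (Re (W r i) - Re (W s i)) \<le> \<delta> * vnorm m (d r)"
      also have "\<dots> \<le> norm (\<delta> * vnorm m (d r)) * 1" by simp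
      finally show "norm (Re (W r i) - Re (W s i)) \<le> norm (\<delta> * vnorm m (d r)) * 1" .
    qed
    thus ?thesis unfolding isCont_def by (rule LIM_zero_cancel)
  qed
  thus ?thesis by (intro continuous_at_imp_continuous_on) auto
qed

lemma supersolution:
  assumes r: "1 / t < r" "r < t" and i: "i < m"
  shows "Re (W r i) \<ge> 1" "(\<Sum>j<m. \<alpha>r r i j * Re (W r j)) = Re (W r i) - 1"
proof -
  \<comment> \<open>W is complex a priori, but the matrix \<alpha>r is real, so the real part
    satisfies the same equation.\<close>
  have eq: "Re (W r i) = 1 + (\<Sum>j<m. \<alpha>r r i j * Re (W r j))" if "1 / t < r" "r < t" "i < m" for r i
    using arg_cong[OF W_eq[OF that], of Re] by simp
  show "(\<Sum>j<m. \<alpha>r r i j * Re (W r j)) = Re (W r i) - 1" using eq[OF r i] by simp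
  show "Re (W r i) \<ge> 1"
  proof (rule nonneg_solution_propagates[where I = "{1 / t<..<t}" and n = m and w = "\<lambda>r i. Re (W r i)" and p = \<alpha>r and ?r0.0 = 1])
    show "connected {1 / t<..<t}" by (rule connected_Ioo)
    show "open {1 / t<..<t}" by (rule open_greaterThanLessThan)
    show "1 \<in> {1 / t<..<t}" using t by simp
    show "r \<in> {1 / t<..<t}" using r by simp
    show "\<alpha>r r i j \<ge> 0" if "r \<in> {1 / t<..<t}" "i < m" "j < m" for r i j
      using that real_pos[of r] by (intro \<alpha>r_nonneg) auto
    show "Re (W r i) = 1 + (\<Sum>j<m. \<alpha>r r i j * Re (W r j))" if "r \<in> {1 / t<..<t}" "i < m" for r i
      using that by (intro eq) auto
  qed (rule W_one_nonneg W_continuous i; assumption?)+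
qed

theorem spectral_radius_annulus:
  assumes z: "z \<in> annulus (1 / t) t"
  shows "spectral_radius (1\<^sub>m m - \<phi> z) < 1"
proof (rule spectral_radius_less_one[where n = m and P = "\<alpha>r (cmod z)" and v = "\<lambda>i. Re (W (cmod z) i)"])
  have r: "1 / t < cmod z" "cmod z < t" using z by (auto simp: annulus_def)
  show "1\<^sub>m m - \<phi> z \<in> carrier_mat m m" by (rule minus_carrier_mat[OF \<phi>_carrier])
  show "m > 0" using m by simp
  show "cmod ((1\<^sub>m m - \<phi> z) $$ (i, j)) \<le> \<alpha>r (cmod z) i j" if "i < m" "j < m" for i j
    using that \<alpha>_le[OF that z] by (simp add: \<phi>_index carrier_matD[OF \<phi>_carrier])
  show "Re (W (cmod z) i) > 0" "(\<Sum>j<m. \<alpha>r (cmod z) i j * Re (W (cmod z) j)) < Re (W (cmod z) i)" if "i < m" for i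
    using supersolution[OF r that] by auto
qed

section \<open>Diagonal blocks and their inverses\<close>

lemma block_supersolution:
  assumes r: "1 / t < r" "r < t" and n: "s + n \<le> m" and i: "i < n"
  shows "(\<Sum>j<n. \<alpha>r r (s + i) (s + j) * Re (W r (s + j))) \<le> Re (W r (s + i)) - 1"
proof -
  \<comment> \<open>The terms outside the block are nonnegative; dropping them turns the equation
    for W into an inequality.\<close>
  have "(\<Sum>j<n. \<alpha>r r (s + i) (s + j) * Re (W r (s + j))) \<le> (\<Sum>j<m. \<alpha>r r (s + i) j * Re (W r j))"
    using n i r
    by (intro sum_block_le[where f = "\<lambda>j. \<alpha>r r (s + i) j * Re (W r j)"] mult_nonneg_nonneg \<alpha>r_nonneg real_pos)
      (auto intro: order_trans[OF _ supersolution(1)[OF r]])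
  thus ?thesis using supersolution(2)[OF r, of "s + i"] n i by simp
qed

text \<open>The inverse of the diagonal block of \<phi> with offset s and size n: the whole matrix
  for \<open>(0, m)\<close>, I - E for \<open>(0, n1)\<close>, I - D for
  \<open>(n1, n2)\<close>.\<close>

definition "block_neumann s n z = neumann n (\<lambda>i j. \<alpha> z (s + i) (s + j))"

lemma block_inverse:
  assumes n: "s + n \<le> m" and z: "z \<in> annulus (1 / t) t"
  defines "X \<equiv> mat n n (\<lambda>(i, j). (if i = j then 1 else 0) - \<alpha> z (s + i) (s + j))"
    and "Y \<equiv> mat n n (\<lambda>(i, j). block_neumann s n z i j)"
  shows "X * Y = 1\<^sub>m n" "Y * X = 1\<^sub>m n"
proof -
  have r: "1 / t < cmod z" "cmod z < t" using z by (auto simp: annulus_def)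
  have "X * Y = 1\<^sub>m n \<and> Y * X = 1\<^sub>m n"
    unfolding X_def Y_def block_neumann_def using n
    by (intro conjI neumann_inverse[where p = "\<lambda>i j. \<alpha>r (cmod z) (s + i) (s + j)" and v = "\<lambda>i. Re (W (cmod z) (s + i))"]
        \<alpha>_le supersolution(1)[OF r] block_supersolution[OF r] z) auto
  thus "X * Y = 1\<^sub>m n" "Y * X = 1\<^sub>m n" by auto
qed

lemma block_laurent:
  assumes n: "s + n \<le> m" and ij: "i < n" "j < n"
  shows "\<exists>f. nonneg_laurent t f (\<lambda>z. block_neumann s n z i j)"
  unfolding block_neumann_def
proof (rule nonneg_laurent_neumann[OF t _ _ ij, where \<alpha> = "\<lambda>z i j. \<alpha> z (s + i) (s + j)"])
  show "\<exists>f. nonneg_laurent t f (\<lambda>z. \<alpha> z (s + i) (s + j))" if "i < n" "j < n" for i j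
    using that n by (intro \<alpha>_laurent) auto
  fix r :: real assume r: "1 / t < r" "r < t"
  have "(\<Sum>j<n. Re (\<alpha> (complex_of_real r) (s + i) (s + j)) * Re (W r (s + j))) =
      (\<Sum>j<n. \<alpha>r r (s + i) (s + j) * Re (W r (s + j)))" if "i < n" for i
    using that n by (intro sum.cong refl) (simp add: \<alpha>_of_real)
  thus "\<exists>v :: nat \<Rightarrow> real. \<forall>i<n. v i \<ge> 1 \<and> (\<Sum>j<n. Re (\<alpha> (complex_of_real r) (s + i) (s + j)) * v j) \<le> v i - 1"
    using supersolution(1)[OF r] block_supersolution[OF r n] n
    by (intro exI[of _ "\<lambda>i. Re (W r (s + i))"]) auto
qed

text \<open>The Neumann series of the full matrix is a right inverse of \<phi>, hence equals
  \<psi>.\<close>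

lemma \<psi>_laurent:
  assumes "i < m" "j < m"
  shows "\<exists>f. nonneg_laurent t f (\<lambda>z. \<psi> z $$ (i, j))"
proof -
  obtain f where f: "nonneg_laurent t f (\<lambda>z. block_neumann 0 m z i j)"
    using block_laurent[of 0 m i j] assms by auto
  have "block_neumann 0 m z i j = \<psi> z $$ (i, j)" if z: "z \<in> annulus (1 / t) t" for z
  proof -
    define Y where "Y = mat m m (\<lambda>(i, j). block_neumann 0 m z i j)"
    have Y: "Y \<in> carrier_mat m m" by (simp add: Y_def)
    have "\<phi> z = mat m m (\<lambda>(i, j). (if i = j then 1 else 0) - \<alpha> z (0 + i) (0 + j))"
      by (rule eq_matI) (auto simp: \<phi>_index carrier_matD[OF \<phi>_carrier])
    hence "\<phi> z * Y = 1\<^sub>m m" using block_inverse(1)[of 0 m z] z by (simp add: Y_def)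
    hence "\<psi> z * (\<phi> z * Y) = \<psi> z" using \<psi>_carrier(1)[OF z] by simp
    moreover have "\<psi> z * (\<phi> z * Y) = (\<psi> z * \<phi> z) * Y"
      by (rule assoc_mult_mat[symmetric, OF \<psi>_carrier(1)[OF z] \<phi>_carrier Y])
    ultimately have "Y = \<psi> z" using \<psi>_carrier(3)[OF z] Y by simp
    from arg_cong[OF this, of "\<lambda>M. M $$ (i, j)"] show ?thesis using assms by (simp add: Y_def)
  qed
  thus ?thesis by (intro exI[of _ f] nonneg_laurent_cong[OF f])
qed

end

subsection \<open>The lower left block of the inverse\<close>

lemma nonneg_laurent_some:
  "\<exists>f. nonneg_laurent t f F \<Longrightarrow> nonneg_laurent t (SOME f. nonneg_laurent t f F) F"
  by (rule someI_ex[of "\<lambda>f. nonneg_laurent t f F"])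

locale qbd_blocks = qbd +
  fixes n1 n2 :: nat
  assumes n: "n1 \<ge> 1" "n2 \<ge> 1" "n1 + n2 = m"
begin

abbreviation "FD \<equiv> block_neumann n1 n2"
abbreviation "FE z i j \<equiv> \<psi> z $$ (i, j)"

definition "KD i j = (SOME f. nonneg_laurent t f (\<lambda>z. FD z i j))"
definition "KE i j = (SOME f. nonneg_laurent t f (\<lambda>z. FE z i j))"

lemma KD: "i < n2 \<Longrightarrow> j < n2 \<Longrightarrow> nonneg_laurent t (KD i j) (\<lambda>z. FD z i j)"
  unfolding KD_def by (rule nonneg_laurent_some, rule block_laurent) (use n in auto)

lemma KE: "i < n1 \<Longrightarrow> j < n1 \<Longrightarrow> nonneg_laurent t (KE i j) (\<lambda>z. FE z i j)"
  unfolding KE_def by (rule nonneg_laurent_some, rule \<psi>_laurent) (use n in auto)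

text \<open>The lower rows of \<phi> \<psi> = I, multiplied by the inverse of I - D. Columns
  \<open>J < n1\<close> yield the product formula for the lower left block, columns
  \<open>J \<ge> n1\<close> compare the lower right block with that inverse.\<close>

lemma schur_complement:
  assumes z: "z \<in> annulus (1 / t) t" and i: "i < n2" and J: "J < m"
  shows "\<psi> z $$ (n1 + i, J) =
    (\<Sum>k<n2. FD z i k * ((if n1 + k = J then 1 else 0) + (\<Sum>u<n1. \<alpha> z (n1 + k) u * \<psi> z $$ (u, J))))"
proof -
  have row: "(\<Sum>l<n2. ((if k = l then 1 else 0) - \<alpha> z (n1 + k) (n1 + l)) * \<psi> z $$ (n1 + l, J)) =
      (if n1 + k = J then 1 else 0) + (\<Sum>u<n1. \<alpha> z (n1 + k) u * \<psi> z $$ (u, J))" if k: "k < n2" for k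
  proof -
    have "(\<Sum>l<n1 + n2. \<phi> z $$ (n1 + k, l) * \<psi> z $$ (l, J)) = (if n1 + k = J then 1 else 0)"
      using \<psi>_rows(1)[OF z, of "n1 + k" J] J k n by simp
    moreover have "(\<Sum>l<n1. \<phi> z $$ (n1 + k, l) * \<psi> z $$ (l, J)) = - (\<Sum>u<n1. \<alpha> z (n1 + k) u * \<psi> z $$ (u, J))"
      unfolding sum_negf[symmetric] using k n by (intro sum.cong refl) (simp add: \<phi>_index)
    moreover have "(\<Sum>l<n2. \<phi> z $$ (n1 + k, n1 + l) * \<psi> z $$ (n1 + l, J)) =
        (\<Sum>l<n2. ((if k = l then 1 else 0) - \<alpha> z (n1 + k) (n1 + l)) * \<psi> z $$ (n1 + l, J))"
      using k n by (intro sum.cong refl) (simp add: \<phi>_index)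
    ultimately show ?thesis by (simp add: sum_lessThan_add algebra_simps)
  qed
  have inv: "(\<Sum>k<n2. FD z i k * ((if k = l then 1 else 0) - \<alpha> z (n1 + k) (n1 + l))) = (if i = l then 1 else 0)"
    if l: "l < n2" for l
  proof -
    have "n1 + n2 \<le> m" using n by simp
    from arg_cong[OF block_inverse(2)[OF this z], of "\<lambda>M. M $$ (i, l)"]
    show ?thesis using i l by (simp add: scalar_prod_def lessThan_atLeast0)
  qed
  have "(\<Sum>k<n2. FD z i k * ((if n1 + k = J then 1 else 0) + (\<Sum>u<n1. \<alpha> z (n1 + k) u * \<psi> z $$ (u, J)))) =
      (\<Sum>k<n2. \<Sum>l<n2. FD z i k * (((if k = l then 1 else 0) - \<alpha> z (n1 + k) (n1 + l)) * \<psi> z $$ (n1 + l, J)))"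
    unfolding sum_distrib_left[symmetric] using row by (intro sum.cong refl) (simp only: lessThan_iff)
  also have "\<dots> = (\<Sum>l<n2. \<Sum>k<n2. FD z i k * ((if k = l then 1 else 0) - \<alpha> z (n1 + k) (n1 + l)) * \<psi> z $$ (n1 + l, J))"
    by (subst sum.swap) (simp only: mult.assoc)
  also have "\<dots> = (\<Sum>l<n2. (if i = l then 1 else 0) * \<psi> z $$ (n1 + l, J))"
    unfolding sum_distrib_right[symmetric] using inv by (intro sum.cong refl) (simp only: lessThan_iff)
  also have "\<dots> = (\<Sum>l<n2. if i = l then \<psi> z $$ (n1 + l, J) else 0)"
    by (intro sum.cong refl) auto
  also have "\<dots> = \<psi> z $$ (n1 + i, J)" using i by simp
  finally show ?thesis by simp
qed

text \<open>At a positive real point the inverse of the diagonal block is entrywise dominated by the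
  corresponding block of \<open>\<psi>\<close>, because the Schur complement correction is nonnegative.\<close>

lemma FD_form_bound:
  assumes r: "1 / t < r" "r < t"
  shows "form_bound n2 n2 (FD (complex_of_real r)) \<delta>"
proof -
  let ?z = "complex_of_real r"
  have z: "?z \<in> annulus (1 / t) t" by (rule real_annulus[OF r])
  have [simp]: "\<bar>r\<bar> = r" using real_pos[OF r(1)] by simp
  have "form_bound n2 n2 (\<lambda>i j. \<psi> ?z $$ (n1 + i, n1 + j)) \<delta>"
    using n by (intro form_bound_block[OF \<psi>_form_bound[OF z]]) auto
  hence real: "form_bound n2 n2 (\<lambda>i j. complex_of_real (Re (\<psi> ?z $$ (n1 + i, n1 + j)))) \<delta>"
  proof (rule form_bound_cong)
    fix i j assume "i < n2" "j < n2"
    then obtain f where "nonneg_laurent t f (\<lambda>z. \<psi> z $$ (n1 + i, n1 + j))"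
      using \<psi>_laurent[of "n1 + i" "n1 + j"] n by auto
    from nonneg_laurentD(5)[OF this z]
    show "\<psi> ?z $$ (n1 + i, n1 + j) = complex_of_real (Re (\<psi> ?z $$ (n1 + i, n1 + j)))" by simp
  qed
  show ?thesis
  proof (rule form_bound_mono[OF real])
    fix i j assume ij: "i < n2" "j < n2"
    \<comment> \<open>g is the correction (I - D)^-1 C B' in the Schur complement formula, built
      from nonnegative Laurent series by sums and products.\<close>
    define g where "g z = (\<Sum>k<n2. FD z i k * (\<Sum>u<n1. \<alpha> z (n1 + k) u * \<psi> z $$ (u, n1 + j)))" for z
    define ka where "ka k u = (SOME f. nonneg_laurent t f (\<lambda>z. \<alpha> z (n1 + k) u))" for k u
    define kp where "kp u = (SOME f. nonneg_laurent t f (\<lambda>z. \<psi> z $$ (u, n1 + j)))" for u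
    have ka: "nonneg_laurent t (ka k u) (\<lambda>z. \<alpha> z (n1 + k) u)" if "k < n2" "u < n1" for k u
      unfolding ka_def by (rule nonneg_laurent_some, rule \<alpha>_laurent) (use n that in auto)
    have kp: "nonneg_laurent t (kp u) (\<lambda>z. \<psi> z $$ (u, n1 + j))" if "u < n1" for u
      unfolding kp_def by (rule nonneg_laurent_some, rule \<psi>_laurent) (use n that ij in auto)
    have "nonneg_laurent t (\<lambda>l. \<Sum>k<n2. \<Sum>\<^sub>\<infinity>p. KD i k p * (\<Sum>u<n1. \<Sum>\<^sub>\<infinity>q. ka k u q * kp u (l - p - q))) g"
      unfolding g_def using ij
      by (intro nonneg_laurent_sum nonneg_laurent_mult[where g = "\<lambda>m. \<Sum>u<n1. \<Sum>\<^sub>\<infinity>q. ka _ u q * kp u (m - q)"]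
          nonneg_laurent_mult[OF t ka kp] t KD) auto
    from nonneg_laurentD(4)[OF this z] have "Re (g ?z) \<ge> 0" by simp
    moreover have "\<psi> ?z $$ (n1 + i, n1 + j) = FD ?z i j + g ?z"
    proof -
      have "\<psi> ?z $$ (n1 + i, n1 + j) = (\<Sum>k<n2. (if k = j then FD ?z i k else 0) + FD ?z i k * (\<Sum>u<n1. \<alpha> ?z (n1 + k) u * \<psi> ?z $$ (u, n1 + j)))"
        unfolding schur_complement[OF z ij(1), of "n1 + j"]
        using schur_complement[OF z ij(1), of "n1 + j"] ij n
        by (simp add: distrib_left if_distrib[of "\<lambda>x. _ * x"] cong: if_cong)
      thus ?thesis using ij(2) by (simp add: sum.distrib g_def)
    qed
    moreover have "cmod (FD ?z i j) = Re (FD ?z i j)"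
      using nonneg_laurentD(4,5)[OF KD[OF ij] z] by simp (metis abs_of_nonneg norm_of_real)
    ultimately show "cmod (FD ?z i j) \<le> Re (\<psi> ?z $$ (n1 + i, n1 + j))" by simp
  qed
qed

lemma FE_form_bound:
  assumes r: "1 / t < r" "r < t"
  shows "form_bound n1 n1 (FE (complex_of_real r)) \<delta>"
  using form_bound_block[OF \<psi>_form_bound[OF real_annulus[OF r]], of 0 n1 0 n1] n by simp

section \<open>Laurent coefficients of the lower left block of \<psi>\<close>

definition "Cl l u w = A l $$ (n1 + u, w)"

lemma Cl_form_bound: "l \<in> {-1, 0, 1} \<Longrightarrow> form_bound n2 n1 (Cl l) L"
  unfolding Cl_def
  using form_bound_block[OF spectral_norm_form_bound[OF A A_norm], of l n1 n2 0 n1] n by simp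

lemma L_nonneg: "L \<ge> 0"
  using spectral_norm_upper(2)[OF A[of 0], of "0\<^sub>v m"] A_norm[of 0] by simp

lemma folded: "N > 0 \<Longrightarrow> cmod \<zeta> = 1 \<Longrightarrow> folded_product t \<delta> L N n2 n1 \<zeta> KD KE FD FE Cl"
  using t \<delta> L_nonneg KD KE FD_form_bound FE_form_bound Cl_form_bound
  by unfold_locales auto

text \<open>The coefficient of z^n in the product of the three factors. It is written out, rather
  than taken from an existence statement, so that its restriction to multiples of N can be matched
  with \<open>part\<close>.\<close>

definition "lower_coeff n i j = (\<Sum>l\<in>{-1, 0, 1 :: int}. \<Sum>u<n2. \<Sum>w<n1.
   Cl l u w * complex_of_real (\<Sum>\<^sub>\<infinity>p. KD i u p * KE w j (n - l - p)))"

definition "lower_coeff_mat n = mat n2 n1 (\<lambda>(i, j). lower_coeff n i j)"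

lemma \<alpha>_Cl: "\<alpha> z (n1 + u) w = (\<Sum>l\<in>{-1, 0, 1 :: int}. z powi l * Cl l u w)"
  by (simp add: \<alpha>_def Cl_def)

lemma lower_coeff_laurent:
  assumes z: "z \<in> annulus (1 / t) t" and ij: "i < n2" "j < n1"
  shows "((\<lambda>n. z powi n * lower_coeff n i j) has_sum \<psi> z $$ (n1 + i, j)) UNIV"
proof -
  have z0: "z \<noteq> 0" by (rule annulus_nonzero[OF z t])
  have entry: "((\<lambda>n. z powi n * complex_of_real (\<Sum>\<^sub>\<infinity>p. KD i u p * KE w j (n - l - p))) has_sum
      z powi l * (FD z i u * FE z w j)) UNIV" if uw: "u < n2" "w < n1" for u w l
  proof -
    let ?h = "\<lambda>n. \<Sum>\<^sub>\<infinity>p. KD i u p * KE w j (n - p)"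
    have "((\<lambda>n. z powi n * complex_of_real (?h n)) has_sum FD z i u * FE z w j) UNIV"
      by (rule nonneg_laurentD(1)[OF nonneg_laurent_mult[OF t KD[OF ij(1) uw(1)] KE[OF uw(2) ij(2)]] z])
    from has_sum_cmult_right[OF this, of "z powi l"]
    have "((\<lambda>n. z powi l * (z powi n * complex_of_real (?h n))) has_sum z powi l * (FD z i u * FE z w j)) UNIV" .
    also have "?this \<longleftrightarrow> ((\<lambda>n. z powi n * complex_of_real (?h (n - l))) has_sum z powi l * (FD z i u * FE z w j)) UNIV"
      by (rule has_sum_reindex_bij_witness[where i = "\<lambda>n. n - l" and j = "\<lambda>n. n + l"])
        (use z0 in \<open>auto simp: power_int_add\<close>)
    finally show ?thesis .
  qed
  have "((\<lambda>n. \<Sum>l\<in>{-1, 0, 1 :: int}. \<Sum>u<n2. \<Sum>w<n1.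
        Cl l u w * (z powi n * complex_of_real (\<Sum>\<^sub>\<infinity>p. KD i u p * KE w j (n - l - p)))) has_sum
      (\<Sum>l\<in>{-1, 0, 1 :: int}. \<Sum>u<n2. \<Sum>w<n1. Cl l u w * (z powi l * (FD z i u * FE z w j)))) UNIV"
    by (intro has_sum_finite_sum has_sum_cmult_right entry) auto
  also have "(\<lambda>n. \<Sum>l\<in>{-1, 0, 1 :: int}. \<Sum>u<n2. \<Sum>w<n1.
        Cl l u w * (z powi n * complex_of_real (\<Sum>\<^sub>\<infinity>p. KD i u p * KE w j (n - l - p)))) = (\<lambda>n. z powi n * lower_coeff n i j)"
    unfolding lower_coeff_def sum_distrib_left by (intro ext sum.cong refl) (simp only: mult.left_commute)
  also have "(\<Sum>l\<in>{-1, 0, 1 :: int}. \<Sum>u<n2. \<Sum>w<n1. Cl l u w * (z powi l * (FD z i u * FE z w j))) =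
      (\<Sum>u<n2. \<Sum>w<n1. \<Sum>l\<in>{-1, 0, 1 :: int}. Cl l u w * (z powi l * (FD z i u * FE z w j)))"
    by (subst sum.swap, intro sum.cong refl sum.swap)
  also have "\<dots> = (\<Sum>u<n2. FD z i u * (\<Sum>w<n1. \<alpha> z (n1 + u) w * FE z w j))"
    unfolding \<alpha>_Cl sum_distrib_left sum_distrib_right by (intro sum.cong refl) (simp only: mult_ac)
  \<comment> \<open>The added indicator vanishes because j < n1; it brings the sum into the form of
    \<open>schur_complement\<close>.\<close>
  also have "\<dots> = (\<Sum>u<n2. FD z i u * ((if n1 + u = j then 1 else 0) + (\<Sum>w<n1. \<alpha> z (n1 + u) w * FE z w j)))"
    using ij by (intro sum.cong refl) auto
  also have "\<dots> = \<psi> z $$ (n1 + i, j)"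
    using ij n by (intro schur_complement[OF z ij(1), symmetric]) auto
  finally show ?thesis .
qed

text \<open>Folding keeps the exponents that are multiples of N, and a power n of \<zeta>^N is the
  power N n of \<zeta>, so the folded value is a partial sum of the series at \<zeta>.\<close>

lemma I_op_eval:
  assumes N: "N > 0" and \<zeta>: "cmod \<zeta> = 1" and ij: "i < n2" "j < n1"
  shows "laurent_eval (I_op N lower_coeff_mat) (\<zeta> ^ N) $$ (i, j) =
    folded_product.part N n2 n1 \<zeta> KD KE Cl (\<lambda>_. {0..<int N}) i j"
proof -
  interpret F: folded_product t \<delta> L N n2 n1 \<zeta> KD KE FD FE Cl by (rule folded[OF N \<zeta>])
  have "((\<lambda>n. \<Sum>l\<in>{-1, 0, 1 :: int}. \<Sum>u<n2. \<Sum>w<n1. Cl l u w * (\<zeta> powi n *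
             complex_of_real (\<Sum>\<^sub>\<infinity>p. KD i u p * KE w j (n - l - p)))) has_sum
      F.part (\<lambda>_. {0..<int N}) i j) {n. n mod int N = 0}"
    unfolding F.part_def by (intro has_sum_finite_sum F.summand_has_sum ij)
  also have "(\<lambda>n. \<Sum>l\<in>{-1, 0, 1 :: int}. \<Sum>u<n2. \<Sum>w<n1.
        Cl l u w * (\<zeta> powi n * complex_of_real (\<Sum>\<^sub>\<infinity>p. KD i u p * KE w j (n - l - p)))) = (\<lambda>n. \<zeta> powi n * lower_coeff n i j)"
    unfolding lower_coeff_def sum_distrib_left by (intro ext sum.cong refl) (simp only: mult.left_commute)
  finally have "((\<lambda>n. \<zeta> powi n * lower_coeff n i j) has_sum F.part (\<lambda>_. {0..<int N}) i j) {n. n mod int N = 0}" .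
  also have "?this \<longleftrightarrow> ((\<lambda>n. (\<zeta> ^ N) powi n * lower_coeff (int N * n) i j) has_sum F.part (\<lambda>_. {0..<int N}) i j) UNIV"
    by (rule has_sum_reindex_bij_witness[where i = "\<lambda>n. int N * n" and j = "\<lambda>n. n div int N"])
      (use N in \<open>auto simp: power_int_mult\<close>)
  finally show ?thesis
    using ij by (simp add: laurent_eval_def I_op_def lower_coeff_mat_def infsumI)
qed

lemma I_op_singular_values:
  assumes N: "N > 0" and z: "cmod z = 1" and s: "s \<ge> 1" and k: "k \<ge> 1"
    and q: "\<And>l. l \<in> {-1, 0, 1} \<Longrightarrow> quasiseparable k (A l)"
  defines "M \<equiv> 4 * L * \<delta>\<^sup>2 / ((1 - (1 / t) ^ N) * (1 - 1 / t))"
  shows "\<sigma> s (laurent_eval (I_op N lower_coeff_mat) z) \<le> 3 * M * (1 / t) powr ((real s - 3 * real k) / (6 * real k))"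
    and "s \<ge> 2 \<Longrightarrow> (\<And>l. l \<in> {-1, 0, 1} \<Longrightarrow> tridiagonal (A l)) \<Longrightarrow>
      \<sigma> s (laurent_eval (I_op N lower_coeff_mat) z) \<le> M * (1 / t) powr (real s / 2)"
proof -
  \<comment> \<open>An N-th root of z on the unit circle.\<close>
  define \<zeta> where "\<zeta> = cis (Arg z / real N)"
  have \<zeta>: "cmod \<zeta> = 1" by (simp add: \<zeta>_def)
  have "\<zeta> ^ N = cis (Arg z)" using N by (simp add: \<zeta>_def DeMoivre)
  hence \<zeta>N: "\<zeta> ^ N = z" using rcis_cmod_Arg[of z] z by (simp add: rcis_def)
  interpret F: folded_product t \<delta> L N n2 n1 \<zeta> KD KE FD FE Cl by (rule folded[OF N \<zeta>])
  have M: "F.M = M" by (simp add: F.M_def F.x_def M_def)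
  let ?X = "laurent_eval (I_op N lower_coeff_mat) z"
  have X: "?X \<in> carrier_mat n2 n1" by (simp add: laurent_eval_def I_op_def lower_coeff_mat_def)
  have Xe: "?X $$ (i, j) = F.part (\<lambda>_. {0..<int N}) i j" if "i < n2" "j < n1" for i j
    using I_op_eval[OF N \<zeta> that] by (simp only: \<zeta>N)
  have "\<exists>U V. \<forall>u<n2. \<forall>w<n1. Cl l u w = (\<Sum>\<kappa><k. U u \<kappa> * V \<kappa> w)" if "l \<in> {-1, 0, 1}" for l
    unfolding Cl_def by (rule quasiseparable_lower_block[OF A[OF that] q[OF that] n(3)])
  then obtain U V where UV: "\<And>l u w. l \<in> {-1, 0, 1} \<Longrightarrow> u < n2 \<Longrightarrow> w < n1 \<Longrightarrow>
      Cl l u w = (\<Sum>\<kappa><k. U l u \<kappa> * V l \<kappa> w)" by metis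
  show "\<sigma> s ?X \<le> 3 * M * (1 / t) powr ((real s - 3 * real k) / (6 * real k))"
    using F.singular_value_low_rank[OF X Xe UV k s] by (simp only: M F.x_def)
  assume s2: "s \<ge> 2" and tri: "\<And>l. l \<in> {-1, 0, 1} \<Longrightarrow> tridiagonal (A l)"
  \<comment> \<open>Row n1 + u and column w < n1 are adjacent only for \<open>u = 0\<close> and
    \<open>w = n1 - 1\<close>, so tridiagonality leaves a single corner entry.\<close>
  have corner: "Cl l u w = (if u = 0 \<and> w = n1 - 1 then Cl l 0 (n1 - 1) else 0)"
    if l: "l \<in> {-1, 0, 1}" and u: "u < n2" and w: "w < n1" for l u w
  proof (cases "u = 0 \<and> w = n1 - 1")
    case False
    hence "w + 1 < n1 + u" using w by linarith
    thus ?thesis using tri[OF l] A[OF l] u w n False by (auto simp: tridiagonal_def Cl_def)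
  qed auto
  show "\<sigma> s ?X \<le> M * (1 / t) powr (real s / 2)"
    using F.singular_value_corner[OF X Xe corner _ _ s2] n by (simp only: M F.x_def)
qed

end

subsection \<open>Main theorem\<close>

theorem theorem4p1:
  fixes m k :: nat and A :: "int \<Rightarrow> complex mat" and L t \<delta> :: real
    and \<phi> \<psi> :: "complex \<Rightarrow> complex mat"
  assumes "m \<ge> 1" and "k \<ge> 1"
    and "\<forall>i\<in>{-1, 0, 1}. A i \<in> carrier_mat m m"
    and "\<forall>z. \<phi> z = qbd_symbol m A z"
    and "\<forall>i\<in>{-1, 0, 1}. \<forall>r<m. \<forall>c<m. A i $$ (r, c) \<in> \<real>\<^sub>\<ge>\<^sub>0"
    and "\<forall>z. cmod z = 1 \<longrightarrow> spectral_radius (1\<^sub>m m - \<phi> z) < 1"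
    and "\<forall>i\<in>{-1, 0, 1}. quasiseparable k (A i) \<and> spectral_norm (A i) \<le> L"
    and "t > 1" and "\<delta> > 0"
    and "\<forall>z\<in>annulus (1 / t) t. Determinant.det (\<phi> z) \<noteq> 0"
    and "\<forall>z\<in>annulus (1 / t) t. inverts_mat (\<phi> z) (\<psi> z) \<and> inverts_mat (\<psi> z) (\<phi> z)"
    and "\<forall>z\<in>annulus (1 / t) t. spectral_norm (\<psi> z) \<le> \<delta>"
  shows "(\<forall>z\<in>annulus (1 / t) t. spectral_radius (1\<^sub>m m - \<phi> z) < 1) \<and>
    (\<forall>n1 n2 E B C D E' B' C' D'.
       n1 \<ge> 1 \<and> n2 \<ge> 1 \<and> n1 + n2 = m \<and>
       (\<forall>z\<in>annulus (1 / t) t.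
          {E z, E' z} \<subseteq> carrier_mat n1 n1 \<and> {B z, B' z} \<subseteq> carrier_mat n1 n2 \<and>
          {C z, C' z} \<subseteq> carrier_mat n2 n1 \<and> {D z, D' z} \<subseteq> carrier_mat n2 n2 \<and>
          \<phi> z = four_block_mat (1\<^sub>m n1 - E z) (- B z) (- C z) (1\<^sub>m n2 - D z) \<and>
          \<psi> z = four_block_mat (E' z) (B' z) (C' z) (D' z)) \<longrightarrow>
       (\<forall>z\<in>annulus (1 / t) t. invertible_mat (1\<^sub>m n1 - E z) \<and> invertible_mat (1\<^sub>m n2 - D z)) \<and>
       (\<exists>c. laurent_series_on (1 / t) t n2 n1 c C' \<and>
          (\<forall>h N M z s.
             N = 2 ^ h \<and>
             M = 4 * L * \<delta>\<^sup>2 / ((1 - exp (- (real N * ln t))) * (1 - 1 / t)) \<and>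
             cmod z = 1 \<and> s \<ge> 1 \<longrightarrow>
             \<sigma> s (laurent_eval (I_op N c) z)
               \<le> 3 * M * exp (- ((real s - 3 * real k) / (6 * real k) * ln t)) \<and>
             ((\<forall>i\<in>{-1, 0, 1}. tridiagonal (A i)) \<and> s \<ge> 2 \<longrightarrow>
               \<sigma> s (laurent_eval (I_op N c) z) \<le> M * exp (- (real s / 2 * ln t))))))"
proof (intro conjI)
  interpret qbd m A L t \<delta> \<phi> \<psi>
    using assms by unfold_locales auto
  show "\<forall>z\<in>annulus (1 / t) t. spectral_radius (1\<^sub>m m - \<phi> z) < 1"
    using spectral_radius_annulus by blast
  have expt: "exp (- (y * ln t)) = (1 / t) powr y" for y
    using t by (simp add: powr_def ln_div)
  have expN: "(1 / t) powr real N = (1 / t) ^ N" for N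
    using t by (simp add: powr_realpow)
  show "\<forall>n1 n2 E B C D E' B' C' D'.
       n1 \<ge> 1 \<and> n2 \<ge> 1 \<and> n1 + n2 = m \<and>
       (\<forall>z\<in>annulus (1 / t) t.
          {E z, E' z} \<subseteq> carrier_mat n1 n1 \<and> {B z, B' z} \<subseteq> carrier_mat n1 n2 \<and>
          {C z, C' z} \<subseteq> carrier_mat n2 n1 \<and> {D z, D' z} \<subseteq> carrier_mat n2 n2 \<and>
          \<phi> z = four_block_mat (1\<^sub>m n1 - E z) (- B z) (- C z) (1\<^sub>m n2 - D z) \<and>
          \<psi> z = four_block_mat (E' z) (B' z) (C' z) (D' z)) \<longrightarrow>
       (\<forall>z\<in>annulus (1 / t) t. invertible_mat (1\<^sub>m n1 - E z) \<and> invertible_mat (1\<^sub>m n2 - D z)) \<and>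
       (\<exists>c. laurent_series_on (1 / t) t n2 n1 c C' \<and>
          (\<forall>h N M z s.
             N = 2 ^ h \<and>
             M = 4 * L * \<delta>\<^sup>2 / ((1 - exp (- (real N * ln t))) * (1 - 1 / t)) \<and>
             cmod z = 1 \<and> s \<ge> 1 \<longrightarrow>
             \<sigma> s (laurent_eval (I_op N c) z)
               \<le> 3 * M * exp (- ((real s - 3 * real k) / (6 * real k) * ln t)) \<and>
             ((\<forall>i\<in>{-1, 0, 1}. tridiagonal (A i)) \<and> s \<ge> 2 \<longrightarrow>
               \<sigma> s (laurent_eval (I_op N c) z) \<le> M * exp (- (real s / 2 * ln t)))))"
  proof (intro allI impI, elim conjE)
    fix n1 n2 :: nat and E B C D E' B' C' D' :: "complex \<Rightarrow> complex mat"
    assume n: "n1 \<ge> 1" "n2 \<ge> 1" "n1 + n2 = m"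
      and blocks: "\<forall>z\<in>annulus (1 / t) t.
          {E z, E' z} \<subseteq> carrier_mat n1 n1 \<and> {B z, B' z} \<subseteq> carrier_mat n1 n2 \<and>
          {C z, C' z} \<subseteq> carrier_mat n2 n1 \<and> {D z, D' z} \<subseteq> carrier_mat n2 n2 \<and>
          \<phi> z = four_block_mat (1\<^sub>m n1 - E z) (- B z) (- C z) (1\<^sub>m n2 - D z) \<and>
          \<psi> z = four_block_mat (E' z) (B' z) (C' z) (D' z)"
    interpret qbd_blocks m A L t \<delta> \<phi> \<psi> n1 n2
      using n by unfold_locales
    \<comment> \<open>Serves both diagonal blocks: offset 0 for I - E and offset n1 for I -
      D.\<close>
    have inv: "invertible_mat X"
      if "s + n \<le> m" "z \<in> annulus (1 / t) t" "X \<in> carrier_mat n n"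
        "\<And>i j. i < n \<Longrightarrow> j < n \<Longrightarrow> X $$ (i, j) = \<phi> z $$ (s + i, s + j)" for s n z X
    proof -
      have "X = mat n n (\<lambda>(i, j). (if i = j then 1 else 0) - \<alpha> z (s + i) (s + j))"
        using that by (intro eq_matI) (auto simp: \<phi>_index)
      with block_inverse[OF that(1,2)] that(3) show ?thesis
        unfolding invertible_mat_def inverts_mat_def
        by (intro conjI exI[of _ "mat n n (\<lambda>(i, j). block_neumann s n z i j)"]) auto
    qed
    have invertible: "invertible_mat (1\<^sub>m n1 - E z) \<and> invertible_mat (1\<^sub>m n2 - D z)"
      if z: "z \<in> annulus (1 / t) t" for z
    proof -
      from blocks z have E: "E z \<in> carrier_mat n1 n1" and D: "D z \<in> carrier_mat n2 n2"
        and \<phi>z: "\<phi> z = four_block_mat (1\<^sub>m n1 - E z) (- B z) (- C z) (1\<^sub>m n2 - D z)" by auto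
      note dims = carrier_matD[OF minus_carrier_mat[OF E, of "1\<^sub>m n1"]]
        carrier_matD[OF minus_carrier_mat[OF D, of "1\<^sub>m n2"]]
      show ?thesis
      proof
        show "invertible_mat (1\<^sub>m n1 - E z)"
          by (rule inv[OF _ z minus_carrier_mat[OF E], of 0]) (use n in \<open>simp_all add: \<phi>z dims del: index_minus_mat\<close>)
        show "invertible_mat (1\<^sub>m n2 - D z)"
          by (rule inv[OF _ z minus_carrier_mat[OF D], of n1]) (use n in \<open>simp_all add: \<phi>z dims del: index_minus_mat\<close>)
      qed
    qed
    \<comment> \<open>One coefficient family serves all h, z and s; only its folding changes with
      h.\<close>
    have "laurent_series_on (1 / t) t n2 n1 lower_coeff_mat C'"
      unfolding laurent_series_on_def
    proof (intro conjI allI ballI impI)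
      show "lower_coeff_mat l \<in> carrier_mat n2 n1" for l by (simp add: lower_coeff_mat_def)
      fix z assume z: "z \<in> annulus (1 / t) t"
      from blocks z have E': "E' z \<in> carrier_mat n1 n1" and C': "C' z \<in> carrier_mat n2 n1"
        and D': "D' z \<in> carrier_mat n2 n2"
        and \<psi>z: "\<psi> z = four_block_mat (E' z) (B' z) (C' z) (D' z)" by auto
      show "C' z \<in> carrier_mat n2 n1" by (rule C')
      fix i j assume ij: "i < n2" "j < n1"
      have "\<psi> z $$ (n1 + i, j) = C' z $$ (i, j)"
        using ij E' D' by (simp add: \<psi>z)
      with lower_coeff_laurent[OF z ij]
      show "((\<lambda>l. z powi l * lower_coeff_mat l $$ (i, j)) has_sum C' z $$ (i, j)) UNIV"
        using ij by (simp add: lower_coeff_mat_def)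
    qed
    moreover have "\<sigma> s (laurent_eval (I_op N lower_coeff_mat) z)
               \<le> 3 * M * exp (- ((real s - 3 * real k) / (6 * real k) * ln t)) \<and>
             ((\<forall>i\<in>{-1, 0, 1}. tridiagonal (A i)) \<and> s \<ge> 2 \<longrightarrow>
               \<sigma> s (laurent_eval (I_op N lower_coeff_mat) z) \<le> M * exp (- (real s / 2 * ln t)))"
      if "N = 2 ^ h" "M = 4 * L * \<delta>\<^sup>2 / ((1 - exp (- (real N * ln t))) * (1 - 1 / t))"
        "cmod z = 1" "s \<ge> 1" for h N :: nat and M z s
    proof -
      have N: "N > 0" using that(1) by simp
      have q: "quasiseparable k (A l)" if "l \<in> {-1, 0, 1}" for l using assms(7) that by blast
      note sv = I_op_singular_values[OF N that(3,4) assms(2) q]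
      show ?thesis
        unfolding that(2) expt expN
      proof (intro conjI impI, goal_cases)
        case 1
        show ?case by (rule sv(1))
      next
        case 2
        hence "tridiagonal (A l)" if "l \<in> {-1, 0, 1}" for l using that by blast
        with 2 show ?case by (intro sv(2)) auto
      qed
    qed
    ultimately show "(\<forall>z\<in>annulus (1 / t) t. invertible_mat (1\<^sub>m n1 - E z) \<and> invertible_mat (1\<^sub>m n2 - D z)) \<and>
       (\<exists>c. laurent_series_on (1 / t) t n2 n1 c C' \<and>
          (\<forall>h N M z s.
             N = 2 ^ h \<and>
             M = 4 * L * \<delta>\<^sup>2 / ((1 - exp (- (real N * ln t))) * (1 - 1 / t)) \<and>
             cmod z = 1 \<and> s \<ge> 1 \<longrightarrow>
             \<sigma> s (laurent_eval (I_op N c) z)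
               \<le> 3 * M * exp (- ((real s - 3 * real k) / (6 * real k) * ln t)) \<and>
             ((\<forall>i\<in>{-1, 0, 1}. tridiagonal (A i)) \<and> s \<ge> 2 \<longrightarrow>
               \<sigma> s (laurent_eval (I_op N c) z) \<le> M * exp (- (real s / 2 * ln t)))))"
      using invertible by blast
  qed
qed

end
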